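(* Let $G_+\subset\mathbb{C}$ be a bounded finitely connected domain whose boundary $C=\partial G_+$ is a rectifiable Carleson curve, consisting of finitely many pairwise disjoint simple closed curves, oriented positively with respect to $G_+$. Let $w\colon C\to[0,\infty)$ be a measurable weight such that $w\not\equiv 0$ on each connected component of $C$, and suppose that the Cauchy singular integral operator $$(\mathcal{K}_S f)(\lambda)=\lim_{\varepsilon\to 0}\frac{1}{2\pi i}\int_{\{z\in C:\,|z-\lambda|\ge\varepsilon\}}\frac{f(z)}{z-\lambda}\,dz,\qquad \lambda\in C,$$ is bounded in $L^2(C,w(z)|dz|)$. Then $\mathcal{K}_S$ is self-adjoint in the Hilbert space $L^2(C,w(z)|dz|)$ if and only if the curve $C$ is a circle and $w$ is constant on $C$.
   Context: $|dz|$ denotes arc-length measure on $C$. The inner product on $L^2(C,w(z)|dz|)$ is $(f,g)_{L^2(C,w)}=\frac{1}{2\pi}\int_C f(z)\overline{g(z)}\,w(z)\,|dz|$. A rectifiable curve $C$ is a Carleson curve if $\sup_{z\in C,\,\varepsilon>0}\varepsilon^{-1}\,|C\cap D(z,\varepsilon)|<\infty$, where $D(z,\varepsilon)=\{\zeta:|\zeta-z|<\varepsilon\}$ and $|\cdot|$ is arc length. Statements about $w$ (such as $w\not\equiv0$ or $w$ constant) are understood up to sets of arc-length measure zero. Boundedness of $\mathcal{K}_S$ in $L^2(C,w(z)|dz|)$ is equivalent (known fact) to the Muckenhoupt condition $(C,w^{1/2})\in A_2$, i.e. $\sup_{z\in C,\,\varepsilon>0}\left(\frac1\varepsilon\int_{C\cap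 D(z,\varepsilon)}w\,|d\zeta|\right)^{1/2}\left(\frac1\varepsilon\int_{C\cap D(z,\varepsilon)}w^{-1}\,|d\zeta|\right)^{1/2}<\infty$; in particular it implies $w\in L^1(C,|dz|)$. *)

theory Defs
  imports "HOL-Complex_Analysis.Complex_Analysis"
begin

section \<open>Rectifiable curves and arc length\<close>

text \<open>
  Lengths of the polygons inscribed in \<open>\<gamma>\<close> over \<open>[a, b]\<close>. Every finite partition is a prefix of
  a monotone sequence that is eventually constant, so the vertices are given by a sequence.
\<close>

definition inscribed_lengths :: "(real \<Rightarrow> complex) \<Rightarrow> real \<Rightarrow> real \<Rightarrow> real set" where
  "inscribed_lengths \<gamma> a b =
     {(\<Sum>k<m. dist (\<gamma> (p k)) (\<gamma> (p (Suc k)))) | (m :: nat) (p :: nat \<Rightarrow> real).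
        mono p \<and> range p \<subseteq> {a..b}}"

definition rectifiable :: "(real \<Rightarrow> complex) \<Rightarrow> bool" where
  "rectifiable \<gamma> \<longleftrightarrow> bdd_above (inscribed_lengths \<gamma> 0 1)"

definition arc_length :: "(real \<Rightarrow> complex) \<Rightarrow> real \<Rightarrow> real \<Rightarrow> real" where
  "arc_length \<gamma> a b = Sup (inscribed_lengths \<gamma> a b)"

text \<open>
  Paths live on \<open>[0, 1]\<close>, whereas \<^const>\<open>interval_measure\<close> takes a function on the whole line.
  Parameters are therefore clamped to \<open>[0, 1]\<close>, so that the resulting measures vanish outside it.
\<close>

definition clamp01 :: "real \<Rightarrow> real" where
  "clamp01 t = min 1 (max 0 t)"

definition length_fun :: "(real \<Rightarrow> complex) \<Rightarrow> real \<Rightarrow> real" where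
  "length_fun \<gamma> t = arc_length \<gamma> 0 (clamp01 t)"

definition cycle_image :: "(real \<Rightarrow> complex) set \<Rightarrow> complex set" where
  "cycle_image \<Gamma> = (\<Union>\<gamma>\<in>\<Gamma>. path_image \<gamma>)"

text \<open>The measure \<open>|dz|\<close> on the union \<open>C\<close> of the (simple, pairwise disjoint) curves in \<open>\<Gamma>\<close>.\<close>

definition arclength_measure :: "(real \<Rightarrow> complex) set \<Rightarrow> complex measure" where
  "arclength_measure \<Gamma> =
     measure_of (cycle_image \<Gamma>) (sets (restrict_space borel (cycle_image \<Gamma>)))
       (\<lambda>A. \<Sum>\<gamma>\<in>\<Gamma>. emeasure (interval_measure (length_fun \<gamma>)) {t \<in> {0..1}. \<gamma> t \<in> A})"

lemma space_arclength_measure [simp]: "space (arclength_measure \<Gamma>) = cycle_image \<Gamma>"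
  by (simp add: arclength_measure_def space_measure_of_conv)

lemma sets_arclength_measure [simp, measurable_cong]:
  "sets (arclength_measure \<Gamma>) = sets (restrict_space borel (cycle_image \<Gamma>))"
proof -
  have "space (restrict_space borel (cycle_image \<Gamma>)) = cycle_image \<Gamma>"
    by (simp add: space_restrict_space)
  then show ?thesis
    using sets.sets_measure_of_eq[of "restrict_space borel (cycle_image \<Gamma>)"]
    unfolding arclength_measure_def by (simp add: sets_measure_of_conv)
qed

lemma emeasure_arclength_measure:
  assumes "\<And>\<gamma>. \<gamma> \<in> \<Gamma> \<Longrightarrow> path \<gamma>" and A: "A \<in> sets (restrict_space borel (cycle_image \<Gamma>))"
  shows "emeasure (arclength_measure \<Gamma>) A =
    (\<Sum>\<gamma>\<in>\<Gamma>. emeasure (interval_measure (length_fun \<gamma>)) {t \<in> {0..1}. \<gamma> t \<in> A})"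
proof -
  have meas: "{t \<in> {0..1}. \<gamma> t \<in> B} \<in> sets borel"
    if "\<gamma> \<in> \<Gamma>" "B \<in> sets (restrict_space borel (cycle_image \<Gamma>))" for \<gamma> B
  proof -
    obtain B' where B': "B' \<in> sets borel" "B = cycle_image \<Gamma> \<inter> B'"
      using \<open>B \<in> _\<close> by (auto simp: sets_restrict_space)
    have "\<gamma> \<in> borel_measurable (restrict_space borel {0..1})"
      using assms(1)[OF \<open>\<gamma> \<in> \<Gamma>\<close>] unfolding path_def
      by (rule borel_measurable_continuous_on_restrict)
    from measurable_sets[OF this B'(1)]
    have "\<gamma> -` B' \<inter> {0..1} \<in> sets borel"
      by (simp add: space_restrict_space sets_restrict_space_iff)
    moreover have "\<gamma> -` B' \<inter> {0..1} = {t \<in> {0..1}. \<gamma> t \<in> B}"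
      using \<open>\<gamma> \<in> \<Gamma>\<close> unfolding B'(2) cycle_image_def path_image_def by blast
    ultimately show ?thesis by simp
  qed
  show ?thesis
  proof (rule emeasure_measure_of[OF arclength_measure_def])
    show "sets (restrict_space borel (cycle_image \<Gamma>)) \<subseteq> Pow (cycle_image \<Gamma>)"
      using sets.space_closed[of "restrict_space borel (cycle_image \<Gamma>)"]
      by (simp add: space_restrict_space)
    show "A \<in> sets (arclength_measure \<Gamma>)" using A by simp
    show "positive (sets (arclength_measure \<Gamma>))
        (\<lambda>A. \<Sum>\<gamma>\<in>\<Gamma>. emeasure (interval_measure (length_fun \<gamma>)) {t \<in> {0..1}. \<gamma> t \<in> A})"
      by (simp add: positive_def)
    show "countably_additive (sets (arclength_measure \<Gamma>))
        (\<lambda>A. \<Sum>\<gamma>\<in>\<Gamma>. emeasure (interval_measure (length_fun \<gamma>)) {t \<in> {0..1}. \<gamma> t \<in> A})"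
    proof (rule countably_additiveI)
      fix F :: "nat \<Rightarrow> complex set"
      assume F: "range F \<subseteq> sets (arclength_measure \<Gamma>)" "disjoint_family F"
      have "(\<Sum>i. emeasure (interval_measure (length_fun \<gamma>)) {t \<in> {0..1}. \<gamma> t \<in> F i}) =
            emeasure (interval_measure (length_fun \<gamma>)) {t \<in> {0..1}. \<gamma> t \<in> (\<Union>i. F i)}"
        if "\<gamma> \<in> \<Gamma>" for \<gamma>
      proof -
        have "(\<Sum>i. emeasure (interval_measure (length_fun \<gamma>)) {t \<in> {0..1}. \<gamma> t \<in> F i}) =
              emeasure (interval_measure (length_fun \<gamma>)) (\<Union>i. {t \<in> {0..1}. \<gamma> t \<in> F i})"
        proof (rule suminf_emeasure)
          show "range (\<lambda>i. {t \<in> {0..1}. \<gamma> t \<in> F i}) \<subseteq> sets (interval_measure (length_fun \<gamma>))"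
            using F(1) meas[OF that] by auto
          show "disjoint_family (\<lambda>i. {t \<in> {0..1}. \<gamma> t \<in> F i})"
            using F(2) by (auto simp: disjoint_family_on_def)
        qed
        also have "(\<Union>i. {t \<in> {0..1}. \<gamma> t \<in> F i}) = {t \<in> {0..1}. \<gamma> t \<in> (\<Union>i. F i)}"
          by auto
        finally show ?thesis .
      qed
      note eq = this
      show "(\<Sum>i. \<Sum>\<gamma>\<in>\<Gamma>. emeasure (interval_measure (length_fun \<gamma>)) {t \<in> {0..1}. \<gamma> t \<in> F i}) =
          (\<Sum>\<gamma>\<in>\<Gamma>. emeasure (interval_measure (length_fun \<gamma>)) {t \<in> {0..1}. \<gamma> t \<in> \<Union> (range F)})"
        by (subst suminf_sum) (simp, rule sum.cong[OF refl eq])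
    qed
  qed
qed

definition carleson :: "(real \<Rightarrow> complex) set \<Rightarrow> bool" where
  "carleson \<Gamma> \<longleftrightarrow>
     (\<exists>M::real. \<forall>z\<in>cycle_image \<Gamma>. \<forall>\<epsilon>>0.
        emeasure (arclength_measure \<Gamma>) (cycle_image \<Gamma> \<inter> ball z \<epsilon>) \<le> ennreal (M * \<epsilon>))"


section \<open>Integration against \<open>dz\<close>\<close>

text \<open>
  Lebesgue--Stieltjes integral \<open>\<integral> g(t) d\<phi>(t)\<close> for a real function \<open>\<phi>\<close> that is the difference of the
  nondecreasing functions \<open>L + \<phi>\<close> and \<open>L\<close>.
\<close>

definition stieltjes_integral :: "(real \<Rightarrow> real) \<Rightarrow> (real \<Rightarrow> real) \<Rightarrow> (real \<Rightarrow> complex) \<Rightarrow> complex" where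
  "stieltjes_integral L \<phi> g =
     (LINT t:{0..1}|interval_measure (\<lambda>t. L t + \<phi> t). g t) -
     (LINT t:{0..1}|interval_measure L. g t)"

text \<open>
  \<open>\<integral> f dz = \<integral> f dx + i \<integral> f dy\<close> along \<open>\<gamma> = x + i y\<close>. The length function dominates the
  variation of \<open>x\<close> and of \<open>y\<close>, so it can play the role of \<open>L\<close>, and a Borel function
  that is integrable for \<open>|dz|\<close> is integrable for all measures involved.
\<close>

definition curve_integral :: "(real \<Rightarrow> complex) \<Rightarrow> (complex \<Rightarrow> complex) \<Rightarrow> complex" where
  "curve_integral \<gamma> f =
     stieltjes_integral (length_fun \<gamma>) (\<lambda>t. Re (\<gamma> (clamp01 t))) (\<lambda>t. f (\<gamma> t)) +
     \<i> * stieltjes_integral (length_fun \<gamma>) (\<lambda>t. Im (\<gamma> (clamp01 t))) (\<lambda>t. f (\<gamma> t))"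

definition cycle_integral :: "(real \<Rightarrow> complex) set \<Rightarrow> (complex \<Rightarrow> complex) \<Rightarrow> complex" where
  "cycle_integral \<Gamma> f = (\<Sum>\<gamma>\<in>\<Gamma>. curve_integral \<gamma> f)"


section \<open>The space \<open>L\<^sup>2\<close>\<close>

text \<open>
  Elements of \<open>L\<^sup>2(\<nu>)\<close> are represented by functions; equality in \<open>L\<^sup>2(\<nu>)\<close> is equality
  \<open>\<nu>\<close>-almost everywhere.
\<close>

definition weighted_measure :: "(real \<Rightarrow> complex) set \<Rightarrow> (complex \<Rightarrow> real) \<Rightarrow> complex measure" where
  "weighted_measure \<Gamma> w = density (arclength_measure \<Gamma>) (\<lambda>z. ennreal (w z))"

definition L2 :: "complex measure \<Rightarrow> (complex \<Rightarrow> complex) set" where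
  "L2 \<nu> = {f \<in> borel_measurable \<nu>. integrable \<nu> (\<lambda>z. (cmod (f z))\<^sup>2)}"

definition L2_inner :: "complex measure \<Rightarrow> (complex \<Rightarrow> complex) \<Rightarrow> (complex \<Rightarrow> complex) \<Rightarrow> complex" where
  "L2_inner \<nu> f g = 1 / (2 * pi) * (LINT z|\<nu>. f z * cnj (g z))"

definition L2_norm :: "complex measure \<Rightarrow> (complex \<Rightarrow> complex) \<Rightarrow> real" where
  "L2_norm \<nu> f = sqrt (1 / (2 * pi) * (LINT z|\<nu>. (cmod (f z))\<^sup>2))"

text \<open>A bounded, everywhere defined operator is self-adjoint iff it equals its adjoint, that is:\<close>

definition self_adjoint_in_L2 ::
    "complex measure \<Rightarrow> ((complex \<Rightarrow> complex) \<Rightarrow> complex \<Rightarrow> complex) \<Rightarrow> bool" where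
  "self_adjoint_in_L2 \<nu> T \<longleftrightarrow>
     (\<forall>f\<in>L2 \<nu>. T f \<in> L2 \<nu>) \<and>
     (\<forall>f\<in>L2 \<nu>. \<forall>g\<in>L2 \<nu>. L2_inner \<nu> (T f) g = L2_inner \<nu> f (T g))"


section \<open>The Cauchy singular integral operator\<close>

definition truncated_kernel ::
    "(complex \<Rightarrow> complex) \<Rightarrow> complex \<Rightarrow> real \<Rightarrow> complex \<Rightarrow> complex" where
  "truncated_kernel f \<zeta> \<epsilon> z = (if cmod (z - \<zeta>) \<ge> \<epsilon> then f z / (z - \<zeta>) else 0)"

text \<open>
  Integrability is demanded explicitly, because the Bochner integral of a non-integrable
  function is \<open>0\<close> by convention.
\<close>

definition has_cauchy_pv ::
    "(real \<Rightarrow> complex) set \<Rightarrow> (complex \<Rightarrow> complex) \<Rightarrow> complex \<Rightarrow> complex \<Rightarrow> bool" where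
  "has_cauchy_pv \<Gamma> f \<zeta> l \<longleftrightarrow>
     (\<forall>\<epsilon>>0. integrable (arclength_measure \<Gamma>) (truncated_kernel f \<zeta> \<epsilon>)) \<and>
     ((\<lambda>\<epsilon>. 1 / (2 * pi * \<i>) * cycle_integral \<Gamma> (truncated_kernel f \<zeta> \<epsilon>)) \<longlongrightarrow> l) (at_right 0)"

definition cauchy_singular ::
    "(real \<Rightarrow> complex) set \<Rightarrow> (complex \<Rightarrow> complex) \<Rightarrow> complex \<Rightarrow> complex" where
  "cauchy_singular \<Gamma> f \<zeta> =
     (if \<exists>l. has_cauchy_pv \<Gamma> f \<zeta> l then THE l. has_cauchy_pv \<Gamma> f \<zeta> l else 0)"

text \<open>
  Boundedness of the operator in \<open>L\<^sup>2(C, w |dz|)\<close>: for every \<open>f\<close> in the space the principal value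
  exists almost everywhere, and it defines an element of the space with norm at most \<open>M\<close> times
  the norm of \<open>f\<close>.
\<close>

definition cauchy_singular_bounded ::
    "(real \<Rightarrow> complex) set \<Rightarrow> (complex \<Rightarrow> real) \<Rightarrow> bool" where
  "cauchy_singular_bounded \<Gamma> w \<longleftrightarrow>
     (\<exists>M. \<forall>f\<in>L2 (weighted_measure \<Gamma> w).
        (AE \<zeta> in weighted_measure \<Gamma> w. \<exists>l. has_cauchy_pv \<Gamma> f \<zeta> l) \<and>
        cauchy_singular \<Gamma> f \<in> L2 (weighted_measure \<Gamma> w) \<and>
        L2_norm (weighted_measure \<Gamma> w) (cauchy_singular \<Gamma> f) \<le> M * L2_norm (weighted_measure \<Gamma> w) f)"


section \<open>Boundary cycles\<close>

text \<open>
  The orientation is positive with respect to \<open>G\<close>: the cycle winds once around the points of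
  \<open>G\<close> and not at all around the points outside the closure of \<open>G\<close>. Equivalently, the outer
  boundary curve runs counterclockwise and the inner ones clockwise.
\<close>

definition positively_oriented :: "(real \<Rightarrow> complex) set \<Rightarrow> complex set \<Rightarrow> bool" where
  "positively_oriented \<Gamma> G \<longleftrightarrow>
     (\<forall>z. z \<notin> cycle_image \<Gamma> \<longrightarrow> (\<Sum>\<gamma>\<in>\<Gamma>. winding_number \<gamma> z) = (if z \<in> G then 1 else 0))"

text \<open>
  For bounded \<open>G\<close>, finite connectivity (finitely many components of the complement in the Riemann
  sphere) is the same as finiteness of the number of components of the complement in the plane.
\<close>

definition finitely_connected_domain :: "complex set \<Rightarrow> bool" where
  "finitely_connected_domain G \<longleftrightarrow>
     open G \<and> connected G \<and> G \<noteq> {} \<and> finite (components (- G))"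

definition boundary_cycle :: "(real \<Rightarrow> complex) set \<Rightarrow> complex set \<Rightarrow> bool" where
  "boundary_cycle \<Gamma> G \<longleftrightarrow>
     finite \<Gamma> \<and>
     (\<forall>\<gamma>\<in>\<Gamma>. simple_path \<gamma> \<and> pathfinish \<gamma> = pathstart \<gamma>) \<and>
     disjoint_family_on path_image \<Gamma> \<and>
     frontier G = cycle_image \<Gamma> \<and>
     positively_oriented \<Gamma> G"

end

theory Submission
  imports Defs
begin

text \<open>
  Write \<open>dz = \<tau> |dz|\<close>. The densities of the Stieltjes measures of \<open>dx\<close> and \<open>dy\<close> with respect to \<open>|dz|\<close>
  provide \<open>\<tau>\<close>, and \<open>|\<tau>| = 1\<close> because inscribed polygons exhaust the arc length.

  Testing self-adjointness on indicators of separated sets on which \<open>w\<close> is bounded gives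
  \<open>w(\<zeta>) \<tau>(z) / (z - \<zeta>) = w(z) cnj (\<tau>(\<zeta>) / (z - \<zeta>))\<close> for almost all pairs. Absolute values show that
  \<open>w\<close> is constant. Dividing the identities for two fixed points \<open>z1\<close>, \<open>z2\<close> eliminates \<open>\<tau>(\<zeta>)\<close> and says that
  \<open>\<zeta>\<close> sees \<open>z1\<close> and \<open>z2\<close> under a constant angle modulo \<open>\<pi>\<close>, so the boundary lies on a circle or a line; a
  bounded open set with boundary in a line is empty, and with boundary in a circle it is the disc.

  Conversely, on a circle \<open>\<tau>(z) = i (z - a) / r\<close>, and \<open>(z - a) / (z - \<zeta>)\<close> is a Hermitian kernel. Up to the
  constant \<open>1/2\<close> it is odd under reflection in the diameter through \<open>\<zeta>\<close>, so the truncated integrals of a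
  Lipschitz function are uniformly bounded. Dominated convergence gives the symmetry on Lipschitz
  functions, which are dense, and boundedness extends it to the whole space.
\<close>

subsection \<open>Vanishing of integrable functions\<close>

text \<open>The densities of \<open>dx\<close> and \<open>dy\<close> alone would only bound
  \<open>cmod \<tau>\<close> by the square root of 2. The sharp bound comes from treating all
  rotated coordinates \<open>Re (cis q * \<gamma>)\<close> alike: their variation is dominated by
  arc length too, so \<open>cmod \<tau> \<le> 1\<close> is an intersection of half-plane conditions,
  and countably many directions suffice. Separation of the test sets is what keeps the necessity
  argument elementary: away from the support the principal value is an ordinary integral and Fubini
  applies. In the converse there is no separation, and for general functions the truncated integrals
  have no known majorant; this is why Lipschitz functions come in, and why boundedness is used both
  for the existence of the limits and for the passage to the closure. The parametrization of the
  circle is arbitrary, so arc length and tangent have to be extracted from a continuous branch of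
  the angle. The orientation enters as winding number 1 about the centre, which makes this angle
  increase by \<open>2 * pi\<close>.\<close>

lemma set_integrable_if_integrable:
  fixes f :: "'a \<Rightarrow> 'b::{banach,second_countable_topology}"
  shows "integrable M f \<Longrightarrow> A \<in> sets M \<Longrightarrow> set_integrable M A f"
  unfolding set_integrable_def by (rule integrable_mult_indicator)

text \<open>The sets over which the integral of \<open>f\<close> vanishes form a Dynkin system:
  complements use \<open>total\<close>, disjoint unions use countable additivity. The total integral
  is a separate hypothesis because the space itself need not belong to \<open>G\<close>.\<close>

lemma AE_zero_if_integral_zero_generator:
  fixes f :: "'a \<Rightarrow> 'b::{second_countable_topology,banach}"
  assumes "sigma_finite_measure M" and f: "integrable M f"
    and G: "Int_stable G" "G \<subseteq> Pow (space M)" "sets M = sigma_sets (space M) G"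
    and total: "(\<integral>x. f x \<partial>M) = 0"
    and gen: "\<And>A. A \<in> G \<Longrightarrow> (LINT x:A|M. f x) = 0"
  shows "AE x in M. f x = 0"
proof (rule sigma_finite_measure.density_zero[OF assms(1) f])
  fix A assume "A \<in> sets M"
  then have "A \<in> sigma_sets (space M) G" using G(3) by simp
  with G(1,2) show "(LINT x:A|M. f x) = 0"
  proof (induction rule: sigma_sets_induct_disjoint)
    case (compl A)
    have A: "A \<in> sets M" using compl G(3) by simp
    have ss: "\<And>B. B \<in> sets M \<Longrightarrow> set_integrable M B f"
      by (rule set_integrable_if_integrable[OF f])
    have "(LINT x:space M|M. f x) = (LINT x:A|M. f x) + (LINT x:space M - A|M. f x)"
      using A sets.sets_into_space[OF A]
      by (subst set_integral_Un[symmetric]) (auto intro!: ss simp: Un_absorb1)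
    moreover have "(LINT x:space M|M. f x) = 0"
      using total set_integral_space[OF f] by simp
    ultimately show ?case using compl by simp
  next
    case (union A)
    have A: "\<And>i. A i \<in> sets M" using union G(3) by auto
    have "(LINT x:(\<Union>i. A i)|M. f x) = (\<Sum>i. LINT x:A i|M. f x)"
    proof (rule lebesgue_integral_countable_add)
      show "\<And>i. A i \<in> sets M" by (rule A)
      show "\<And>i j. i \<noteq> j \<Longrightarrow> A i \<inter> A j = {}"
        using union by (auto simp: disjoint_family_on_def)
      show "set_integrable M (\<Union>i. A i) f"
        using f A unfolding set_integrable_def by (intro integrable_mult_indicator) auto
    qed
    then show ?case using union by simp
  qed (use gen in \<open>auto simp: set_lebesgue_integral_def\<close>)
qed

text \<open>Half-open intervals are stable under intersection, and \<open>interval_measure\<close>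
  prescribes their masses. The integral over the whole line is recovered as the limit over
  \<open>{- real n<..real n}\<close>.\<close>

lemma real_AE_zero_if_interval_integrals_zero:
  fixes f :: "real \<Rightarrow> 'b::{second_countable_topology,banach}"
  assumes "sigma_finite_measure M" and f: "integrable M f" and M: "sets M = sets borel"
    and gen: "\<And>a b. a \<le> b \<Longrightarrow> (LINT x:{a<..b}|M. f x) = 0"
  shows "AE x in M. f x = 0"
proof (rule AE_zero_if_integral_zero_generator[OF assms(1) f, of "range (\<lambda>(a, b). {a <.. b::real})"])
  have sp: "space M = UNIV" using sets_eq_imp_space_eq[OF M] by simp
  show "Int_stable (range (\<lambda>(a, b). {a<..b::real}))"
    by (auto simp: Int_stable_def image_iff)
  show "range (\<lambda>(a, b). {a<..b}) \<subseteq> Pow (space M)" by (auto simp: sp)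
  show "sets M = sigma_sets (space M) (range (\<lambda>(a, b). {a<..b}))"
    unfolding M sp by (subst borel_sigma_sets_Ioc) simp
  have "(\<lambda>n. LINT x:{- real n<..real n}|M. f x) \<longlonglongrightarrow> (\<integral>x. f x \<partial>M)"
    unfolding set_lebesgue_integral_def
  proof (rule integral_dominated_convergence[where w="\<lambda>x. norm (f x)"])
    show "AE x in M. (\<lambda>n. indicat_real {- real n<..real n} x *\<^sub>R f x) \<longlonglongrightarrow> f x"
    proof (rule AE_I2, rule tendsto_eventually)
      fix x :: real
      obtain N :: nat where N: "\<bar>x\<bar> < N" using reals_Archimedean2 by blast
      show "\<forall>\<^sub>F n in sequentially. indicat_real {- real n<..real n} x *\<^sub>R f x = f x"
        using eventually_ge_at_top[of N]
        by eventually_elim (use N in \<open>auto simp: indicator_def\<close>)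
    qed
  next
    show "(\<lambda>x. indicat_real {- real n<..real n} x *\<^sub>R f x) \<in> borel_measurable M" for n
      using f by (intro borel_measurable_scaleR borel_measurable_indicator) (auto simp: M)
  qed (use f in \<open>auto simp: indicator_def\<close>)
  moreover have "(\<lambda>n. LINT x:{- real n<..real n}|M. f x) = (\<lambda>n. 0)"
    using gen by auto
  ultimately show "(\<integral>x. f x \<partial>M) = 0"
    using LIMSEQ_unique tendsto_const by metis
  show "(LINT x:A|M. f x) = 0" if A: "A \<in> range (\<lambda>(a, b). {a<..b})" for A
  proof -
    obtain ab where "A = (\<lambda>(a, b). {a<..b}) ab" using A by (rule rangeE)
    then obtain a b where "A = {a<..b}" by (cases ab) simp
    then show ?thesis using gen[of a b] by (cases "a \<le> b") (auto simp: set_lebesgue_integral_def)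
  qed
qed

subsection \<open>Arc length\<close>

lemma inscribed_lengths_mono:
  "a' \<le> a \<Longrightarrow> b \<le> b' \<Longrightarrow> inscribed_lengths \<gamma> a b \<subseteq> inscribed_lengths \<gamma> a' b'"
  unfolding inscribed_lengths_def by fastforce

lemma bdd_above_inscribed:
  "rectifiable \<gamma> \<Longrightarrow> 0 \<le> a \<Longrightarrow> b \<le> 1 \<Longrightarrow> bdd_above (inscribed_lengths \<gamma> a b)"
  unfolding rectifiable_def by (meson bdd_above_mono inscribed_lengths_mono)

lemma inscribed_lengthsI:
  "mono p \<Longrightarrow> range p \<subseteq> {a..b} \<Longrightarrow> (\<Sum>k<m. dist (\<gamma> (p k)) (\<gamma> (p (Suc k)))) \<in> inscribed_lengths \<gamma> a b"
  unfolding inscribed_lengths_def by blast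

lemma inscribed_lengths_nonempty: "a \<le> b \<Longrightarrow> inscribed_lengths \<gamma> a b \<noteq> {}"
  using inscribed_lengthsI[of "\<lambda>_. a" a b \<gamma> 0] by (auto simp: mono_def)

lemma clamp01_in: "clamp01 t \<in> {0..1}" by (auto simp: clamp01_def)

lemma clamp01_id: "t \<in> {0..1} \<Longrightarrow> clamp01 t = t" by (auto simp: clamp01_def)

lemma clamp01_mono: "s \<le> t \<Longrightarrow> clamp01 s \<le> clamp01 t"
  unfolding clamp01_def by (intro min.mono max.mono order_refl)

lemma continuous_on_clamp01: "continuous_on S clamp01"
  unfolding clamp01_def by (intro continuous_intros)

context
  fixes \<gamma> :: "real \<Rightarrow> complex"
  assumes rect: "rectifiable \<gamma>"
begin

lemma inscribed_le_arc_length: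
  assumes "mono p" "range p \<subseteq> {a..b}" "0 \<le> a" "b \<le> 1"
  shows "(\<Sum>k<m. dist (\<gamma> (p k)) (\<gamma> (p (Suc k)))) \<le> arc_length \<gamma> a b"
  unfolding arc_length_def
  by (rule cSup_upper[OF inscribed_lengthsI bdd_above_inscribed]) (use assms rect in auto)

lemma arc_length_le:
  assumes "a \<le> b"
    and "\<And>p m. mono p \<Longrightarrow> range p \<subseteq> {a..b} \<Longrightarrow> (\<Sum>k<m. dist (\<gamma> (p k)) (\<gamma> (p (Suc k)))) \<le> B"
  shows "arc_length \<gamma> a b \<le> B"
  unfolding arc_length_def
  by (rule cSup_least[OF inscribed_lengths_nonempty[OF assms(1)]])
     (use assms(2) in \<open>auto simp: inscribed_lengths_def\<close>)

lemma dist_le_arc_length: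
  assumes "0 \<le> s" "s \<le> t" "t \<le> 1"
  shows "dist (\<gamma> s) (\<gamma> t) \<le> arc_length \<gamma> s t"
proof -
  have "mono (\<lambda>k::nat. if k = 0 then s else t)" using assms by (auto simp: mono_def)
  moreover have "range (\<lambda>k::nat. if k = 0 then s else t) \<subseteq> {s..t}" using assms by auto
  ultimately show ?thesis
    using inscribed_le_arc_length[of "\<lambda>k. if k = 0 then s else t" s t 1] assms by simp
qed

lemma arc_length_nonneg: "0 \<le> s \<Longrightarrow> s \<le> t \<Longrightarrow> t \<le> 1 \<Longrightarrow> 0 \<le> arc_length \<gamma> s t"
  using dist_le_arc_length[of s t] zero_le_dist[of "\<gamma> s" "\<gamma> t"] by linarith

text \<open>Two partitions are run one after the other; the chord that links them can only add
  length.\<close>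

lemma arc_length_superadditive:
  assumes "0 \<le> a" "a \<le> b" "b \<le> c" "c \<le> 1"
  shows "arc_length \<gamma> a b + arc_length \<gamma> b c \<le> arc_length \<gamma> a c"
proof -
  let ?S = "\<lambda>p m. (\<Sum>k<m. dist (\<gamma> (p k)) (\<gamma> (p (Suc k))))"
  have key: "?S p m + ?S q n \<le> arc_length \<gamma> a c"
    if p: "mono p" "range p \<subseteq> {a..b}" and q: "mono q" "range q \<subseteq> {b..c}" for p q m n
  proof -
    define r where "r k = (if k \<le> m then p k else q (k - Suc m))" for k
    have "mono r"
    proof (rule monoI)
      fix x y :: nat assume "x \<le> y"
      moreover have "p x \<le> b" "b \<le> q (y - Suc m)"
        using range_subsetD[OF p(2), of x] range_subsetD[OF q(2), of "y - Suc m"] by auto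
      ultimately show "r x \<le> r y"
        using monoD[OF p(1), of x y] monoD[OF q(1), of "x - Suc m" "y - Suc m"]
        unfolding r_def by (auto intro: order_trans)
    qed
    moreover have "range r \<subseteq> {a..c}"
    proof -
      have "\<And>k. p k \<in> {a..b}" "\<And>k. q k \<in> {b..c}"
        using range_subsetD[OF p(2)] range_subsetD[OF q(2)] by auto
      then have pq: "a \<le> p k" "p k \<le> b" "b \<le> q k" "q k \<le> c" for k by simp_all
      have "r k \<in> {a..c}" for k
        using pq(1,2)[of k] pq(3,4)[of "k - Suc m"] assms(2,3) unfolding r_def by auto
      then show ?thesis by auto
    qed
    ultimately have "?S r (Suc m + n) \<le> arc_length \<gamma> a c"
      using assms by (intro inscribed_le_arc_length)
    moreover have "?S r (Suc m + n) = ?S r (Suc m) + (\<Sum>k<n. dist (\<gamma> (r (Suc m + k))) (\<gamma> (r (Suc (Suc m + k)))))"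
      by (induction n) simp_all
    moreover have "(\<Sum>k<n. dist (\<gamma> (r (Suc m + k))) (\<gamma> (r (Suc (Suc m + k))))) = ?S q n"
      by (rule sum.cong) (auto simp: r_def)
    moreover have "?S r (Suc m) = ?S r m + dist (\<gamma> (r m)) (\<gamma> (r (Suc m)))" by simp
    moreover have "?S r m = ?S p m" by (rule sum.cong) (auto simp: r_def)
    ultimately show ?thesis using zero_le_dist[of "\<gamma> (r m)" "\<gamma> (r (Suc m))"] by linarith
  qed
  have "arc_length \<gamma> a b \<le> arc_length \<gamma> a c - arc_length \<gamma> b c"
  proof (rule arc_length_le[OF assms(2)])
    fix p :: "nat \<Rightarrow> real" and m assume p: "mono p" "range p \<subseteq> {a..b}"
    have "arc_length \<gamma> b c \<le> arc_length \<gamma> a c - ?S p m"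
      using key[OF p] by (intro arc_length_le[OF assms(3)]) (simp add: algebra_simps)
    then show "?S p m \<le> arc_length \<gamma> a c - arc_length \<gamma> b c" by linarith
  qed
  then show ?thesis by linarith
qed

text \<open>A partition of \<open>{a..c}\<close> is cut at \<open>b\<close> by clamping its vertices
  with \<open>min b\<close> and \<open>max b\<close>. A chord survives on one side and collapses on
  the other, except the one that straddles \<open>b\<close>, where the triangle inequality is
  needed.\<close>

lemma arc_length_subadditive:
  assumes "0 \<le> a" "a \<le> b" "b \<le> c" "c \<le> 1"
  shows "arc_length \<gamma> a c \<le> arc_length \<gamma> a b + arc_length \<gamma> b c"
proof (rule arc_length_le)
  fix p :: "nat \<Rightarrow> real" and m assume p: "mono p" "range p \<subseteq> {a..c}"
  have pk: "a \<le> p k \<and> p k \<le> c" "p k \<le> p (Suc k)" for k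
    using range_subsetD[OF p(2), of k] p(1) by (auto simp: mono_def)
  have "dist (\<gamma> (p k)) (\<gamma> (p (Suc k))) \<le>
     dist (\<gamma> (min b (p k))) (\<gamma> (min b (p (Suc k)))) + dist (\<gamma> (max b (p k))) (\<gamma> (max b (p (Suc k))))" for k
    using pk[of k] dist_triangle[of "\<gamma> (p k)" "\<gamma> (p (Suc k))" "\<gamma> b"] by (auto simp: min_def max_def)
  then have "(\<Sum>k<m. dist (\<gamma> (p k)) (\<gamma> (p (Suc k)))) \<le>
    (\<Sum>k<m. dist (\<gamma> (min b (p k))) (\<gamma> (min b (p (Suc k))))) + (\<Sum>k<m. dist (\<gamma> (max b (p k))) (\<gamma> (max b (p (Suc k)))))"
    by (simp add: sum.distrib[symmetric] sum_mono)
  also have "\<dots> \<le> arc_length \<gamma> a b + arc_length \<gamma> b c"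
    by (intro add_mono inscribed_le_arc_length monoI min.mono max.mono order_refl monoD[OF p(1)])
       (use assms pk in auto)
  finally show "(\<Sum>k<m. dist (\<gamma> (p k)) (\<gamma> (p (Suc k)))) \<le> arc_length \<gamma> a b + arc_length \<gamma> b c" .
qed (use assms in auto)

lemma arc_length_add:
  "0 \<le> a \<Longrightarrow> a \<le> b \<Longrightarrow> b \<le> c \<Longrightarrow> c \<le> 1 \<Longrightarrow> arc_length \<gamma> a c = arc_length \<gamma> a b + arc_length \<gamma> b c"
  by (intro antisym arc_length_superadditive arc_length_subadditive)

text \<open>Fix a partition that misses less than \<open>e/2\<close> of the total length. If no
  vertex lies strictly between \<open>s\<close> and \<open>t\<close>, it contributes at most one
  chord in that gap, which continuity makes shorter than \<open>e/2\<close>; additivity then leaves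
  less than \<open>e\<close> for the arc.\<close>

lemma arc_length_small:
  assumes \<gamma>: "path \<gamma>" and e: "e > 0" and t: "t \<in> {0..1}"
  obtains d where "d > 0" "\<And>s. s \<in> {0..1} \<Longrightarrow> dist s t < d \<Longrightarrow> arc_length \<gamma> (min s t) (max s t) < e"
proof -
  let ?S = "\<lambda>p m. (\<Sum>k<m. dist (\<gamma> (p k)) (\<gamma> (p (Suc k))))"
  have "\<exists>x\<in>inscribed_lengths \<gamma> 0 1. arc_length \<gamma> 0 1 - e/2 < x"
    unfolding arc_length_def
    by (rule less_cSupE[of _ "inscribed_lengths \<gamma> 0 1"])
       (use e inscribed_lengths_nonempty[of 0 1] in auto)
  then obtain p m where p: "mono p" "range p \<subseteq> {0..1}" and S: "arc_length \<gamma> 0 1 - e/2 < ?S p m"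
    unfolding inscribed_lengths_def by auto
  \<comment> \<open>\<open>t\<close> itself may be a vertex; all other vertices keep the distance
    \<open>d1\<close>, so none lies inside the gap.\<close>
  obtain d1 where d1: "d1 > 0" "\<And>x. x \<in> p ` {..m} \<Longrightarrow> x \<noteq> t \<Longrightarrow> d1 \<le> dist t x"
    using finite_set_avoid[of "p ` {..m}" t] by auto
  have "continuous_on {0..1} \<gamma>" using \<gamma> by (simp add: path_def)
  then obtain d2 where d2: "d2 > 0" "\<And>s. s \<in> {0..1} \<Longrightarrow> dist s t < d2 \<Longrightarrow> dist (\<gamma> s) (\<gamma> t) < e/2"
    using t e unfolding continuous_on_iff by (meson half_gt_zero)
  show ?thesis
  proof
    show "min d1 d2 > 0" using d1 d2 by simp
    fix s assume s: "s \<in> {0..1}" "dist s t < min d1 d2"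
    define a b where "a = min s t" and "b = max s t"
    have ab: "0 \<le> a" "a \<le> b" "b \<le> 1" using s t by (auto simp: a_def b_def)
    have no: "p k \<le> a \<or> b \<le> p k" if "k \<le> m" for k
      using d1(2)[of "p k"] that s(2) by (cases "p k = t") (auto simp: a_def b_def dist_real_def)
    have mono_p: "p k \<le> p (Suc k)" for k using p by (auto simp: mono_def)
    \<comment> \<open>\<open>c\<close> is the part of the polygon inside the gap: it stays at
      \<open>a\<close> and, since \<open>p\<close> is monotone, jumps at most once to
      \<open>b\<close>.\<close>
    define c where "c k = (if p k \<le> a then a else b)" for k
    have c: "?S c n \<le> (if c n = b then dist (\<gamma> a) (\<gamma> b) else 0)" for n
    proof (induction n)
      case (Suc n)
      show ?case using Suc mono_p[of n] by (auto simp: c_def split: if_splits)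
    qed auto
    define A B where "A k = dist (\<gamma> (min a (p k))) (\<gamma> (min a (p (Suc k))))"
      and "B k = dist (\<gamma> (max b (p k))) (\<gamma> (max b (p (Suc k))))" for k
    have "dist (\<gamma> (p k)) (\<gamma> (p (Suc k))) \<le> A k + dist (\<gamma> (c k)) (\<gamma> (c (Suc k)))
       + B k" if "k \<in> {..<m}" for k
      using mono_p[of k] dist_triangle[of "\<gamma> (p k)" "\<gamma> (p (Suc k))" "\<gamma> a"] ab
        dist_triangle[of "\<gamma> a" "\<gamma> (p (Suc k))" "\<gamma> b"] no[of k] no[of "Suc k"] that[unfolded lessThan_iff]
      by (auto simp: min_def max_def c_def A_def B_def)
    then have "?S p m \<le> (\<Sum>k<m. A k + dist (\<gamma> (c k)) (\<gamma> (c (Suc k))) + B k)"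
      by (rule sum_mono)
    then have "?S p m \<le> (\<Sum>k<m. A k) + ?S c m + (\<Sum>k<m. B k)"
      unfolding sum.distrib .
    moreover have "(\<Sum>k<m. A k) \<le> arc_length \<gamma> 0 a"
      unfolding A_def by (intro inscribed_le_arc_length monoI min.mono order_refl monoD[OF p(1)])
        (use ab range_subsetD[OF p(2)] in auto)
    moreover have "(\<Sum>k<m. B k) \<le> arc_length \<gamma> b 1"
      unfolding B_def by (intro inscribed_le_arc_length monoI max.mono order_refl monoD[OF p(1)])
        (use ab range_subsetD[OF p(2)] in auto)
    moreover have "?S c m \<le> dist (\<gamma> a) (\<gamma> b)" using c[of m] by (auto split: if_splits intro: order_trans)
    moreover have "dist (\<gamma> a) (\<gamma> b) < e/2"
    proof -
      have "dist (\<gamma> s) (\<gamma> t) < e/2" using d2(2)[OF s(1)] s(2) by linarith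
      then show ?thesis by (simp add: a_def b_def min_def max_def dist_commute)
    qed
    moreover have "arc_length \<gamma> 0 1 = arc_length \<gamma> 0 a + arc_length \<gamma> a b + arc_length \<gamma> b 1"
      using arc_length_add[of 0 a 1] arc_length_add[of a b 1] ab by simp
    ultimately show "arc_length \<gamma> (min s t) (max s t) < e"
      using S unfolding a_def b_def by linarith
  qed
qed

lemma length_fun_diff:
  assumes "s \<le> t" shows "length_fun \<gamma> t - length_fun \<gamma> s = arc_length \<gamma> (clamp01 s) (clamp01 t)"
  using arc_length_add[of 0 "clamp01 s" "clamp01 t"] clamp01_in[of s] clamp01_in[of t] clamp01_mono[OF assms]
  by (auto simp: length_fun_def)

lemma length_fun_mono: "s \<le> t \<Longrightarrow> length_fun \<gamma> s \<le> length_fun \<gamma> t"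
  using length_fun_diff[of s t] arc_length_nonneg[of "clamp01 s" "clamp01 t"]
    clamp01_in[of s] clamp01_in[of t] clamp01_mono[of s t] by auto

lemma dist_le_length_fun:
  "s \<le> t \<Longrightarrow> dist (\<gamma> (clamp01 s)) (\<gamma> (clamp01 t)) \<le> length_fun \<gamma> t - length_fun \<gamma> s"
  using length_fun_diff[of s t] dist_le_arc_length[of "clamp01 s" "clamp01 t"]
    clamp01_in[of s] clamp01_in[of t] clamp01_mono[of s t] by auto

lemma continuous_length_fun:
  assumes "path \<gamma>" shows "continuous_on S (length_fun \<gamma>)"
proof -
  have "continuous_on {0..1} (arc_length \<gamma> 0)"
    unfolding continuous_on_iff
  proof safe
    fix t e :: real assume t: "t \<in> {0..1}" and "e > 0"
    then obtain d where d: "d > 0" "\<And>s. s \<in> {0..1} \<Longrightarrow> dist s t < d \<Longrightarrow> arc_length \<gamma> (min s t) (max s t) < e"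
      using arc_length_small[OF assms] by blast
    have "dist (arc_length \<gamma> 0 s) (arc_length \<gamma> 0 t) < e" if "s \<in> {0..1}" "dist s t < d" for s
    proof (cases "s \<le> t")
      case True
      then show ?thesis using d(2)[OF that] arc_length_add[of 0 s t] arc_length_nonneg[of s t] that(1) t
        by (simp add: dist_real_def)
    next
      case False
      then show ?thesis using d(2)[OF that] arc_length_add[of 0 t s] arc_length_nonneg[of t s] that(1) t
        by (simp add: dist_real_def)
    qed
    then show "\<exists>d>0. \<forall>s\<in>{0..1}. dist s t < d \<longrightarrow> dist (arc_length \<gamma> 0 s) (arc_length \<gamma> 0 t) < e"
      using d(1) by blast
  qed
  then have "continuous_on S (arc_length \<gamma> 0 \<circ> clamp01)"
    by (rule continuous_on_compose[OF continuous_on_clamp01 continuous_on_subset])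
       (use clamp01_in in blast)
  then show ?thesis by (simp add: length_fun_def[abs_def] comp_def)
qed

end

subsection \<open>Densities of Stieltjes measures\<close>

lemma continuous_at_right_UNIV: "continuous_on UNIV F \<Longrightarrow> continuous (at_right a) F" for F :: "real \<Rightarrow> real"
  by (simp add: continuous_on_eq_continuous_within continuous_at_imp_continuous_at_within)

lemma UN_symmetric_Ioc: "(\<Union>n::nat. {- real n<..real n}) = UNIV"
proof -
  have "x \<in> (\<Union>n::nat. {- real n<..real n})" for x :: real
    using reals_Archimedean2[of "\<bar>x\<bar>"] by (auto simp: abs_less_iff intro: exI)
      (metis less_imp_le minus_less_iff)
  then show ?thesis by blast
qed

lemma emeasure_interval_measure_UNIV_le:
  assumes F: "mono F" "continuous_on UNIV F" and bd: "\<And>t. a \<le> F t \<and> F t \<le> b"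
  shows "emeasure (interval_measure F) UNIV \<le> ennreal (b - a)"
proof -
  note UN_symmetric_Ioc
  moreover have "(SUP n::nat. emeasure (interval_measure F) {- real n<..real n}) =
      emeasure (interval_measure F) (\<Union>n::nat. {- real n<..real n})"
    by (rule SUP_emeasure_incseq) (auto simp: incseq_def)
  moreover have "emeasure (interval_measure F) {- real n<..real n} \<le> ennreal (b - a)" for n :: nat
  proof -
    have "emeasure (interval_measure F) {- real n<..real n} = ennreal (F (real n) - F (- real n))"
      by (rule emeasure_interval_measure_Ioc) (use F continuous_at_right_UNIV in \<open>auto simp: mono_def\<close>)
    also have "\<dots> \<le> ennreal (b - a)"
      using bd[of "real n"] bd[of "- real n"] by (intro ennreal_leI) linarith
    finally show ?thesis .
  qed
  then have "(SUP n::nat. emeasure (interval_measure F) {- real n<..real n}) \<le> ennreal (b - a)"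
    by (intro SUP_least)
  ultimately show ?thesis by simp
qed

lemma finite_measure_interval_measure:
  assumes F: "mono F" "continuous_on UNIV F" and bd: "bounded (range F)"
  shows "finite_measure (interval_measure F)"
proof
  obtain B where B: "\<And>t. \<bar>F t\<bar> \<le> B" using bd by (auto simp: bounded_iff)
  have "emeasure (interval_measure F) UNIV \<le> ennreal (B - (-B))"
    using B by (intro emeasure_interval_measure_UNIV_le F) (auto simp: abs_le_iff minus_le_iff)
  then show "emeasure (interval_measure F) (space (interval_measure F)) \<noteq> \<infinity>"
    by (simp add: top_unique) (metis ennreal_neq_top top.extremum_unique)
qed

lemma measure_interval_measure_Ioc':
  assumes "mono F" "continuous_on UNIV F" "a \<le> b"
  shows "measure (interval_measure F) {a<..b} = F b - F a"
  by (rule measure_interval_measure_Ioc) (use assms continuous_at_right_UNIV in \<open>auto simp: mono_def\<close>)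

text \<open>Meant for \<open>F = L + \<phi>\<close> and \<open>G = L - \<phi>\<close>. The identity
  is clear on half-open intervals and extends through the Dynkin system they generate. It bounds the
  measure of \<open>F\<close> by twice that of \<open>L\<close>, hence gives absolute
  continuity.\<close>

lemma interval_measure_add_diff:
  fixes L \<phi> :: "real \<Rightarrow> real"
  assumes L: "mono L" "continuous_on UNIV L" "bounded (range L)"
    and F: "mono F" "continuous_on UNIV F" "bounded (range F)"
    and G: "mono G" "continuous_on UNIV G" "bounded (range G)"
    and FG: "\<And>t. F t + G t = 2 * L t" and A: "A \<in> sets borel"
  shows "measure (interval_measure F) A + measure (interval_measure G) A = 2 * measure (interval_measure L) A"
proof -
  interpret L: finite_measure "interval_measure L" by (rule finite_measure_interval_measure[OF L])
  interpret F: finite_measure "interval_measure F" by (rule finite_measure_interval_measure[OF F])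
  interpret G: finite_measure "interval_measure G" by (rule finite_measure_interval_measure[OF G])
  let ?P = "\<lambda>A. measure (interval_measure F) A + measure (interval_measure G) A = 2 * measure (interval_measure L) A"
  have Ioc: "?P {a<..b}" if "a \<le> b" for a b
    using that FG[of a] FG[of b] by (simp add: measure_interval_measure_Ioc' L F G algebra_simps)
  have un: "?P (\<Union>i::nat. A i)" if d: "disjoint_family A" and A: "\<And>i. A i \<in> sets borel" and P: "\<And>i. ?P (A i)" for A
  proof -
    have r: "range A \<subseteq> sets borel" using A by auto
    have "(\<lambda>i. measure (interval_measure F) (A i) + measure (interval_measure G) (A i)) sums
       (measure (interval_measure F) (\<Union>i. A i) + measure (interval_measure G) (\<Union>i. A i))"
      using F.finite_measure_UNION[OF _ d] G.finite_measure_UNION[OF _ d] r by (intro sums_add) auto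
    moreover have "(\<lambda>i. 2 * measure (interval_measure L) (A i)) sums (2 * measure (interval_measure L) (\<Union>i. A i))"
      using L.finite_measure_UNION[OF _ d] r by (intro sums_mult) auto
    ultimately show ?thesis using P by (simp add: sums_iff)
  qed
  have UNIV: "?P UNIV"
  proof -
    have "(\<lambda>n. measure (interval_measure F) {- real n<..real n} + measure (interval_measure G) {- real n<..real n})
       \<longlonglongrightarrow> measure (interval_measure F) (\<Union>n. {- real n<..real n}) + measure (interval_measure G) (\<Union>n. {- real n<..real n})"
      by (intro tendsto_add F.finite_Lim_measure_incseq G.finite_Lim_measure_incseq) (auto simp: incseq_def)
    moreover have "(\<lambda>n. 2 * measure (interval_measure L) {- real n<..real n})
       \<longlonglongrightarrow> 2 * measure (interval_measure L) (\<Union>n. {- real n<..real n})"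
      by (intro tendsto_mult tendsto_const L.finite_Lim_measure_incseq) (auto simp: incseq_def)
    moreover note UN_symmetric_Ioc
    moreover have "(\<lambda>n. measure (interval_measure F) {- real n<..real n} + measure (interval_measure G) {- real n<..real n})
        = (\<lambda>n. 2 * measure (interval_measure L) {- real n<..real n})"
      using Ioc by auto
    ultimately show ?thesis by (metis (no_types, lifting) LIMSEQ_unique)
  qed
  have b: "A \<in> sets borel" if "A \<in> sigma_sets UNIV (range (\<lambda>(a, b). {a <.. b::real}))" for A
    using that by (subst borel_sigma_sets_Ioc) simp
  have st: "Int_stable (range (\<lambda>(a, b). {a<..b::real}))"
    by (auto simp: Int_stable_def image_iff)
  have pw: "range (\<lambda>(a, b). {a <.. b::real}) \<subseteq> Pow UNIV" by simp
  have "A \<in> sigma_sets UNIV (range (\<lambda>(a, b). {a <.. b::real}))"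
    using A by (subst (asm) borel_sigma_sets_Ioc) simp
  with st pw show ?thesis
  proof (induction rule: sigma_sets_induct_disjoint)
    case (basic A)
    then obtain ab where "A = (\<lambda>(a, b). {a<..b}) ab" by (rule rangeE)
    then obtain a b where "A = {a<..b}" by (cases ab) simp
    then show ?case using Ioc[of a b] by (cases "a \<le> b") auto
  next
    case (compl A)
    then show ?case
      using b[OF compl(1)] UNIV F.finite_measure_compl[of A] G.finite_measure_compl[of A]
        L.finite_measure_compl[of A] by simp
  next
    case (union A)
    then show ?case using b by (intro un) auto
  qed auto
qed

text \<open>Radon-Nikodym with a real density: the measure of \<open>F\<close> is finite, so the
  extended density is finite almost everywhere and \<open>enn2real\<close> loses nothing.\<close>

lemma interval_measure_density:
  fixes L F :: "real \<Rightarrow> real"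
  assumes L: "mono L" "continuous_on UNIV L" "bounded (range L)"
    and F: "mono F" "continuous_on UNIV F" "bounded (range F)"
    and null: "\<And>A. A \<in> sets borel \<Longrightarrow> measure (interval_measure L) A = 0 \<Longrightarrow> measure (interval_measure F) A = 0"
  obtains d where "d \<in> borel_measurable borel" "\<And>t. 0 \<le> d t"
    "interval_measure F = density (interval_measure L) (\<lambda>t. ennreal (d t))"
    "integrable (interval_measure L) d"
    "\<And>s t. s \<le> t \<Longrightarrow> (LINT u:{s<..t}|interval_measure L. d u) = F t - F s"
proof -
  let ?L = "interval_measure L" and ?F = "interval_measure F"
  interpret L: finite_measure ?L by (rule finite_measure_interval_measure[OF L])
  interpret F: finite_measure ?F by (rule finite_measure_interval_measure[OF F])
  have "absolutely_continuous ?L ?F"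
    unfolding absolutely_continuous_def
    using null by (auto simp: null_sets_def L.emeasure_eq_measure F.emeasure_eq_measure)
  from L.Radon_Nikodym[OF this] obtain f where f: "f \<in> borel_measurable ?L" and d: "density ?L f = ?F"
    by auto
  have "(\<integral>\<^sup>+x. f x \<partial>?L) = emeasure ?F UNIV"
    using emeasure_density[OF f, of UNIV] by (simp add: d)
  then have "AE x in ?L. f x \<noteq> \<infinity>"
    using f F.emeasure_finite by (intro nn_integral_PInf_AE) auto
  then have "AE x in ?L. ennreal (enn2real (f x)) = f x" by (auto simp: less_top)
  then have dens: "density ?L (\<lambda>x. ennreal (enn2real (f x))) = ?F"
    unfolding d[symmetric] using f by (intro density_cong) auto
  let ?d = "\<lambda>x. enn2real (f x)"
  have meas: "?d \<in> borel_measurable borel" using f by measurable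
  have int: "integrable ?L ?d"
  proof (rule integrableI_nonneg)
    show "?d \<in> borel_measurable ?L" using f by measurable
    have "(\<integral>\<^sup>+x. ennreal (?d x) \<partial>?L) = emeasure ?F UNIV"
      using emeasure_density[of "\<lambda>x. ennreal (?d x)" ?L UNIV] f by (simp add: dens)
    then show "(\<integral>\<^sup>+x. ennreal (?d x) \<partial>?L) < \<infinity>"
      by (simp add: F.emeasure_eq_measure)
  qed auto
  show ?thesis
  proof
    show "(LINT u:{s<..t}|?L. ?d u) = F t - F s" if "s \<le> t" for s t
    proof -
      have "ennreal (LINT u:{s<..t}|?L. ?d u) = (\<integral>\<^sup>+u. ennreal (indicator {s<..t} u *\<^sub>R ?d u) \<partial>?L)"
        unfolding set_lebesgue_integral_def
        by (rule nn_integral_eq_integral[symmetric])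
           (use set_integrable_if_integrable[OF int, of "{s<..t}"] in \<open>auto simp: set_integrable_def\<close>)
      also have "\<dots> = (\<integral>\<^sup>+u. ennreal (?d u) * indicator {s<..t} u \<partial>?L)"
        by (intro nn_integral_cong) (auto simp: indicator_def)
      also have "\<dots> = emeasure ?F {s<..t}"
        using emeasure_density[of "\<lambda>x. ennreal (?d x)" ?L "{s<..t}"] f by (simp add: dens)
      also have "\<dots> = ennreal (F t - F s)"
        using that F by (simp add: F.emeasure_eq_measure measure_interval_measure_Ioc')
      finally show ?thesis
        using monoD[OF F(1) that]
        by (subst (asm) ennreal_inj) (auto simp: set_lebesgue_integral_def intro!: integral_nonneg_AE)
    qed
  qed (use meas int dens in auto)
qed

text \<open>\<open>L - \<phi>\<close> is nondecreasing as well, and its density \<open>d'\<close>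
  satisfies \<open>d + d' = 2\<close> almost everywhere because the two functions add up to
  \<open>2 * L\<close>. So \<open>d\<close> lies between 0 and 2; passing to
  \<open>min 2 (d t)\<close> makes the bound hold everywhere.\<close>

lemma interval_measure_perturbation_density:
  fixes L \<phi> :: "real \<Rightarrow> real"
  assumes L: "mono L" "continuous_on UNIV L" "bounded (range L)"
    and \<phi>: "\<And>s t. s \<le> t \<Longrightarrow> \<bar>\<phi> t - \<phi> s\<bar> \<le> L t - L s"
  obtains d where "d \<in> borel_measurable borel" "\<And>t. 0 \<le> d t" "\<And>t. d t \<le> 2"
    "interval_measure (\<lambda>t. L t + \<phi> t) = density (interval_measure L) (\<lambda>t. ennreal (d t))"
    "\<And>s t. s \<le> t \<Longrightarrow> (LINT u:{s<..t}|interval_measure L. d u) = (L t + \<phi> t) - (L s + \<phi> s)"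
proof -
  let ?L = "interval_measure L"
  interpret L: finite_measure ?L by (rule finite_measure_interval_measure[OF L])
  have le: "dist (\<phi> s) (\<phi> t) \<le> dist (L s) (L t)" for s t
    using \<phi>[of s t] \<phi>[of t s] by (cases "s \<le> t") (auto simp: dist_real_def)
  have "continuous_on UNIV \<phi>"
    using L(2) unfolding continuous_on_iff by (meson le le_less_trans)
  moreover have "bounded (range \<phi>)"
  proof -
    obtain B where B: "\<And>t. \<bar>L t\<bar> \<le> B" using L(3) by (auto simp: bounded_iff)
    have "\<bar>\<phi> t\<bar> \<le> 2 * B + \<bar>\<phi> 0\<bar>" for t
      using le[of t 0] B[of t] B[of 0] by (auto simp: dist_real_def)
    then show ?thesis by (auto simp: bounded_iff)
  qed
  ultimately have F: "mono (\<lambda>t. L t + \<phi> t)" "continuous_on UNIV (\<lambda>t. L t + \<phi> t)" "bounded (range (\<lambda>t. L t + \<phi> t))"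
    and G: "mono (\<lambda>t. L t - \<phi> t)" "continuous_on UNIV (\<lambda>t. L t - \<phi> t)" "bounded (range (\<lambda>t. L t - \<phi> t))"
    using L \<phi> by (auto intro!: monoI continuous_intros bounded_plus_comp bounded_minus_comp simp: abs_le_iff) (smt (verit))+
  note sum = interval_measure_add_diff[OF L F G]
  obtain d where d: "d \<in> borel_measurable borel" "\<And>t. 0 \<le> d t"
    "interval_measure (\<lambda>t. L t + \<phi> t) = density ?L (\<lambda>t. ennreal (d t))" "integrable ?L d"
    "\<And>s t. s \<le> t \<Longrightarrow> (LINT u:{s<..t}|interval_measure L. d u) = (L t + \<phi> t) - (L s + \<phi> s)"
  proof (rule interval_measure_density[OF L F])
    show "measure (interval_measure (\<lambda>t. L t + \<phi> t)) A = 0" if "A \<in> sets borel" "measure ?L A = 0" for A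
      using sum[of A] that measure_nonneg[of "interval_measure (\<lambda>t. L t + \<phi> t)" A]
        measure_nonneg[of "interval_measure (\<lambda>t. L t - \<phi> t)" A] by linarith
  qed blast
  obtain d' where d': "d' \<in> borel_measurable borel" "\<And>t. 0 \<le> d' t"
    "interval_measure (\<lambda>t. L t - \<phi> t) = density ?L (\<lambda>t. ennreal (d' t))" "integrable ?L d'"
    "\<And>s t. s \<le> t \<Longrightarrow> (LINT u:{s<..t}|interval_measure L. d' u) = (L t - \<phi> t) - (L s - \<phi> s)"
  proof (rule interval_measure_density[OF L G])
    show "measure (interval_measure (\<lambda>t. L t - \<phi> t)) A = 0" if "A \<in> sets borel" "measure ?L A = 0" for A
      using sum[of A] that measure_nonneg[of "interval_measure (\<lambda>t. L t + \<phi> t)" A]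
        measure_nonneg[of "interval_measure (\<lambda>t. L t - \<phi> t)" A] by linarith
  qed blast
  have "AE t in ?L. d t + d' t - 2 = 0"
  proof (rule real_AE_zero_if_interval_integrals_zero)
    show "integrable ?L (\<lambda>t. d t + d' t - 2)" using d(4) d'(4) by simp
    fix a b :: real assume ab: "a \<le> b"
    have i: "set_integrable ?L {a<..b} d" "set_integrable ?L {a<..b} d'" "set_integrable ?L {a<..b} (\<lambda>_. 2::real)"
      using d(4) d'(4) by (auto intro!: set_integrable_if_integrable)
    have "(LINT t:{a<..b}|?L. d t + d' t - 2) = (LINT t:{a<..b}|?L. d t) + (LINT t:{a<..b}|?L. d' t) - (LINT t:{a<..b}|?L. 2)"
      using i by (simp add: set_integral_diff set_integral_add)
    also have "(LINT t:{a<..b}|?L. 2) = 2 * (L b - L a)"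
      using L ab by (simp add: set_lebesgue_integral_def measure_interval_measure_Ioc')
    finally show "(LINT t:{a<..b}|?L. d t + d' t - 2) = 0"
      using d(5)[OF ab] d'(5)[OF ab] by simp
  qed (auto intro: L.sigma_finite_measure_axioms)
  then have AE: "AE t in ?L. d t = min 2 (d t)"
    by eventually_elim (use d'(2) in \<open>smt (verit)\<close>)
  show ?thesis
  proof
    show "(\<lambda>t. min 2 (d t)) \<in> borel_measurable borel" using d(1) by measurable
    show "interval_measure (\<lambda>t. L t + \<phi> t) = density ?L (\<lambda>t. ennreal (min 2 (d t)))"
      unfolding d(3) using d(1) AE by (intro density_cong) auto
    show "(LINT u:{s<..t}|?L. min 2 (d u)) = (L t + \<phi> t) - (L s + \<phi> s)" if "s \<le> t" for s t
      unfolding d(5)[OF that, symmetric] set_lebesgue_integral_def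
      by (rule integral_cong_AE) (use d(1) AE in auto)
  qed (use d in auto)
qed

section \<open>The unit tangent of a rectifiable path\<close>

lemma length_fun_bounds:
  assumes "rectifiable \<gamma>"
  shows "length_fun \<gamma> 0 \<le> length_fun \<gamma> t" "length_fun \<gamma> t \<le> length_fun \<gamma> 1"
  using length_fun_mono[OF assms, of 0 "clamp01 t"] length_fun_mono[OF assms, of "clamp01 t" 1]
    clamp01_in[of t] by (simp_all add: length_fun_def clamp01_id[OF clamp01_in])

lemma length_fun_props:
  assumes \<gamma>: "path \<gamma>" "rectifiable \<gamma>"
  shows "mono (length_fun \<gamma>)" "continuous_on UNIV (length_fun \<gamma>)" "bounded (range (length_fun \<gamma>))"
proof -
  show "mono (length_fun \<gamma>)" by (intro monoI length_fun_mono[OF \<gamma>(2)])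
  show "continuous_on UNIV (length_fun \<gamma>)" by (rule continuous_length_fun[OF \<gamma>(2,1)])
  show "bounded (range (length_fun \<gamma>))"
    by (rule bounded_subset[OF bounded_closed_interval[of "length_fun \<gamma> 0" "length_fun \<gamma> 1"]])
       (use length_fun_bounds[OF \<gamma>(2)] in auto)
qed

text \<open>The signed densities of the coordinates \<open>Re (cis q * \<gamma>)\<close> are
  projections of one complex function. Each is at least -1, which bounds the modulus by 1; the
  length of inscribed polygons forces equality.\<close>

lemma unit_tangent:
  assumes \<gamma>: "path \<gamma>" "rectifiable \<gamma>"
  obtains \<tau> :: "real \<Rightarrow> complex" where "\<tau> \<in> borel_measurable borel" "\<And>t. cmod (\<tau> t) = 1"
    "\<And>s t. s \<le> t \<Longrightarrow> (LINT u:{s<..t}|interval_measure (length_fun \<gamma>). \<tau> u) = \<gamma> (clamp01 t) - \<gamma> (clamp01 s)"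
    "\<And>f. set_integrable (interval_measure (length_fun \<gamma>)) {0..1} (\<lambda>t. f (\<gamma> t)) \<Longrightarrow>
       curve_integral \<gamma> f = (LINT t:{0..1}|interval_measure (length_fun \<gamma>). f (\<gamma> t) * \<tau> t)"
proof -
  let ?L = "length_fun \<gamma>"
  let ?M = "interval_measure ?L"
  have bd: "?L 0 \<le> ?L t \<and> ?L t \<le> ?L 1" for t
    using length_fun_bounds[OF \<gamma>(2)] by simp
  note L = length_fun_props[OF \<gamma>]
  interpret M: finite_measure ?M by (rule finite_measure_interval_measure[OF L])
  \<comment> \<open>\<open>q = 0\<close> gives the real part and \<open>q = -pi/2\<close> the
    imaginary part, since \<open>cis (-pi/2) = - \<i>\<close>.\<close>
  define \<phi> where "\<phi> q t = Re (cis q * \<gamma> (clamp01 t))" for q t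
  have lip: "\<bar>\<phi> q t - \<phi> q s\<bar> \<le> ?L t - ?L s" if "s \<le> t" for q s t
  proof -
    have "\<phi> q t - \<phi> q s = Re (cis q * (\<gamma> (clamp01 t) - \<gamma> (clamp01 s)))"
      by (simp add: \<phi>_def algebra_simps)
    also have "\<bar>\<dots>\<bar> \<le> cmod (cis q * (\<gamma> (clamp01 t) - \<gamma> (clamp01 s)))" by (rule abs_Re_le_cmod)
    also have "\<dots> = dist (\<gamma> (clamp01 s)) (\<gamma> (clamp01 t))"
      by (simp add: norm_mult dist_norm norm_minus_commute)
    finally show ?thesis using dist_le_length_fun[OF \<gamma>(2) that] by linarith
  qed
  define P where "P d q \<longleftrightarrow> d \<in> borel_measurable borel \<and> (\<forall>t. 0 \<le> d t \<and> d t \<le> 2) \<and>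
    interval_measure (\<lambda>t. ?L t + \<phi> q t) = density ?M (\<lambda>t. ennreal (d t)) \<and>
    (\<forall>s t. s \<le> t \<longrightarrow> (LINT u:{s<..t}|?M. d u) = (?L t + \<phi> q t) - (?L s + \<phi> q s))"
    for d :: "real \<Rightarrow> real" and q
  have "\<forall>q. \<exists>d. P d q"
  proof
    show "\<exists>d. P d q" for q
      unfolding P_def
      by (rule interval_measure_perturbation_density[OF L, of "\<phi> q"]) (use lip in blast)+
  qed
  from choice[OF this] obtain D where "\<forall>q. P (D q) q" by (rule exE)
  then have D: "D q \<in> borel_measurable borel" "0 \<le> D q t" "D q t \<le> 2"
    "interval_measure (\<lambda>t. ?L t + \<phi> q t) = density ?M (\<lambda>t. ennreal (D q t))"
    "s \<le> t \<Longrightarrow> (LINT u:{s<..t}|?M. D q u) = (?L t + \<phi> q t) - (?L s + \<phi> q s)" for q s t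
    unfolding P_def by auto
  note [measurable] = D(1)
  have Dint: "integrable ?M (D q)" for q
    by (rule M.integrable_const_bound[where B=2]) (use D(2,3) in auto)
  have D1int: "integrable ?M (\<lambda>u. D q u - 1)" for q using Dint by simp
  have D1: "(LINT u:{s<..t}|?M. D q u - 1) = \<phi> q t - \<phi> q s" if "s \<le> t" for q s t
  proof -
    have "(LINT u:{s<..t}|?M. D q u - 1) = (LINT u:{s<..t}|?M. D q u) - (LINT u:{s<..t}|?M. 1)"
      by (rule set_integral_diff) (auto intro!: set_integrable_if_integrable Dint)
    also have "(LINT u:{s<..t}|?M. (1::real)) = ?L t - ?L s"
      using that by (simp add: set_lebesgue_integral_def measure_interval_measure_Ioc' L)
    finally show ?thesis using D(5)[OF that] by simp
  qed
  \<comment> \<open>\<open>D q\<close> is the density of \<open>?L + \<phi> q\<close>; subtracting 1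
    removes the contribution of \<open>?L\<close> and leaves the signed density of
    \<open>\<phi> q\<close>.\<close>
  define \<tau>0 where "\<tau>0 t = complex_of_real (D 0 t - 1) + \<i> * complex_of_real (D (-pi/2) t - 1)" for t
  have \<tau>0_meas[measurable]: "\<tau>0 \<in> borel_measurable borel" unfolding \<tau>0_def by measurable
  have \<tau>0_bound: "cmod (\<tau>0 t) \<le> 2" for t
  proof -
    have "cmod (\<tau>0 t) \<le> \<bar>D 0 t - 1\<bar> + \<bar>D (-pi/2) t - 1\<bar>"
      unfolding \<tau>0_def by (rule order_trans[OF norm_triangle_ineq]) (simp only: norm_mult norm_ii norm_of_real mult_1 order_refl)
    then show ?thesis using D(2,3)[of 0 t] D(2,3)[of "-pi/2" t] by (simp add: abs_if split: if_splits)
  qed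
  have \<tau>0_int: "integrable ?M \<tau>0"
    by (rule M.integrable_const_bound[where B=2]) (use \<tau>0_bound in auto)
  have \<tau>0_Ioc: "(LINT u:{s<..t}|?M. \<tau>0 u) = \<gamma> (clamp01 t) - \<gamma> (clamp01 s)" if "s \<le> t" for s t
  proof -
    have "(LINT u:{s<..t}|?M. \<tau>0 u) = (LINT u:{s<..t}|?M. complex_of_real (D 0 u - 1)) +
       (LINT u:{s<..t}|?M. \<i> * complex_of_real (D (-pi/2) u - 1))"
      unfolding \<tau>0_def
      by (rule set_integral_add) (intro set_integrable_if_integrable integrable_mult_right integrable_of_real D1int; simp)+
    also have "\<dots> = complex_of_real (\<phi> 0 t - \<phi> 0 s) + \<i> * complex_of_real (\<phi> (-pi/2) t - \<phi> (-pi/2) s)"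
      unfolding D1[OF that, symmetric] set_integral_complex_of_real[symmetric] by simp
    also have "\<dots> = \<gamma> (clamp01 t) - \<gamma> (clamp01 s)"
      by (simp add: \<phi>_def complex_eq_iff)
    finally show ?thesis .
  qed
  \<comment> \<open>\<open>D q - 1\<close> and \<open>Re (cis q * \<tau>0)\<close> have the same
    integral \<open>\<phi> q b - \<phi> q a\<close> over every interval.\<close>
  have "AE t in ?M. D q t - 1 - (cos q * (D 0 t - 1) - sin q * (D (-pi/2) t - 1)) = 0" for q
  proof (rule real_AE_zero_if_interval_integrals_zero)
    show "sigma_finite_measure ?M" by (rule M.sigma_finite_measure_axioms)
    show "integrable ?M (\<lambda>t. D q t - 1 - (cos q * (D 0 t - 1) - sin q * (D (-pi/2) t - 1)))"
      using Dint by simp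
    fix a b :: real assume ab: "a \<le> b"
    have si: "set_integrable ?M {a<..b} (\<lambda>u. D q u - 1)" for q
      by (intro set_integrable_if_integrable D1int) simp
    have "(LINT t:{a<..b}|?M. D q t - 1 - (cos q * (D 0 t - 1) - sin q * (D (-pi/2) t - 1)))
      = (LINT t:{a<..b}|?M. D q t - 1) - (cos q * (LINT t:{a<..b}|?M. D 0 t - 1) - sin q * (LINT t:{a<..b}|?M. D (-pi/2) t - 1))"
      using si by (simp add: set_integral_diff(2) set_integrable_mult_right)
    also have "\<dots> = 0"
      unfolding D1[OF ab] by (simp add: \<phi>_def algebra_simps)
    finally show "(LINT t:{a<..b}|?M. D q t - 1 - (cos q * (D 0 t - 1) - sin q * (D (-pi/2) t - 1))) = 0" .
  qed simp
  \<comment> \<open>The exceptional null set depends on \<open>q\<close>. Rational \<open>q\<close>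
    are countable, which yields a common null set, and dense, which gives all directions by
    continuity in \<open>q\<close>.\<close>
  then have "AE t in ?M. \<forall>q\<in>\<rat>. D q t - 1 - (cos q * (D 0 t - 1) - sin q * (D (-pi/2) t - 1)) = 0"
    by (intro AE_ball_countable') (auto simp: countable_rat)
  then have le1: "AE t in ?M. cmod (\<tau>0 t) \<le> 1"
  proof eventually_elim
    case (elim t)
    have nn: "0 \<le> 1 + Re (cis q * \<tau>0 t)" if "q \<in> \<rat>" for q
    proof -
      have "D q t - 1 - (cos q * (D 0 t - 1) - sin q * (D (-pi/2) t - 1)) = 0" using elim that by blast
      moreover have "Re (cis q * \<tau>0 t) = cos q * (D 0 t - 1) - sin q * (D (-pi/2) t - 1)"
        by (simp add: \<tau>0_def)
      ultimately show ?thesis using D(2)[of q t] by linarith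
    qed
    have "0 \<le> 1 + Re (cis q * \<tau>0 t)" for q
    proof (rule continuous_ge_on_closure[of \<rat> "\<lambda>q. 1 + Re (cis q * \<tau>0 t)" q 0])
      show "continuous_on (closure \<rat>) (\<lambda>q. 1 + Re (cis q * \<tau>0 t))"
        by (intro continuous_intros)
    qed (use nn in \<open>auto simp: Rats_closure_real\<close>)
    \<comment> \<open>This direction turns \<open>\<tau>0 t\<close> onto the negative real axis,
      where the half-plane condition reads \<open>cmod (\<tau>0 t) \<le> 1\<close>.\<close>
    from this[of "pi - Arg (\<tau>0 t)"] have "0 \<le> 1 + Re (cis (pi - Arg (\<tau>0 t)) * \<tau>0 t)" .
    also have "cis (pi - Arg (\<tau>0 t)) * \<tau>0 t = - complex_of_real (cmod (\<tau>0 t))"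
    proof -
      define m A where "m = complex_of_real (cmod (\<tau>0 t))" and "A = Arg (\<tau>0 t)"
      have "\<tau>0 t = m * cis A" using rcis_cmod_Arg[of "\<tau>0 t"] by (simp add: rcis_def m_def A_def)
      then have "cis (pi - A) * \<tau>0 t = m * (cis (pi - A) * cis A)" by (simp only: ac_simps)
      also have "\<dots> = - m" by (simp add: cis_mult)
      finally show ?thesis by (simp add: m_def A_def)
    qed
    finally show ?case by simp
  qed
  have sum_Ioc: "(\<Sum>k<m. LINT u:{p k<..p (Suc k)}|?M. cmod (\<tau>0 u)) = (LINT u:{p 0<..p m}|?M. cmod (\<tau>0 u))"
    if "mono p" for p :: "nat \<Rightarrow> real" and m
  proof (induction m)
    case (Suc m)
    have "p 0 \<le> p m" "p m \<le> p (Suc m)" using that by (auto simp: mono_def)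
    then have eq: "{p 0<..p (Suc m)} = {p 0<..p m} \<union> {p m<..p (Suc m)}" by auto
    show ?case unfolding eq
      by (subst set_integral_Un) (use Suc in \<open>auto intro!: set_integrable_if_integrable \<tau>0_int\<close>)
  qed (simp add: set_lebesgue_integral_def)
  \<comment> \<open>Chords are integrals of \<open>\<tau>0\<close>, so the length is at most the
    integral of \<open>cmod (\<tau>0 u)\<close>. The total mass of \<open>?M\<close> is at most the
    length; hence the nonnegative function \<open>1 - cmod (\<tau>0 u)\<close> has integral
    0.\<close>
  have "arc_length \<gamma> 0 1 \<le> (\<integral>u. cmod (\<tau>0 u) \<partial>?M)"
  proof (rule arc_length_le[OF \<gamma>(2)])
    fix p :: "nat \<Rightarrow> real" and m assume p: "mono p" "range p \<subseteq> {0..1}"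
    have "dist (\<gamma> (p k)) (\<gamma> (p (Suc k))) \<le> (LINT u:{p k<..p (Suc k)}|?M. cmod (\<tau>0 u))" for k
    proof -
      have "(LINT u:{p k<..p (Suc k)}|?M. \<tau>0 u) = \<gamma> (p (Suc k)) - \<gamma> (p k)"
        using \<tau>0_Ioc[of "p k" "p (Suc k)"] p by (simp add: mono_def clamp01_id image_subset_iff)
      moreover have "cmod (LINT u:{p k<..p (Suc k)}|?M. \<tau>0 u) \<le> (LINT u:{p k<..p (Suc k)}|?M. cmod (\<tau>0 u))"
        by (rule set_integral_norm_bound) (simp add: set_integrable_if_integrable \<tau>0_int)
      ultimately show ?thesis by (simp add: dist_norm norm_minus_commute)
    qed
    then have "(\<Sum>k<m. dist (\<gamma> (p k)) (\<gamma> (p (Suc k)))) \<le> (\<Sum>k<m. LINT u:{p k<..p (Suc k)}|?M. cmod (\<tau>0 u))"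
      by (intro sum_mono)
    also have "\<dots> = (LINT u:{p 0<..p m}|?M. cmod (\<tau>0 u))" by (rule sum_Ioc[OF p(1)])
    also have "\<dots> \<le> (\<integral>u. cmod (\<tau>0 u) \<partial>?M)"
      unfolding set_lebesgue_integral_def
      by (rule integral_mono[OF integrable_mult_indicator]) (use \<tau>0_int in \<open>auto simp: indicator_def\<close>)
    finally show "(\<Sum>k<m. dist (\<gamma> (p k)) (\<gamma> (p (Suc k)))) \<le> (\<integral>u. cmod (\<tau>0 u) \<partial>?M)" .
  qed simp
  moreover have "arc_length \<gamma> 0 1 = ?L 1 - ?L 0"
    using length_fun_diff[OF \<gamma>(2), of 0 1] by (simp add: clamp01_id)
  moreover have "measure ?M UNIV \<le> ?L 1 - ?L 0"
    using emeasure_interval_measure_UNIV_le[OF L(1,2) bd] length_fun_mono[OF \<gamma>(2), of 0 1]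
    by (simp add: M.emeasure_eq_measure)
  moreover have "(\<integral>u. 1 - cmod (\<tau>0 u) \<partial>?M) = measure ?M UNIV - (\<integral>u. cmod (\<tau>0 u) \<partial>?M)"
    using \<tau>0_int by simp
  ultimately have "(\<integral>u. 1 - cmod (\<tau>0 u) \<partial>?M) \<le> 0" by linarith
  moreover have "0 \<le> (\<integral>u. 1 - cmod (\<tau>0 u) \<partial>?M)"
    using le1 by (intro integral_nonneg_AE) auto
  ultimately have "(\<integral>u. 1 - cmod (\<tau>0 u) \<partial>?M) = 0" by linarith
  then have "AE u in ?M. 1 - cmod (\<tau>0 u) = 0"
    by (subst (asm) integral_nonneg_eq_0_iff_AE) (use le1 \<tau>0_int in auto)
  then have norm1: "AE u in ?M. cmod (\<tau>0 u) = 1" by simp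
  \<comment> \<open>The default 1 on a null set makes \<open>cmod (\<tau> t) = 1\<close>
    unconditional.\<close>
  define \<tau> where "\<tau> t = (if cmod (\<tau>0 t) = 1 then \<tau>0 t else 1)" for t
  have \<tau>_meas[measurable]: "\<tau> \<in> borel_measurable borel" unfolding \<tau>_def by measurable
  have \<tau>_AE: "AE u in ?M. \<tau>0 u = \<tau> u" using norm1 by (auto simp: \<tau>_def)
  show ?thesis
  proof
    show "\<tau> \<in> borel_measurable borel" by (rule \<tau>_meas)
    show "cmod (\<tau> t) = 1" for t by (simp add: \<tau>_def)
    show "(LINT u:{s<..t}|?M. \<tau> u) = \<gamma> (clamp01 t) - \<gamma> (clamp01 s)" if "s \<le> t" for s t
      unfolding \<tau>0_Ioc[OF that, symmetric] set_lebesgue_integral_def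
      by (rule integral_cong_AE) (use \<tau>_AE in auto)
    fix f :: "complex \<Rightarrow> complex" assume f: "set_integrable ?M {0..1} (\<lambda>t. f (\<gamma> t))"
    define g where "g t = indicat_real {0..1} t *\<^sub>R f (\<gamma> t)" for t
    have g: "integrable ?M g" using f by (simp add: set_integrable_def g_def[abs_def])
    have gD: "integrable ?M (\<lambda>t. D q t *\<^sub>R g t)" for q
      by (rule Bochner_Integration.integrable_bound[of _ "\<lambda>t. 2 * cmod (g t)"])
         (use g D(2,3) in \<open>auto intro!: mult_right_mono\<close>)
    \<comment> \<open>Both Stieltjes measures become integrals against \<open>?M\<close>, so their
      difference is integration with the weight \<open>D q - 1\<close>.\<close>
    have st: "stieltjes_integral ?L (\<phi> q) (\<lambda>t. f (\<gamma> t)) = (\<integral>t. (D q t - 1) *\<^sub>R g t \<partial>?M)" for q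
    proof -
      have "(LINT t:{0..1}|interval_measure (\<lambda>t. ?L t + \<phi> q t). f (\<gamma> t)) = (\<integral>t. D q t *\<^sub>R g t \<partial>?M)"
        unfolding set_lebesgue_integral_def D(4) g_def[symmetric]
        by (rule integral_density) (use g D(2) in auto)
      then show ?thesis
        using g gD by (simp add: stieltjes_integral_def set_lebesgue_integral_def g_def[symmetric] scaleR_diff_left)
    qed
    have "curve_integral \<gamma> f = (\<integral>t. (D 0 t - 1) *\<^sub>R g t \<partial>?M) + \<i> * (\<integral>t. (D (-pi/2) t - 1) *\<^sub>R g t \<partial>?M)"
    proof -
      have "\<phi> 0 = (\<lambda>t. Re (\<gamma> (clamp01 t)))" "\<phi> (-pi/2) = (\<lambda>t. Im (\<gamma> (clamp01 t)))"
        by (auto simp: \<phi>_def fun_eq_iff)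
      then show ?thesis using st[of 0] st[of "-pi/2"] by (simp only: curve_integral_def)
    qed
    also have "\<dots> = (\<integral>t. (D 0 t - 1) *\<^sub>R g t + \<i> * ((D (-pi/2) t - 1) *\<^sub>R g t) \<partial>?M)"
      using g gD by (simp add: scaleR_diff_left)
    also have "\<dots> = (\<integral>t. g t * \<tau>0 t \<partial>?M)"
      by (rule Bochner_Integration.integral_cong) (auto simp: \<tau>0_def scaleR_conv_of_real algebra_simps)
    also have "\<dots> = (\<integral>t. g t * \<tau> t \<partial>?M)"
      by (rule integral_cong_AE) (use g \<tau>_AE in auto)
    also have "\<dots> = (LINT t:{0..1}|?M. f (\<gamma> t) * \<tau> t)"
      by (simp add: set_lebesgue_integral_def g_def)
    finally show "curve_integral \<gamma> f = (LINT t:{0..1}|?M. f (\<gamma> t) * \<tau> t)" .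
  qed
qed

subsection \<open>Rectifiable cycles\<close>

lemma interval_measure_finite_null:
  assumes F: "mono F" "continuous_on UNIV F" and "finite A"
  shows "A \<in> null_sets (interval_measure F)"
  using \<open>finite A\<close>
proof induction
  case (insert x A)
  have "emeasure (interval_measure F) {x..x} = ennreal (F x - F x)"
    by (rule emeasure_interval_measure_Icc) (use F in \<open>auto simp: mono_def\<close>)
  then have "{x} \<in> null_sets (interval_measure F)" by (auto simp: null_sets_def)
  then show ?case using insert null_sets.Un by (metis insert_is_Un)
qed simp

lemma simple_loop_inj_on:
  assumes "simple_path \<gamma>" shows "inj_on \<gamma> {0..<1}"
  using assms unfolding simple_path_def loop_free_def inj_on_def by fastforce

text \<open>The conditions on a boundary cycle that concern the curves alone, without domain or
  orientation. The necessity argument works directly in this locale, the converse in an extension of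
  it.\<close>

locale rectifiable_cycle =
  fixes \<Gamma> :: "(real \<Rightarrow> complex) set"
  assumes finite_cycle: "finite \<Gamma>"
    and simple: "\<And>\<gamma>. \<gamma> \<in> \<Gamma> \<Longrightarrow> simple_path \<gamma>"
    and closed_loop: "\<And>\<gamma>. \<gamma> \<in> \<Gamma> \<Longrightarrow> pathfinish \<gamma> = pathstart \<gamma>"
    and disjoint: "disjoint_family_on path_image \<Gamma>"
    and rect: "\<And>\<gamma>. \<gamma> \<in> \<Gamma> \<Longrightarrow> rectifiable \<gamma>"
begin

abbreviation "C \<equiv> cycle_image \<Gamma>"
abbreviation "\<mu> \<equiv> arclength_measure \<Gamma>"
abbreviation "m \<gamma> \<equiv> interval_measure (length_fun \<gamma>)"

lemma paths: "\<gamma> \<in> \<Gamma> \<Longrightarrow> path \<gamma>"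
  using simple simple_path_imp_path by blast

lemma compact_cycle: "compact C"
  unfolding cycle_image_def using finite_cycle paths by (intro compact_UN) auto

lemma sets_\<mu> [simp]: "A \<in> sets (restrict_space borel C) \<longleftrightarrow> A \<subseteq> C \<and> A \<in> sets borel"
  using compact_cycle by (auto simp: sets_restrict_space_iff compact_imp_closed)

lemma borel_C [simp]: "C \<in> sets borel"
  using compact_cycle by (simp add: compact_imp_closed)

lemmas emeasure_\<mu> = emeasure_arclength_measure[OF paths, unfolded sets_arclength_measure[symmetric]]

lemma finite_m: "\<gamma> \<in> \<Gamma> \<Longrightarrow> finite_measure (m \<gamma>)"
  by (intro finite_measure_interval_measure length_fun_props paths rect)

lemma finite_null_m: "\<gamma> \<in> \<Gamma> \<Longrightarrow> finite A \<Longrightarrow> A \<in> null_sets (m \<gamma>)"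
  by (intro interval_measure_finite_null length_fun_props paths rect)

sublocale finite_measure \<mu>
proof
  have "emeasure \<mu> C = (\<Sum>\<gamma>\<in>\<Gamma>. emeasure (m \<gamma>) {t \<in> {0..1}. \<gamma> t \<in> C})"
    by (rule emeasure_\<mu>) auto
  also have "\<dots> = (\<Sum>\<gamma>\<in>\<Gamma>. ennreal (measure (m \<gamma>) {t \<in> {0..1}. \<gamma> t \<in> C}))"
    by (intro sum.cong refl finite_measure.emeasure_eq_measure finite_m)
  also have "\<dots> < \<infinity>" by simp
  finally show "emeasure \<mu> (space \<mu>) \<noteq> \<infinity>" by simp
qed

lemma path_image_subset: "\<gamma> \<in> \<Gamma> \<Longrightarrow> path_image \<gamma> \<subseteq> C"
  by (auto simp: cycle_image_def)

lemma path_image_sets: "\<gamma> \<in> \<Gamma> \<Longrightarrow> path_image \<gamma> \<in> sets \<mu>"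
  using path_image_subset closed_path_image[OF paths] by (auto simp: sets_\<mu>)

section \<open>Transport of integrals between the parameter interval and the cycle\<close>

lemma measurable_path:
  assumes "\<gamma> \<in> \<Gamma>"
  shows "\<gamma> \<in> restrict_space (m \<gamma>) {0..1} \<rightarrow>\<^sub>M restrict_space borel (path_image \<gamma>)"
proof (rule measurable_restrict_space2)
  show "\<gamma> \<in> space (restrict_space (m \<gamma>) {0..1}) \<rightarrow> path_image \<gamma>"
    by (auto simp: space_restrict_space path_image_def)
  have "\<gamma> \<in> borel_measurable (restrict_space borel {0..1})"
    using paths[OF assms] unfolding path_def by (rule borel_measurable_continuous_on_restrict)
  then show "\<gamma> \<in> restrict_space (m \<gamma>) {0..1} \<rightarrow>\<^sub>M borel"
    by (simp cong: measurable_cong_sets add: sets_restrict_space_cong[of "m \<gamma>" borel])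
qed

text \<open>The arc-length measure sums over all curves; disjointness of the images leaves only the
  summand of \<gamma>. As a push-forward it turns integrals over one curve into integrals over its
  parameter interval.\<close>

lemma restrict_\<mu>_path_image:
  assumes \<gamma>: "\<gamma> \<in> \<Gamma>"
  shows "restrict_space \<mu> (path_image \<gamma>) =
    distr (restrict_space (m \<gamma>) {0..1}) (restrict_space borel (path_image \<gamma>)) \<gamma>"
proof (rule measure_eqI)
  have sets_eq: "sets (restrict_space \<mu> (path_image \<gamma>)) = sets (restrict_space borel (path_image \<gamma>))"
    using path_image_subset[OF \<gamma>] closed_path_image[OF paths[OF \<gamma>]]
    by (auto simp: sets_restrict_space_iff Int_absorb2 subset_iff)
  then show "sets (restrict_space \<mu> (path_image \<gamma>)) =
    sets (distr (restrict_space (m \<gamma>) {0..1}) (restrict_space borel (path_image \<gamma>)) \<gamma>)"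
    by simp
  fix A assume "A \<in> sets (restrict_space \<mu> (path_image \<gamma>))"
  then have A: "A \<subseteq> path_image \<gamma>" "A \<in> sets \<mu>" "A \<in> sets borel"
    using path_image_subset[OF \<gamma>] closed_path_image[OF paths[OF \<gamma>]] unfolding sets_eq
    by (auto simp: sets_restrict_space_iff)
  then have "emeasure (restrict_space \<mu> (path_image \<gamma>)) A = emeasure \<mu> A"
    using path_image_sets[OF \<gamma>] by (intro emeasure_restrict_space) auto
  also have "\<dots> = (\<Sum>\<delta>\<in>\<Gamma>. emeasure (m \<delta>) {t \<in> {0..1}. \<delta> t \<in> A})"
    by (rule emeasure_\<mu>) (use A in auto)
  also have "\<dots> = (\<Sum>\<delta>\<in>{\<gamma>}. emeasure (m \<delta>) {t \<in> {0..1}. \<delta> t \<in> A})"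
  proof (rule sum.mono_neutral_right)
    show "\<forall>\<delta>\<in>\<Gamma> - {\<gamma>}. emeasure (m \<delta>) {t \<in> {0..1}. \<delta> t \<in> A} = 0"
    proof
      fix \<delta> assume "\<delta> \<in> \<Gamma> - {\<gamma>}"
      then have "path_image \<delta> \<inter> path_image \<gamma> = {}"
        using disjoint \<gamma> by (auto simp: disjoint_family_on_def)
      then have "{t \<in> {0..1}. \<delta> t \<in> A} = {}" using A(1) unfolding path_image_def by blast
      then show "emeasure (m \<delta>) {t \<in> {0..1}. \<delta> t \<in> A} = 0" by (simp only: emeasure_empty)
    qed
  qed (use finite_cycle \<gamma> in auto)
  also have "\<dots> = emeasure (m \<gamma>) {t \<in> {0..1}. \<gamma> t \<in> A}" by simp
  also have "\<dots> = emeasure (restrict_space (m \<gamma>) {0..1}) (\<gamma> -` A \<inter> space (restrict_space (m \<gamma>) {0..1}))"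
    by (subst emeasure_restrict_space)
       (auto simp: space_restrict_space vimage_def intro!: arg_cong[where f="emeasure (m \<gamma>)"])
  also have "\<dots> = emeasure (distr (restrict_space (m \<gamma>) {0..1}) (restrict_space borel (path_image \<gamma>)) \<gamma>) A"
    using A closed_path_image[OF paths[OF \<gamma>]]
    by (intro emeasure_distr[symmetric] measurable_path[OF \<gamma>]) (auto simp: sets_restrict_space_iff)
  finally show "emeasure (restrict_space \<mu> (path_image \<gamma>)) A =
    emeasure (distr (restrict_space (m \<gamma>) {0..1}) (restrict_space borel (path_image \<gamma>)) \<gamma>) A" .
qed

lemma integral_path_image:
  fixes h :: "complex \<Rightarrow> 'b::{banach,second_countable_topology}"
  assumes \<gamma>: "\<gamma> \<in> \<Gamma>" and h: "integrable \<mu> h"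
  shows "set_integrable (m \<gamma>) {0..1} (\<lambda>t. h (\<gamma> t))"
    "(LINT z:path_image \<gamma>|\<mu>. h z) = (LINT t:{0..1}|m \<gamma>. h (\<gamma> t))"
proof -
  let ?P = "path_image \<gamma>"
  have hP: "integrable (restrict_space \<mu> ?P) h"
    using set_integrable_if_integrable[OF h path_image_sets[OF \<gamma>]] path_image_sets[OF \<gamma>]
    by (subst integrable_restrict_space) (auto simp: set_integrable_def Int_absorb2)
  then have hm: "h \<in> borel_measurable (restrict_space borel ?P)"
    unfolding restrict_\<mu>_path_image[OF \<gamma>] by auto
  have "integrable (restrict_space (m \<gamma>) {0..1}) (\<lambda>t. h (\<gamma> t))"
    using hP unfolding restrict_\<mu>_path_image[OF \<gamma>]
    by (subst (asm) integrable_distr_eq[OF measurable_path[OF \<gamma>] hm])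
  then show "set_integrable (m \<gamma>) {0..1} (\<lambda>t. h (\<gamma> t))"
    by (subst (asm) integrable_restrict_space) (auto simp: set_integrable_def)
  have "(LINT z:?P|\<mu>. h z) = (\<integral>z. h z \<partial>restrict_space \<mu> ?P)"
    unfolding set_lebesgue_integral_def
    by (rule integral_restrict_space[symmetric]) (use path_image_sets[OF \<gamma>] in auto)
  also have "\<dots> = (\<integral>t. h (\<gamma> t) \<partial>restrict_space (m \<gamma>) {0..1})"
    unfolding restrict_\<mu>_path_image[OF \<gamma>] by (rule integral_distr[OF measurable_path[OF \<gamma>] hm])
  also have "\<dots> = (LINT t:{0..1}|m \<gamma>. h (\<gamma> t))"
    unfolding set_lebesgue_integral_def by (rule integral_restrict_space) auto
  finally show "(LINT z:?P|\<mu>. h z) = (LINT t:{0..1}|m \<gamma>. h (\<gamma> t))" .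
qed

lemma integral_\<mu>:
  fixes h :: "complex \<Rightarrow> 'b::{banach,second_countable_topology}"
  assumes h: "integrable \<mu> h"
  shows "(\<integral>z. h z \<partial>\<mu>) = (\<Sum>\<gamma>\<in>\<Gamma>. LINT t:{0..1}|m \<gamma>. h (\<gamma> t))"
proof -
  have "(\<integral>z. h z \<partial>\<mu>) = (LINT z:(\<Union>\<gamma>\<in>\<Gamma>. path_image \<gamma>)|\<mu>. h z)"
    using set_integral_space[OF h] by (simp add: cycle_image_def)
  also have "\<dots> = (\<Sum>\<gamma>\<in>\<Gamma>. LINT z:path_image \<gamma>|\<mu>. h z)"
    by (rule set_integral_finite_Union)
       (use finite_cycle disjoint path_image_sets set_integrable_if_integrable[OF h] in auto)
  also have "\<dots> = (\<Sum>\<gamma>\<in>\<Gamma>. LINT t:{0..1}|m \<gamma>. h (\<gamma> t))"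
    by (intro sum.cong refl integral_path_image h)
  finally show ?thesis .
qed

text \<open>A Borel left inverse of the parametrization, needed to make the tangent a function on
  the curve instead of a function of the parameter. \<open>t = 1\<close> is excluded because the
  loop closes there. The nontrivial sublevel sets are a compact image together with the complement
  of the curve, hence Borel.\<close>

lemma parameter_exists:
  assumes \<gamma>: "\<gamma> \<in> \<Gamma>"
  obtains s :: "complex \<Rightarrow> real" where "s \<in> borel_measurable borel" "\<And>t. t \<in> {0..<1} \<Longrightarrow> s (\<gamma> t) = t"
proof -
  have inj: "inj_on \<gamma> {0..<1}" by (rule simple_loop_inj_on[OF simple[OF \<gamma>]])
  have im: "path_image \<gamma> = \<gamma> ` {0..<1}"
  proof -
    have "{0..1} = insert 1 {0..<1::real}" by auto
    moreover have "\<gamma> 1 = \<gamma> 0" using closed_loop[OF \<gamma>] by (simp add: pathfinish_def pathstart_def)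
    ultimately show ?thesis unfolding path_image_def by (auto simp: image_iff)
  qed
  define s where "s z = (if z \<in> path_image \<gamma> then inv_into {0..<1} \<gamma> z else 0)" for z
  have s: "s (\<gamma> t) = t" if "t \<in> {0..<1}" for t
    using that inv_into_f_f[OF inj that] by (auto simp: s_def im)
  have s01: "s z \<in> {0..<1}" for z
    using inv_into_into[of z \<gamma> "{0..<1}"] by (auto simp: s_def im)
  have "{z. s z \<le> c} \<in> sets borel" for c
  proof -
    consider "c < 0" | "0 \<le> c" "c < 1" | "c \<ge> 1" by linarith
    then show ?thesis
    proof cases
      case 1 then have "{z. s z \<le> c} = {}" using s01 by (auto simp: not_le intro: less_le_trans)
      then show ?thesis by simp
    next
      case 2
      have "{z. s z \<le> c} = \<gamma> ` {0..c} \<union> - path_image \<gamma>"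
      proof safe
        fix z assume "s z \<le> c" "z \<notin> \<gamma> ` {0..c}" "z \<in> path_image \<gamma>"
        then obtain t where "t \<in> {0..<1}" "z = \<gamma> t" by (auto simp: im)
        then show False using s[of t] \<open>s z \<le> c\<close> \<open>z \<notin> \<gamma> ` {0..c}\<close> by auto
      next
        fix t assume "t \<in> {0..c}"
        then show "s (\<gamma> t) \<le> c" using s[of t] 2 by auto
      next
        fix z assume "z \<notin> path_image \<gamma>"
        then show "s z \<le> c" using 2 by (simp add: s_def)
      qed
      moreover have "compact (\<gamma> ` {0..c})"
        using paths[OF \<gamma>] 2 by (intro compact_continuous_image)
          (auto simp: path_def intro: continuous_on_subset)
      ultimately show ?thesis using closed_path_image[OF paths[OF \<gamma>]]
        by (auto simp: compact_imp_closed)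
    next
      case 3
      then have "{z. s z \<le> c} = UNIV" using s01 by (auto intro: less_imp_le less_le_trans)
      then show ?thesis by simp
    qed
  qed
  then have "s \<in> borel_measurable borel" by (simp add: borel_measurable_iff_le)
  then show ?thesis using s that by blast
qed

text \<open>On each curve the tangent is composed with the inverse parameter, which can alter it
  only at the null point \<open>t = 1\<close>. Disjointness of the curves allows gluing.\<close>

lemma unit_tangent_field:
  obtains \<tau> :: "complex \<Rightarrow> complex" where "\<tau> \<in> borel_measurable borel" "\<And>z. cmod (\<tau> z) = 1"
    "\<And>f. integrable \<mu> f \<Longrightarrow> cycle_integral \<Gamma> f = (\<integral>z. f z * \<tau> z \<partial>\<mu>)"
proof -
  define Q where "Q \<gamma> \<sigma> \<longleftrightarrow> \<sigma> \<in> borel_measurable borel \<and> (\<forall>z. cmod (\<sigma> z) = 1) \<and>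
    (\<forall>f. integrable \<mu> f \<longrightarrow> curve_integral \<gamma> f = (LINT t:{0..1}|m \<gamma>. f (\<gamma> t) * \<sigma> (\<gamma> t)))"
    for \<gamma> and \<sigma> :: "complex \<Rightarrow> complex"
  have "\<forall>\<gamma>\<in>\<Gamma>. \<exists>\<sigma>. Q \<gamma> \<sigma>"
  proof
    fix \<gamma> assume \<gamma>: "\<gamma> \<in> \<Gamma>"
    obtain \<tau> where \<tau>: "\<tau> \<in> borel_measurable borel" "\<And>t. cmod (\<tau> t) = 1"
      "\<And>f. set_integrable (m \<gamma>) {0..1} (\<lambda>t. f (\<gamma> t)) \<Longrightarrow>
       curve_integral \<gamma> f = (LINT t:{0..1}|m \<gamma>. f (\<gamma> t) * \<tau> t)"
      using unit_tangent[OF paths rect] \<gamma> by metis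
    obtain s where s: "s \<in> borel_measurable borel" "\<And>t. t \<in> {0..<1} \<Longrightarrow> s (\<gamma> t) = t"
      using parameter_exists[OF \<gamma>] by blast
    have "Q \<gamma> (\<lambda>z. \<tau> (s z))"
      unfolding Q_def
    proof (intro conjI allI impI)
      show "(\<lambda>z. \<tau> (s z)) \<in> borel_measurable borel" using s(1) \<tau>(1) by measurable
      fix f :: "complex \<Rightarrow> complex" assume f: "integrable \<mu> f"
      then have si: "set_integrable (m \<gamma>) {0..1} (\<lambda>t. f (\<gamma> t))" using integral_path_image(1)[OF \<gamma>] by blast
      have "curve_integral \<gamma> f = (\<integral>t. indicat_real {0..1} t *\<^sub>R f (\<gamma> t) * \<tau> t \<partial>m \<gamma>)"
        using \<tau>(3)[OF si] by (simp add: set_lebesgue_integral_def)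
      \<comment> \<open>Clamping makes the path continuous on the whole line, so the composed
        integrand is Borel there.\<close>
      also have "\<dots> = (\<integral>t. indicat_real {0..1} t *\<^sub>R f (\<gamma> t) * \<tau> (s (\<gamma> (clamp01 t))) \<partial>m \<gamma>)"
      proof (rule integral_cong_AE)
        have [measurable]: "(\<lambda>t. indicat_real {0..1} t *\<^sub>R f (\<gamma> t)) \<in> borel_measurable (m \<gamma>)"
          using si unfolding set_integrable_def by auto
        have "continuous_on UNIV (\<lambda>t. \<gamma> (clamp01 t))"
          using paths[OF \<gamma>] clamp01_in unfolding path_def
          by (intro continuous_on_compose2[OF _ continuous_on_clamp01[of UNIV]]) auto
        then have [measurable]: "(\<lambda>t. \<gamma> (clamp01 t)) \<in> borel_measurable borel"
          by (rule borel_measurable_continuous_onI)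
        note [measurable] = s(1) \<tau>(1)
        show "(\<lambda>t. indicat_real {0..1} t *\<^sub>R f (\<gamma> t) * \<tau> t) \<in> borel_measurable (m \<gamma>)" by measurable
        show "(\<lambda>t. indicat_real {0..1} t *\<^sub>R f (\<gamma> t) * \<tau> (s (\<gamma> (clamp01 t)))) \<in> borel_measurable (m \<gamma>)"
          by measurable
        have "AE t in m \<gamma>. t \<notin> {1}" by (rule AE_not_in[OF finite_null_m[OF \<gamma>]]) simp
        then show "AE t in m \<gamma>. indicat_real {0..1} t *\<^sub>R f (\<gamma> t) * \<tau> t =
           indicat_real {0..1} t *\<^sub>R f (\<gamma> t) * \<tau> (s (\<gamma> (clamp01 t)))"
          by eventually_elim (use s(2) in \<open>auto simp: indicator_def clamp01_id\<close>)
      qed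
      also have "\<dots> = (LINT t:{0..1}|m \<gamma>. f (\<gamma> t) * \<tau> (s (\<gamma> t)))"
        unfolding set_lebesgue_integral_def
        by (rule Bochner_Integration.integral_cong) (auto simp: indicator_def clamp01_id)
      finally show "curve_integral \<gamma> f = (LINT t:{0..1}|m \<gamma>. f (\<gamma> t) * \<tau> (s (\<gamma> t)))" .
    qed (use \<tau> in auto)
    then show "\<exists>\<sigma>. Q \<gamma> \<sigma>" by blast
  qed
  from bchoice[OF this] obtain \<sigma> where \<sigma>: "\<And>\<gamma>. \<gamma> \<in> \<Gamma> \<Longrightarrow> Q \<gamma> (\<sigma> \<gamma>)" by blast
  then have [measurable]: "\<And>\<gamma>. \<gamma> \<in> \<Gamma> \<Longrightarrow> \<sigma> \<gamma> \<in> borel_measurable borel" by (auto simp: Q_def)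
  \<comment> \<open>On the cycle exactly one indicator is 1; off the cycle the sum is 0, and
    \<open>\<tau>\<close> below takes the value 1 instead.\<close>
  define \<tau>' where "\<tau>' z = (\<Sum>\<gamma>\<in>\<Gamma>. indicator (path_image \<gamma>) z *\<^sub>R \<sigma> \<gamma> z)" for z
  have \<tau>'_eq: "\<tau>' z = \<sigma> \<gamma> z" if "\<gamma> \<in> \<Gamma>" "z \<in> path_image \<gamma>" for \<gamma> z
  proof -
    have "\<tau>' z = (\<Sum>\<delta>\<in>{\<gamma>}. indicator (path_image \<delta>) z *\<^sub>R \<sigma> \<delta> z)"
      unfolding \<tau>'_def
    proof (rule sum.mono_neutral_right)
      show "\<forall>\<delta>\<in>\<Gamma> - {\<gamma>}. indicat_real (path_image \<delta>) z *\<^sub>R \<sigma> \<delta> z = 0"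
        using disjoint that by (fastforce simp: disjoint_family_on_def indicator_def)
    qed (use finite_cycle that in auto)
    then show ?thesis using that by simp
  qed
  have [measurable]: "\<tau>' \<in> borel_measurable borel"
    unfolding \<tau>'_def using closed_path_image[OF paths]
    by (intro borel_measurable_sum borel_measurable_scaleR borel_measurable_indicator) auto
  define \<tau> where "\<tau> z = (if cmod (\<tau>' z) = 1 then \<tau>' z else 1)" for z
  have \<tau>_meas[measurable]: "\<tau> \<in> borel_measurable borel" unfolding \<tau>_def by measurable
  have \<tau>_eq: "\<tau> z = \<sigma> \<gamma> z" if "\<gamma> \<in> \<Gamma>" "z \<in> path_image \<gamma>" for \<gamma> z
    using \<tau>'_eq[OF that] \<sigma>[OF that(1)] by (simp add: \<tau>_def Q_def)
  show ?thesis
  proof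
    show "\<tau> \<in> borel_measurable borel" by (rule \<tau>_meas)
    show norm1: "cmod (\<tau> z) = 1" for z by (simp add: \<tau>_def)
    fix f :: "complex \<Rightarrow> complex" assume f: "integrable \<mu> f"
    have "\<tau> \<in> borel_measurable \<mu>"
      using \<tau>_meas by (simp add: measurable_restrict_space1 cong: measurable_cong_sets)
    then have "integrable \<mu> (\<lambda>z. f z * \<tau> z)"
      by (intro Bochner_Integration.integrable_bound[OF f]) (use f norm1 in \<open>auto simp: norm_mult\<close>)
    then have "(\<integral>z. f z * \<tau> z \<partial>\<mu>) = (\<Sum>\<gamma>\<in>\<Gamma>. LINT t:{0..1}|m \<gamma>. f (\<gamma> t) * \<tau> (\<gamma> t))"
      by (rule integral_\<mu>)
    also have "\<dots> = (\<Sum>\<gamma>\<in>\<Gamma>. LINT t:{0..1}|m \<gamma>. f (\<gamma> t) * \<sigma> \<gamma> (\<gamma> t))"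
      unfolding set_lebesgue_integral_def
      by (intro sum.cong refl Bochner_Integration.integral_cong)
         (auto simp: indicator_def \<tau>_eq path_image_def)
    also have "\<dots> = cycle_integral \<Gamma> f"
      unfolding cycle_integral_def using \<sigma> f by (intro sum.cong) (auto simp: Q_def)
    finally show "cycle_integral \<Gamma> f = (\<integral>z. f z * \<tau> z \<partial>\<mu>)" by simp
  qed
qed

text \<open>A simple loop is not constant on a short parameter interval, so such an interval
  contains a positive chord and has positive length.\<close>

lemma emeasure_\<mu>_ball_pos:
  assumes p: "p \<in> C" and e: "e > 0"
  shows "emeasure \<mu> (C \<inter> ball p e) > 0"
proof -
  obtain \<gamma> t where \<gamma>: "\<gamma> \<in> \<Gamma>" and t: "t \<in> {0..1}" "p = \<gamma> t"
    using p by (auto simp: cycle_image_def path_image_def)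
  have "continuous_on {0..1} \<gamma>" using paths[OF \<gamma>] by (simp add: path_def)
  then obtain d where d: "d > 0" "\<And>s. s \<in> {0..1} \<Longrightarrow> dist s t < d \<Longrightarrow> dist (\<gamma> s) (\<gamma> t) < e"
    using t e unfolding continuous_on_iff by metis
  define a b where "a = max 0 (t - d/2)" and "b = min 1 (t + d/2)"
  have ab: "0 \<le> a" "a < b" "b \<le> 1" using t d(1) by (auto simp: a_def b_def)
  \<comment> \<open>Stopping at the midpoint keeps \<open>c < 1\<close>, so injectivity on
    \<open>{0..<1}\<close> applies even when \<open>b = 1\<close>.\<close>
  define c where "c = (a + b) / 2"
  have c: "a < c" "c < 1" using ab by (auto simp: c_def)
  have "\<gamma> a \<noteq> \<gamma> c"
    using inj_onD[OF simple_loop_inj_on[OF simple[OF \<gamma>]], of a c] ab c by auto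
  then have "0 < dist (\<gamma> a) (\<gamma> c)" by simp
  also have "\<dots> \<le> length_fun \<gamma> c - length_fun \<gamma> a"
    using dist_le_length_fun[OF rect[OF \<gamma>], of a c] ab c by (simp add: clamp01_id)
  finally have pos: "0 < length_fun \<gamma> c - length_fun \<gamma> a" .
  have "0 < ennreal (length_fun \<gamma> c - length_fun \<gamma> a)" using pos by simp
  also have "\<dots> = emeasure (m \<gamma>) {a<..c}"
    using c length_fun_props[OF paths rect, OF \<gamma> \<gamma>] continuous_at_right_UNIV
    by (intro emeasure_interval_measure_Ioc[symmetric]) (auto simp: mono_def)
  also have "\<dots> \<le> emeasure (m \<gamma>) {t \<in> {0..1}. \<gamma> t \<in> C \<inter> ball p e}"
  proof (rule emeasure_mono)
    show "{a<..c} \<subseteq> {t \<in> {0..1}. \<gamma> t \<in> C \<inter> ball p e}"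
    proof
      fix s assume s: "s \<in> {a<..c}"
      then have s01: "s \<in> {0..1}" using ab c by auto
      moreover have "dist s t < d"
        using s d(1) t unfolding a_def b_def c_def by (auto simp: dist_real_def)
      ultimately have "dist (\<gamma> s) (\<gamma> t) < e" using d(2) by blast
      then show "s \<in> {t \<in> {0..1}. \<gamma> t \<in> C \<inter> ball p e}"
        using s01 path_image_subset[OF \<gamma>] t by (auto simp: path_image_def dist_commute)
    qed
    have "\<gamma> -` (path_image \<gamma> \<inter> ball p e) \<inter> space (restrict_space (m \<gamma>) {0..1}) \<in> sets (restrict_space (m \<gamma>) {0..1})"
      using closed_path_image[OF paths[OF \<gamma>]]
      by (intro measurable_sets[OF measurable_path[OF \<gamma>]]) (auto simp: sets_restrict_space_iff)
    moreover have "\<gamma> -` (path_image \<gamma> \<inter> ball p e) \<inter> space (restrict_space (m \<gamma>) {0..1}) = {t \<in> {0..1}. \<gamma> t \<in> C \<inter> ball p e}"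
      using path_image_subset[OF \<gamma>] by (auto simp: space_restrict_space path_image_def)
    ultimately show "{t \<in> {0..1}. \<gamma> t \<in> C \<inter> ball p e} \<in> sets (m \<gamma>)"
      by (simp add: sets_restrict_space_iff)
  qed
  also have "\<dots> \<le> (\<Sum>\<gamma>\<in>\<Gamma>. emeasure (m \<gamma>) {t \<in> {0..1}. \<gamma> t \<in> C \<inter> ball p e})"
    using finite_cycle \<gamma> by (intro member_le_sum) auto
  also have "\<dots> = emeasure \<mu> (C \<inter> ball p e)"
    by (rule emeasure_\<mu>[symmetric]) auto
  finally show ?thesis .
qed

text \<open>Arc length has full support. This serves to choose generic points and to extend closed
  conditions from almost all points to all points of the cycle.\<close>

lemma AE_dense:
  assumes "AE z in \<mu>. P z" "p \<in> C" "e > 0"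
  obtains z where "z \<in> C" "dist z p < e" "P z"
proof -
  have "\<exists>z\<in>C. dist z p < e \<and> P z"
  proof (rule ccontr)
    assume "\<not> ?thesis"
    then have "AE z in \<mu>. z \<notin> C \<inter> ball p e"
      using assms(1) by (auto elim!: eventually_mono simp: dist_commute)
    then have "emeasure \<mu> (C \<inter> ball p e) = 0"
      by (subst (asm) AE_iff_measurable[of "C \<inter> ball p e"])
         auto
    then show False using emeasure_\<mu>_ball_pos[OF assms(2,3)] by simp
  qed
  then show ?thesis using that by blast
qed

text \<open>Arc length has no atoms: a simple loop meets \<open>p\<close> at finitely many
  parameters, and these are null because the length function is continuous.\<close>

lemma AE_neq: "AE z in \<mu>. z \<noteq> p"
proof (cases "p \<in> C")
  case True
  have "emeasure \<mu> {p} = (\<Sum>\<gamma>\<in>\<Gamma>. emeasure (m \<gamma>) {t \<in> {0..1}. \<gamma> t \<in> {p}})"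
    by (rule emeasure_\<mu>) (use True in \<open>auto simp: sets_\<mu>\<close>)
  also have "\<dots> = 0"
  proof (intro sum.neutral ballI)
    fix \<gamma> assume \<gamma>: "\<gamma> \<in> \<Gamma>"
    have "finite {t \<in> {0..<1}. \<gamma> t \<in> {p}}"
      using finite_vimage_IntI[OF _ simple_loop_inj_on[OF simple[OF \<gamma>]], of "{p}"]
      by (simp add: vimage_def Int_def conj_commute)
    then have "finite ({t \<in> {0..<1}. \<gamma> t \<in> {p}} \<union> {1})" by simp
    then have "finite {t \<in> {0..1}. \<gamma> t \<in> {p}}" by (rule finite_subset[rotated]) auto
    then show "emeasure (m \<gamma>) {t \<in> {0..1}. \<gamma> t \<in> {p}} = 0"
      using finite_null_m[OF \<gamma>] by blast
  qed
  finally have "{p} \<in> null_sets \<mu>" using True by (auto simp: null_sets_def sets_\<mu>)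
  from AE_not_in[OF this] show ?thesis by simp
next
  case False
  then show ?thesis by (intro AE_I2) auto
qed

end

subsection \<open>Geometry and topology\<close>

text \<open>A connected set that avoids the frontier lies inside \<open>G\<close> or misses it. The
  exterior of the disc is unbounded, so it misses \<open>G\<close>; the open disc meets
  \<open>G\<close>, so it is contained in it.\<close>

lemma bounded_open_frontier_subset_sphere:
  fixes G :: "complex set"
  assumes G: "open G" "bounded G" "G \<noteq> {}" and r: "r > 0" and fr: "frontier G \<subseteq> sphere a r"
  shows "G = ball a r" "frontier G = sphere a r"
proof -
  have conn: "S \<subseteq> G \<or> S \<inter> G = {}" if "connected S" "S \<inter> sphere a r = {}" for S
    using connected_Int_frontier[OF that(1), of G] that(2) fr by blast
  have "connected (- cball a r)"
    by (rule connected_complement_bounded_convex) auto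
  moreover have "\<not> bounded (- cball a r)"
    using cobounded_imp_unbounded[of "- cball a r"] by simp
  ultimately have out: "- cball a r \<inter> G = {}"
  proof -
    have "- cball a r \<inter> sphere a r = {}" by auto
    with \<open>connected (- cball a r)\<close> have "- cball a r \<subseteq> G \<or> - cball a r \<inter> G = {}" by (rule conn)
    then show ?thesis using \<open>\<not> bounded (- cball a r)\<close> bounded_subset[OF G(2)] by blast
  qed
  have "G \<subseteq> cball a r" using out by blast
  then have "G \<subseteq> interior (cball a r)" using G(1) by (rule interior_maximal)
  then have sub: "G \<subseteq> ball a r" by simp
  moreover have "ball a r \<subseteq> G"
  proof -
    have "ball a r \<inter> sphere a r = {}" by auto
    moreover have "ball a r \<inter> G \<noteq> {}" using sub G(3) by blast
    ultimately show ?thesis using conn[OF connected_ball, of a r] by blast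
  qed
  ultimately show "G = ball a r" by simp
  then show "frontier G = sphere a r" using r by (simp add: frontier_ball)
qed

text \<open>Both open half-planes are connected, avoid the frontier and are unbounded, so neither
  meets \<open>G\<close>. Then \<open>G\<close> would be an open set inside a line.\<close>

lemma bounded_open_frontier_not_subset_line:
  fixes G :: "complex set"
  assumes G: "open G" "bounded G" "G \<noteq> {}" and d: "d \<noteq> 0"
    and fr: "\<And>z. z \<in> frontier G \<Longrightarrow> Im ((z - p) * cnj d) = 0"
  shows False
proof -
  have half: "{z. s * Im ((z - p) * cnj d) > 0} \<inter> G = {}" if s: "s = 1 \<or> s = -1" for s :: real
  proof -
    let ?H = "{z. s * Im ((z - p) * cnj d) > 0}"
    have "?H = {z. inner (of_real s * \<i> * d) z > s * Im (p * cnj d)}"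
      by (auto simp: inner_complex_def algebra_simps)
    then have "convex ?H" by (simp only: convex_halfspace_gt)
    then have "connected ?H" by (rule convex_connected)
    moreover have "?H \<inter> frontier G = {}" using fr by force
    ultimately have "?H \<subseteq> G \<or> ?H \<inter> G = {}"
      using connected_Int_frontier[of ?H G] by blast
    moreover have "\<not> bounded ?H"
    proof
      assume "bounded ?H"
      then obtain B where B: "\<And>z. z \<in> ?H \<Longrightarrow> cmod z \<le> B" by (auto simp: bounded_iff)
      \<comment> \<open>A move from \<open>p\<close> perpendicular to \<open>d\<close> of length
        \<open>t * cmod d = \<bar>B\<bar> + cmod p + 1\<close> ends at a point of modulus greater
        than \<open>B\<close>.\<close>
      define t where "t = (\<bar>B\<bar> + cmod p + 1) / cmod d"
      have t: "t > 0" using d by (auto simp: t_def intro!: divide_pos_pos add_nonneg_pos)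
      let ?z = "p + of_real (s * t) * \<i> * d"
      have "s * Im ((?z - p) * cnj d) = s * s * (t * (cmod d)\<^sup>2)"
        unfolding cmod_power2 by (simp add: algebra_simps power2_eq_square)
      also have "\<dots> > 0" using s t d by auto
      finally have "?z \<in> ?H" by (simp only: mem_Collect_eq)
      then have "cmod ?z \<le> B" by (rule B)
      moreover have "cmod (of_real (s * t) * \<i> * d) = t * cmod d" using s t by (auto simp: norm_mult)
      moreover have "t * cmod d = \<bar>B\<bar> + cmod p + 1" using d by (simp add: t_def)
      ultimately show False
        using norm_triangle_ineq2[of "of_real (s * t) * \<i> * d" "- p"] by (simp add: add.commute)
    qed
    ultimately show ?thesis using G(2) bounded_subset by blast
  qed
  have on_line: "Im ((z - p) * cnj d) = 0" if "z \<in> G" for z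
  proof (rule ccontr)
    assume "Im ((z - p) * cnj d) \<noteq> 0"
    then have "1 * Im ((z - p) * cnj d) > 0 \<or> (-1) * Im ((z - p) * cnj d) > 0" by linarith
    then show False using half[of 1] half[of "-1"] that by blast
  qed
  obtain z where z: "z \<in> G" using G(3) by blast
  then obtain e where e: "e > 0" "ball z e \<subseteq> G" using G(1) open_contains_ball by blast
  define t where "t = e / (2 * cmod d)"
  have t: "t > 0" "t * cmod d = e / 2" using e d by (simp_all add: t_def)
  have "cmod (of_real t * \<i> * d) = e / 2"
    unfolding norm_mult norm_of_real using t by simp
  then have "z + of_real t * \<i> * d \<in> ball z e" using e by (simp only: mem_ball dist_norm) simp
  then have "Im ((z + of_real t * \<i> * d - p) * cnj d) = 0" using e(2) on_line by blast
  moreover have "Im ((z + of_real t * \<i> * d - p) * cnj d) = Im ((z - p) * cnj d) + t * (cmod d)\<^sup>2"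
    unfolding cmod_power2 by (simp add: algebra_simps power2_eq_square)
  ultimately show False using on_line[OF z] t(1) d by simp
qed

text \<open>The equation says that \<open>(z - z1) / (z - z2)\<close> has constant argument modulo \<open>\<pi>\<close>.\<close>

lemma inscribed_angle_locus:
  assumes b: "cmod b1 = 1" "cmod b2 = 1" and ne: "z1 \<noteq> z2"
    and eq: "\<And>z. z \<in> S \<Longrightarrow> b1 * ((z - z1) * cnj (z - z2)) = b2 * ((z - z2) * cnj (z - z1))"
  shows "(\<exists>c R. \<forall>z\<in>S. (cmod (z - c))\<^sup>2 = R) \<or> (\<exists>d. d \<noteq> 0 \<and> (\<forall>z\<in>S. Im ((z - z1) * cnj d) = 0))"
proof -
  \<comment> \<open>With \<open>q = (z - z1) * cnj (z - z2)\<close> the hypothesis reads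
    \<open>\<beta>\<^sup>2 * q = cnj q\<close>. Since \<beta> is unimodular, this says that
    \<open>\<beta> * q\<close> is real.\<close>
  define \<beta> where "\<beta> = csqrt (b1 / b2)"
  have sq: "\<beta>\<^sup>2 = b1 / b2" by (simp add: \<beta>_def)
  have "(cmod \<beta>)\<^sup>2 = 1" using b sq by (simp add: norm_power[symmetric] norm_divide)
  then have \<beta>1: "\<beta> * cnj \<beta> = 1" by (simp add: complex_norm_square[symmetric] power2_eq_square flip: of_real_mult)
  have b2: "b2 \<noteq> 0" using b by auto
  have im0: "Im (\<beta> * ((z - z1) * cnj (z - z2))) = 0" if "z \<in> S" for z
  proof -
    let ?q = "(z - z1) * cnj (z - z2)"
    have "\<beta>\<^sup>2 * ?q = cnj ?q"
      using eq[OF that] b2 by (simp add: sq field_simps)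
    then have "cnj \<beta> * cnj ?q = cnj \<beta> * (\<beta>\<^sup>2 * ?q)" by (simp only:)
    also have "\<dots> = (\<beta> * cnj \<beta>) * (\<beta> * ?q)" by (simp only: power2_eq_square ac_simps)
    also have "\<dots> = \<beta> * ?q" unfolding \<beta>1 by (rule mult_1)
    finally have "cnj (\<beta> * ?q) = \<beta> * ?q" by (simp only: complex_cnj_mult)
    then have "Im (cnj (\<beta> * ?q)) = Im (\<beta> * ?q)" by (simp only:)
    then show ?thesis unfolding cnj.sel by linarith
  qed
  show ?thesis
  proof (cases "Im \<beta> = 0")
    case True
    have "Re \<beta> \<noteq> 0"
    proof
      assume "Re \<beta> = 0"
      with True have "\<beta> = 0" by (simp add: complex_eq_iff)
      then show False using \<beta>1 by simp
    qed
    \<comment> \<open>\<open>(z - z1) * cnj (z - z2)\<close> and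
      \<open>(z - z1) * cnj (z1 - z2)\<close> differ by the real number
      \<open>(cmod (z - z1))\<^sup>2\<close>.\<close>
    have "Im ((z - z1) * cnj (z1 - z2)) = 0" if "z \<in> S" for z
    proof -
      have "Re \<beta> * Im ((z - z1) * cnj (z - z2)) = 0" using im0[OF that] True by simp
      then have "Im ((z - z1) * cnj (z - z2)) = 0" using \<open>Re \<beta> \<noteq> 0\<close> by simp
      then show ?thesis by (simp add: algebra_simps)
    qed
    then show ?thesis using ne by (intro disjI2 exI[of _ "z1 - z2"]) auto
  next
    case False
    \<comment> \<open>Expanding the condition gives
      \<open>s * (cmod z)\<^sup>2 + Im (k * z) + const = 0\<close>. As \<open>s\<close> is nonzero
      the square can be completed; \<open>c\<close> is the resulting centre.\<close>
    define s k where "s = Im \<beta>" and "k = cnj \<beta> * cnj z1 - \<beta> * cnj z2"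
    have s: "s \<noteq> 0" using False by (simp add: s_def)
    define c where "c = Complex (- Im k / (2 * s)) (- Re k / (2 * s))"
    have "(cmod (z - c))\<^sup>2 = (cmod c)\<^sup>2 - Im (\<beta> * (z1 * cnj z2)) / s" if "z \<in> S" for z
    proof -
      have "s * (cmod z)\<^sup>2 + Im (k * z) + Im (\<beta> * (z1 * cnj z2)) = Im (\<beta> * ((z - z1) * cnj (z - z2)))"
        unfolding cmod_power2 by (simp add: s_def k_def algebra_simps power2_eq_square)
      then have 1: "s * (cmod z)\<^sup>2 + Im (k * z) + Im (\<beta> * (z1 * cnj z2)) = 0" using im0[OF that] by simp
      have "Im (k * z) = - 2 * s * (Re z * Re c + Im z * Im c)"
        using s by (simp add: c_def field_simps)
      moreover have "(cmod (z - c))\<^sup>2 = (cmod z)\<^sup>2 + (cmod c)\<^sup>2 - 2 * (Re z * Re c + Im z * Im c)"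
        unfolding cmod_power2 by (simp add: power2_eq_square algebra_simps)
      ultimately have "s * (cmod (z - c))\<^sup>2 = s * (cmod z)\<^sup>2 + s * (cmod c)\<^sup>2 + Im (k * z)"
        by (simp only:) (simp add: algebra_simps)
      also have "\<dots> = s * ((cmod c)\<^sup>2 - Im (\<beta> * (z1 * cnj z2)) / s)"
        using 1 s by (simp only: right_diff_distrib) simp
      finally show ?thesis using s by (simp only: mult_cancel_left) simp
    qed
    then show ?thesis by blast
  qed
qed

subsection \<open>Self-adjointness forces a Hermitian kernel\<close>

lemma borel_measurable_cnj: "cnj \<in> borel_measurable borel"
  by (intro borel_measurable_continuous_onI continuous_intros)

lemma cauchy_singular_eq: "has_cauchy_pv \<Gamma> f \<zeta> l \<Longrightarrow> cauchy_singular \<Gamma> f \<zeta> = l"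
proof -
  have uniq: "l' = l''" if "has_cauchy_pv \<Gamma> f \<zeta> l'" "has_cauchy_pv \<Gamma> f \<zeta> l''" for l' l''
    using that unfolding has_cauchy_pv_def by (blast intro: tendsto_unique[OF trivial_limit_at_right_real])
  assume l: "has_cauchy_pv \<Gamma> f \<zeta> l"
  then have "(THE l. has_cauchy_pv \<Gamma> f \<zeta> l) = l" using uniq by blast
  then show ?thesis using l by (auto simp: cauchy_singular_def)
qed

text \<open>The complement of the diagonal is covered by countably many products of small separated
  balls with centres in a countable dense set, and the sublevel sets of \<open>u\<close> exhaust the
  plane. Localizing therefore costs only countably many null sets.\<close>

lemma AE_off_diagonal_if_AE_separated_balls:
  fixes P :: "complex \<times> complex \<Rightarrow> bool" and u :: "complex \<Rightarrow> real"
  assumes "\<And>p q \<rho> n. \<rho> > 0 \<Longrightarrow> dist p q \<ge> 3 * \<rho> \<Longrightarrow>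
    AE x in M. fst x \<in> ball p \<rho> \<longrightarrow> snd x \<in> ball q \<rho> \<longrightarrow> u (fst x) \<le> real n \<longrightarrow> u (snd x) \<le> real n \<longrightarrow> P x"
  shows "AE x in M. fst x \<noteq> snd x \<longrightarrow> P x"
proof -
  obtain D :: "complex set" where D: "countable D" "\<And>X. open X \<Longrightarrow> X \<noteq> {} \<Longrightarrow> \<exists>d\<in>D. d \<in> X"
    by (erule countable_dense_setE)
  have "AE x in M. \<forall>p\<in>D. \<forall>q\<in>D. \<forall>k n :: nat. dist p q \<ge> 3 * (1 / real (Suc k)) \<longrightarrow>
    fst x \<in> ball p (1 / real (Suc k)) \<longrightarrow> snd x \<in> ball q (1 / real (Suc k)) \<longrightarrow>
    u (fst x) \<le> real n \<longrightarrow> u (snd x) \<le> real n \<longrightarrow> P x"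
    using assms by (intro AE_ball_countable' AE_all_countable[THEN iffD2] allI D(1)) (auto intro!: AE_impI)
  then show ?thesis
  proof eventually_elim
    case (elim x)
    show ?case
    proof
      assume ne: "fst x \<noteq> snd x"
      \<comment> \<open>With a radius below a fifth of the distance, replacing both points by nearby
        centres costs two radii and leaves the required three.\<close>
      then obtain k :: nat where k: "1 / real (Suc k) < dist (fst x) (snd x) / 5"
        using nat_approx_posE[of "dist (fst x) (snd x) / 5"] by (metis zero_less_dist_iff zero_less_divide_iff zero_less_numeral of_nat_Suc)
      define \<rho> where "\<rho> = 1 / real (Suc k)"
      have \<rho>: "\<rho> > 0" by (simp add: \<rho>_def)
      obtain p where p: "p \<in> D" "p \<in> ball (fst x) \<rho>" using D(2)[of "ball (fst x) \<rho>"] \<rho> by auto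
      obtain q where q: "q \<in> D" "q \<in> ball (snd x) \<rho>" using D(2)[of "ball (snd x) \<rho>"] \<rho> by auto
      obtain n :: nat where n: "max (u (fst x)) (u (snd x)) \<le> real n" using real_arch_simple by blast
      have "dist (fst x) (snd x) \<le> dist (fst x) p + dist p q + dist (snd x) q"
        by (metis add.commute add.left_commute dist_commute dist_triangle_le dist_triangle2 add_mono order_refl)
      then have "dist p q \<ge> 3 * \<rho>" using p q k by (simp add: \<rho>_def dist_commute)
      then show "P x"
        using elim[rule_format, of p q k n] p q n by (simp add: \<rho>_def dist_commute)
    qed
  qed
qed

context rectifiable_cycle
begin

section \<open>Weighted integrals and truncated kernels on a cycle\<close>

lemma borel_measurable_\<mu>: "f \<in> borel_measurable borel \<Longrightarrow> f \<in> borel_measurable \<mu>"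
  by (simp add: measurable_restrict_space1 cong: measurable_cong_sets)

lemma truncated_kernel_measurable:
  assumes "f \<in> borel_measurable \<mu>" shows "truncated_kernel f \<zeta> \<epsilon> \<in> borel_measurable \<mu>"
proof -
  have [measurable]: "(\<lambda>z. z) \<in> borel_measurable \<mu>" by (rule borel_measurable_\<mu>) simp
  note [measurable] = assms
  show ?thesis unfolding truncated_kernel_def[abs_def] by measurable
qed

lemma truncated_kernel_integrable:
  assumes f: "f \<in> borel_measurable \<mu>" "\<And>z. z \<in> C \<Longrightarrow> cmod (f z) \<le> K" and "\<epsilon> > 0"
  shows "integrable \<mu> (truncated_kernel f \<zeta> \<epsilon>)"
proof (rule integrable_const_bound[where B="K / \<epsilon>"])
  have "cmod (truncated_kernel f \<zeta> \<epsilon> z) \<le> K / \<epsilon>" if "z \<in> C" for z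
    using f(2)[OF that] \<open>\<epsilon> > 0\<close> norm_ge_zero[of "f z"]
    by (cases "\<epsilon> \<le> cmod (z - \<zeta>)") (auto simp: truncated_kernel_def norm_divide simp del: norm_ge_zero intro!: frac_le)
  then show "AE z in \<mu>. cmod (truncated_kernel f \<zeta> \<epsilon> z) \<le> K / \<epsilon>" by (intro AE_I2) simp
qed (rule truncated_kernel_measurable[OF f(1)])

lemma integrable_weighted_iff:
  fixes f :: "complex \<Rightarrow> 'b::{banach,second_countable_topology}"
  assumes w: "w \<in> borel_measurable \<mu>" "\<And>z. z \<in> C \<Longrightarrow> 0 \<le> w z" and f: "f \<in> borel_measurable \<mu>"
  shows "integrable (weighted_measure \<Gamma> w) f \<longleftrightarrow> integrable \<mu> (\<lambda>z. w z *\<^sub>R f z)"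
  unfolding weighted_measure_def by (rule integrable_density[OF f w(1)]) (use w(2) in \<open>auto intro: AE_I2\<close>)

lemma integral_weighted:
  fixes f :: "complex \<Rightarrow> 'b::{banach,second_countable_topology}"
  assumes w: "w \<in> borel_measurable \<mu>" "\<And>z. z \<in> C \<Longrightarrow> 0 \<le> w z" and f: "f \<in> borel_measurable \<mu>"
  shows "(\<integral>z. f z \<partial>weighted_measure \<Gamma> w) = (\<integral>z. w z *\<^sub>R f z \<partial>\<mu>)"
  unfolding weighted_measure_def by (rule integral_density[OF f w(1)]) (use w(2) in \<open>auto intro: AE_I2\<close>)

text \<open>The bound of \<open>w\<close> on \<open>A\<close> together with the finiteness of arc
  length gives integrability.\<close>

lemma indicator_in_L2:
  assumes w: "w \<in> borel_measurable \<mu>" "\<And>z. z \<in> C \<Longrightarrow> 0 \<le> w z"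
    and A: "A \<in> sets \<mu>" "\<And>z. z \<in> A \<Longrightarrow> w z \<le> n"
  shows "indicator A \<in> L2 (weighted_measure \<Gamma> w)"
proof -
  have m: "(indicator A :: complex \<Rightarrow> complex) \<in> borel_measurable \<mu>" using A(1) by (rule borel_measurable_indicator)
  have nm: "(\<lambda>z. (cmod (indicator A z))\<^sup>2) \<in> borel_measurable \<mu>" using m by measurable
  have "integrable \<mu> (\<lambda>z. w z *\<^sub>R (cmod (indicator A z))\<^sup>2)"
  proof (rule integrable_const_bound[where B="\<bar>n\<bar>"])
    show "AE z in \<mu>. norm (w z *\<^sub>R (cmod (indicator A z))\<^sup>2) \<le> \<bar>n\<bar>"
    proof (rule AE_I2)
      fix z assume "z \<in> space \<mu>"
      then show "norm (w z *\<^sub>R (cmod (indicator A z))\<^sup>2) \<le> \<bar>n\<bar>"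
        using A(2)[of z] w(2)[of z] by (auto simp: indicator_def)
    qed
    show "(\<lambda>z. w z *\<^sub>R (cmod (indicator A z))\<^sup>2) \<in> borel_measurable \<mu>"
      using m w(1) by measurable
  qed
  then show ?thesis
    using integrable_weighted_iff[OF w nm] m
    unfolding L2_def by (intro CollectI conjI) (simp_all only: weighted_measure_def measurable_density_eq1)
qed

context
  fixes \<tau> :: "complex \<Rightarrow> complex"
  assumes \<tau>_meas: "\<tau> \<in> borel_measurable borel"
    and \<tau>_norm: "\<And>z. cmod (\<tau> z) = 1"
    and \<tau>_integral: "\<And>f. integrable \<mu> f \<Longrightarrow> cycle_integral \<Gamma> f = (\<integral>z. f z * \<tau> z \<partial>\<mu>)"
begin

text \<open>For \<epsilon> below the distance \<delta> between \<zeta> and the support of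
  \<open>f\<close> the truncation removes nothing, so the principal value is the limit of an
  eventually constant family.\<close>

lemma cauchy_singular_separated:
  assumes f: "f \<in> borel_measurable \<mu>" "\<And>z. z \<in> C \<Longrightarrow> cmod (f z) \<le> K"
    and \<delta>: "\<delta> > 0" "\<And>z. z \<in> C \<Longrightarrow> f z \<noteq> 0 \<Longrightarrow> \<delta> \<le> cmod (z - \<zeta>)"
  shows "cauchy_singular \<Gamma> f \<zeta> = 1 / (2 * pi * \<i>) * (\<integral>z. f z * (\<tau> z / (z - \<zeta>)) \<partial>\<mu>)"
proof (rule cauchy_singular_eq)
  show "has_cauchy_pv \<Gamma> f \<zeta> (1 / (2 * pi * \<i>) * (\<integral>z. f z * (\<tau> z / (z - \<zeta>)) \<partial>\<mu>))"
    unfolding has_cauchy_pv_def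
  proof (intro conjI allI impI)
    show "integrable \<mu> (truncated_kernel f \<zeta> \<epsilon>)" if "\<epsilon> > 0" for \<epsilon>
      using truncated_kernel_integrable[OF f that] by simp
    have "\<forall>\<^sub>F \<epsilon> in at_right 0. 1 / (2 * pi * \<i>) * cycle_integral \<Gamma> (truncated_kernel f \<zeta> \<epsilon>)
        = 1 / (2 * pi * \<i>) * (\<integral>z. f z * (\<tau> z / (z - \<zeta>)) \<partial>\<mu>)"
      using eventually_at_right_real[OF \<delta>(1)]
    proof eventually_elim
      case (elim \<epsilon>)
      have "cycle_integral \<Gamma> (truncated_kernel f \<zeta> \<epsilon>) = (\<integral>z. truncated_kernel f \<zeta> \<epsilon> z * \<tau> z \<partial>\<mu>)"
        using elim by (intro \<tau>_integral truncated_kernel_integrable[OF f]) auto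
      also have "\<dots> = (\<integral>z. f z * (\<tau> z / (z - \<zeta>)) \<partial>\<mu>)"
        using elim \<delta>(2) by (intro Bochner_Integration.integral_cong) (force simp: truncated_kernel_def)+
      finally show ?case by simp
    qed
    then show "((\<lambda>\<epsilon>. 1 / (2 * pi * \<i>) * cycle_integral \<Gamma> (truncated_kernel f \<zeta> \<epsilon>)) \<longlongrightarrow>
      1 / (2 * pi * \<i>) * (\<integral>z. f z * (\<tau> z / (z - \<zeta>)) \<partial>\<mu>)) (at_right 0)"
      by (rule tendsto_eventually)
  qed
qed

text \<open>For indicators of separated sets \<open>A\<close> and \<open>B\<close>, Fubini turns the
  two inner products into integrals over \<open>A \<times> B\<close>. Measurable rectangles generate
  the product sigma algebra, so equality of these integrals gives equality of the kernels for almost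
  all pairs.\<close>

lemma hermitian_kernel:
  assumes w: "w \<in> borel_measurable \<mu>" "\<And>z. z \<in> C \<Longrightarrow> 0 \<le> w z"
    and sa: "self_adjoint_in_L2 (weighted_measure \<Gamma> w) (cauchy_singular \<Gamma>)"
  shows "AE z in \<mu>. AE \<zeta> in \<mu>. z \<noteq> \<zeta> \<longrightarrow> w \<zeta> * (\<tau> z / (z - \<zeta>)) = w z * cnj (\<tau> \<zeta> / (z - \<zeta>))"
proof -
  let ?\<nu> = "weighted_measure \<Gamma> w"
  let ?T = "cauchy_singular \<Gamma>"
  interpret pair_sigma_finite \<mu> \<mu> by unfold_locales
  interpret PP: finite_measure "\<mu> \<Otimes>\<^sub>M \<mu>"
    by (rule finite_measure_pair_measure) unfold_locales
  have \<tau>m[measurable]: "\<tau> \<in> borel_measurable \<mu>" by (rule borel_measurable_\<mu>[OF \<tau>_meas])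
  have idm[measurable]: "(\<lambda>z. z) \<in> borel_measurable \<mu>" by (rule borel_measurable_\<mu>) simp
  note [measurable] = w(1)
  have "AE x in \<mu> \<Otimes>\<^sub>M \<mu>. fst x \<in> ball p \<rho> \<longrightarrow> snd x \<in> ball q \<rho> \<longrightarrow> w (fst x) \<le> real n \<longrightarrow> w (snd x) \<le> real n \<longrightarrow>
     w (snd x) * (\<tau> (fst x) / (fst x - snd x)) = w (fst x) * cnj (\<tau> (snd x) / (fst x - snd x))"
    if \<rho>: "\<rho> > 0" "dist p q \<ge> 3 * \<rho>" for p q \<rho> n
  proof -
    \<comment> \<open>Cutting at the level \<open>n\<close> of \<open>w\<close> puts indicators of
      subsets into the weighted space and bounds both kernels, so the product integrals converge
      absolutely.\<close>
    define A0 B0 where "A0 = {z \<in> space \<mu>. z \<in> ball p \<rho> \<and> w z \<le> real n}"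
      and "B0 = {z \<in> space \<mu>. z \<in> ball q \<rho> \<and> w z \<le> real n}"
    have A0[measurable]: "A0 \<in> sets \<mu>" and B0[measurable]: "B0 \<in> sets \<mu>"
      unfolding A0_def B0_def mem_ball by measurable
    have AC: "A0 \<subseteq> C" "B0 \<subseteq> C" by (auto simp: A0_def B0_def)
    have far: "\<rho> \<le> cmod (z - \<zeta>)" if "z \<in> A0" "\<zeta> \<in> B0" for z \<zeta>
    proof -
      have "dist p z < \<rho>" "dist q \<zeta> < \<rho>" using that by (auto simp: A0_def B0_def)
      moreover have "dist p q \<le> dist p z + dist z \<zeta> + dist q \<zeta>"
        using dist_triangle[of p q z] dist_triangle[of z q \<zeta>] by (simp add: dist_commute)
      ultimately have "\<rho> \<le> dist z \<zeta>" using \<rho> by linarith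
      then show ?thesis by (simp add: dist_norm)
    qed
    \<comment> \<open>\<open>k1\<close> belongs to the operator, with the weight at the evaluation
      point \<zeta>; \<open>k2\<close> belongs to its adjoint, with the weight at \<open>z\<close>.
      The common factor \<open>1 / (2 * pi * \<i>)\<close> is left out.\<close>
    define k1 k2 where "k1 z \<zeta> = of_real (w \<zeta>) * (\<tau> z / (z - \<zeta>))"
      and "k2 z \<zeta> = of_real (w z) * cnj (\<tau> \<zeta> / (z - \<zeta>))" for z \<zeta>
    have kbound: "cmod (k1 z \<zeta>) \<le> real n / \<rho>" "cmod (k2 z \<zeta>) \<le> real n / \<rho>" if "z \<in> A0" "\<zeta> \<in> B0" for z \<zeta>
    proof -
      have "0 \<le> w z" "w z \<le> real n" "0 \<le> w \<zeta>" "w \<zeta> \<le> real n"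
        using that w(2) AC by (auto simp: A0_def B0_def)
      then show "cmod (k1 z \<zeta>) \<le> real n / \<rho>" "cmod (k2 z \<zeta>) \<le> real n / \<rho>"
        using far[OF that] \<rho> \<tau>_norm by (auto simp: k1_def k2_def norm_mult norm_divide simp del: complex_cnj_divide complex_cnj_diff intro!: frac_le)
    qed
    define F where "F x = indicator (A0 \<times> B0) x *\<^sub>R (k1 (fst x) (snd x) - k2 (fst x) (snd x))" for x
    have [measurable]: "fst \<in> borel_measurable (\<mu> \<Otimes>\<^sub>M \<mu>)" "snd \<in> borel_measurable (\<mu> \<Otimes>\<^sub>M \<mu>)"
      using measurable_compose[OF measurable_fst idm] measurable_compose[OF measurable_snd idm] by simp_all
    have [measurable]: "(\<lambda>x. cnj (\<tau> (snd x) / (fst x - snd x))) \<in> borel_measurable (\<mu> \<Otimes>\<^sub>M \<mu>)"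
      by (rule measurable_compose[OF _ borel_measurable_cnj]) measurable
    have [measurable]: "(\<lambda>x. k1 (fst x) (snd x)) \<in> borel_measurable (\<mu> \<Otimes>\<^sub>M \<mu>)"
      "(\<lambda>x. k2 (fst x) (snd x)) \<in> borel_measurable (\<mu> \<Otimes>\<^sub>M \<mu>)"
      unfolding k1_def k2_def by measurable
    have indk: "integrable (\<mu> \<Otimes>\<^sub>M \<mu>) (\<lambda>x. indicator (A \<times> B) x *\<^sub>R k1 (fst x) (snd x))"
      "integrable (\<mu> \<Otimes>\<^sub>M \<mu>) (\<lambda>x. indicator (A \<times> B) x *\<^sub>R k2 (fst x) (snd x))"
      if AB[measurable]: "A \<in> sets \<mu>" "B \<in> sets \<mu>" and sub: "A \<subseteq> A0" "B \<subseteq> B0" for A B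
    proof -
      have "cmod (indicator (A \<times> B) x *\<^sub>R k1 (fst x) (snd x)) \<le> real n / \<rho>"
        "cmod (indicator (A \<times> B) x *\<^sub>R k2 (fst x) (snd x)) \<le> real n / \<rho>" for x
        using kbound[of "fst x" "snd x"] sub \<rho> by (cases x; auto simp: indicator_def)+
      then show "integrable (\<mu> \<Otimes>\<^sub>M \<mu>) (\<lambda>x. indicator (A \<times> B) x *\<^sub>R k1 (fst x) (snd x))"
        "integrable (\<mu> \<Otimes>\<^sub>M \<mu>) (\<lambda>x. indicator (A \<times> B) x *\<^sub>R k2 (fst x) (snd x))"
        by (auto intro!: PP.integrable_const_bound[where B="real n / \<rho>"])
    qed
    have rect: "(\<integral>x. indicator (A \<times> B) x *\<^sub>R (k1 (fst x) (snd x) - k2 (fst x) (snd x)) \<partial>(\<mu> \<Otimes>\<^sub>M \<mu>)) = 0"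
      if AB[measurable]: "A \<in> sets \<mu>" "B \<in> sets \<mu>" and sub: "A \<subseteq> A0" "B \<subseteq> B0" for A B
    proof -
      note ABC = subset_trans[OF sub(1) AC(1)] subset_trans[OF sub(2) AC(2)]
      let ?f = "indicator A :: complex \<Rightarrow> complex" and ?g = "indicator B :: complex \<Rightarrow> complex"
      have fg: "?f \<in> L2 ?\<nu>" "?g \<in> L2 ?\<nu>"
        using sub AB by (auto intro!: indicator_in_L2[OF w, where n="real n"] simp: A0_def B0_def)
      then have Tm[measurable]: "?T ?f \<in> borel_measurable \<mu>" "?T ?g \<in> borel_measurable \<mu>"
        using sa unfolding self_adjoint_in_L2_def L2_def by (auto simp: weighted_measure_def)
      have Tf: "?T ?f \<zeta> = 1 / (2 * pi * \<i>) * (\<integral>z. ?f z * (\<tau> z / (z - \<zeta>)) \<partial>\<mu>)" if "\<zeta> \<in> B" for \<zeta>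
        by (rule cauchy_singular_separated[where K=1 and \<delta>=\<rho>])
           (use that sub far \<rho> in \<open>auto simp: indicator_def\<close>)
      have Tg: "?T ?g z = 1 / (2 * pi * \<i>) * (\<integral>\<zeta>. ?g \<zeta> * (\<tau> \<zeta> / (\<zeta> - z)) \<partial>\<mu>)" if "z \<in> A" for z
        by (rule cauchy_singular_separated[where K=1 and \<delta>=\<rho>])
           (use that sub far[of z] \<rho> in \<open>auto simp: indicator_def norm_minus_commute\<close>)
      have cmb: "(\<lambda>z. ?T ?f z * cnj (?g z)) \<in> borel_measurable \<mu>" "(\<lambda>z. ?f z * cnj (?T ?g z)) \<in> borel_measurable \<mu>"
        using AB Tm measurable_compose[OF Tm(2) borel_measurable_cnj]
          measurable_compose[OF borel_measurable_indicator[OF AB(2)] borel_measurable_cnj]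
        by (auto intro!: borel_measurable_times)
      have "(\<integral>z. ?T ?f z * cnj (?g z) \<partial>?\<nu>) = (\<integral>\<zeta>. w \<zeta> *\<^sub>R (?T ?f \<zeta> * cnj (?g \<zeta>)) \<partial>\<mu>)"
        by (rule integral_weighted[OF w cmb(1)])
      also have "\<dots> = (\<integral>\<zeta>. 1 / (2 * pi * \<i>) * (\<integral>z. indicator (A \<times> B) (z, \<zeta>) *\<^sub>R k1 z \<zeta> \<partial>\<mu>) \<partial>\<mu>)"
      proof (rule Bochner_Integration.integral_cong[OF refl])
        fix \<zeta>
        show "w \<zeta> *\<^sub>R (?T ?f \<zeta> * cnj (?g \<zeta>)) = 1 / (2 * pi * \<i>) * (\<integral>z. indicator (A \<times> B) (z, \<zeta>) *\<^sub>R k1 z \<zeta> \<partial>\<mu>)"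
        proof (cases "\<zeta> \<in> B")
          case True
          have "(\<integral>z. indicator (A \<times> B) (z, \<zeta>) *\<^sub>R k1 z \<zeta> \<partial>\<mu>) = (\<integral>z. of_real (w \<zeta>) * (?f z * (\<tau> z / (z - \<zeta>))) \<partial>\<mu>)"
            using True by (intro Bochner_Integration.integral_cong) (auto simp: indicator_def k1_def)
          also have "\<dots> = of_real (w \<zeta>) * (\<integral>z. ?f z * (\<tau> z / (z - \<zeta>)) \<partial>\<mu>)"
            by (rule integral_mult_right_zero)
          finally show ?thesis using Tf[OF True] True by (simp add: scaleR_conv_of_real)
        qed (simp add: indicator_def)
      qed
      also have "\<dots> = 1 / (2 * pi * \<i>) * (\<integral>\<zeta>. (\<integral>z. indicator (A \<times> B) (z, \<zeta>) *\<^sub>R k1 z \<zeta> \<partial>\<mu>) \<partial>\<mu>)"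
        by (rule integral_mult_right_zero)
      also have "(\<integral>\<zeta>. (\<integral>z. indicator (A \<times> B) (z, \<zeta>) *\<^sub>R k1 z \<zeta> \<partial>\<mu>) \<partial>\<mu>) =
          (\<integral>x. indicator (A \<times> B) x *\<^sub>R k1 (fst x) (snd x) \<partial>(\<mu> \<Otimes>\<^sub>M \<mu>))"
        using integral_snd[of "\<lambda>z \<zeta>. indicator (A \<times> B) (z, \<zeta>) *\<^sub>R k1 z \<zeta>"] indk(1)[OF that]
        by (simp add: case_prod_beta')
      finally have 1: "(\<integral>z. ?T ?f z * cnj (?g z) \<partial>?\<nu>) =
        1 / (2 * pi * \<i>) * (\<integral>x. indicator (A \<times> B) x *\<^sub>R k1 (fst x) (snd x) \<partial>(\<mu> \<Otimes>\<^sub>M \<mu>))" .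
      have "(\<integral>z. ?f z * cnj (?T ?g z) \<partial>?\<nu>) = (\<integral>z. w z *\<^sub>R (?f z * cnj (?T ?g z)) \<partial>\<mu>)"
        by (rule integral_weighted[OF w cmb(2)])
      also have "\<dots> = (\<integral>z. 1 / (2 * pi * \<i>) * (\<integral>\<zeta>. indicator (A \<times> B) (z, \<zeta>) *\<^sub>R k2 z \<zeta> \<partial>\<mu>) \<partial>\<mu>)"
      proof (rule Bochner_Integration.integral_cong[OF refl])
        fix z
        show "w z *\<^sub>R (?f z * cnj (?T ?g z)) = 1 / (2 * pi * \<i>) * (\<integral>\<zeta>. indicator (A \<times> B) (z, \<zeta>) *\<^sub>R k2 z \<zeta> \<partial>\<mu>)"
        proof (cases "z \<in> A")
          case True
          \<comment> \<open>Two signs cancel: conjugation reverses that of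
            \<open>1 / (2 * pi * \<i>)\<close>, and the difference in the denominator is reversed as
            well.\<close>
          have "(\<integral>\<zeta>. indicator (A \<times> B) (z, \<zeta>) *\<^sub>R k2 z \<zeta> \<partial>\<mu>) = (\<integral>\<zeta>. - of_real (w z) * cnj (?g \<zeta> * (\<tau> \<zeta> / (\<zeta> - z))) \<partial>\<mu>)"
          proof (intro Bochner_Integration.integral_cong refl)
            fix \<zeta>
            have "z - \<zeta> = - (\<zeta> - z)" by simp
            then have "\<tau> \<zeta> / (z - \<zeta>) = - (\<tau> \<zeta> / (\<zeta> - z))" by (metis divide_minus_right)
            then show "indicator (A \<times> B) (z, \<zeta>) *\<^sub>R k2 z \<zeta> = - of_real (w z) * cnj (?g \<zeta> * (\<tau> \<zeta> / (\<zeta> - z)))"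
              using True unfolding k2_def by (simp add: indicator_def)
          qed
          also have "\<dots> = - of_real (w z) * (\<integral>\<zeta>. cnj (?g \<zeta> * (\<tau> \<zeta> / (\<zeta> - z))) \<partial>\<mu>)"
            by (rule integral_mult_right_zero)
          also have "(\<integral>\<zeta>. cnj (?g \<zeta> * (\<tau> \<zeta> / (\<zeta> - z))) \<partial>\<mu>) = cnj (\<integral>\<zeta>. ?g \<zeta> * (\<tau> \<zeta> / (\<zeta> - z)) \<partial>\<mu>)"
            by (rule integral_bounded_linear'[OF bounded_linear_cnj bounded_linear_cnj]) simp
          finally show ?thesis using Tg[OF True] True by (simp add: scaleR_conv_of_real)
        qed (simp add: indicator_def)
      qed
      also have "\<dots> = 1 / (2 * pi * \<i>) * (\<integral>z. (\<integral>\<zeta>. indicator (A \<times> B) (z, \<zeta>) *\<^sub>R k2 z \<zeta> \<partial>\<mu>) \<partial>\<mu>)"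
        by (rule integral_mult_right_zero)
      also have "(\<integral>z. (\<integral>\<zeta>. indicator (A \<times> B) (z, \<zeta>) *\<^sub>R k2 z \<zeta> \<partial>\<mu>) \<partial>\<mu>) =
          (\<integral>x. indicator (A \<times> B) x *\<^sub>R k2 (fst x) (snd x) \<partial>(\<mu> \<Otimes>\<^sub>M \<mu>))"
        using integral_fst[of "\<lambda>z \<zeta>. indicator (A \<times> B) (z, \<zeta>) *\<^sub>R k2 z \<zeta>"] indk(2)[OF that]
        by (simp add: case_prod_beta')
      finally have 2: "(\<integral>z. ?f z * cnj (?T ?g z) \<partial>?\<nu>) =
        1 / (2 * pi * \<i>) * (\<integral>x. indicator (A \<times> B) x *\<^sub>R k2 (fst x) (snd x) \<partial>(\<mu> \<Otimes>\<^sub>M \<mu>))" .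
      have "L2_inner ?\<nu> (?T ?f) ?g = L2_inner ?\<nu> ?f (?T ?g)"
        using sa fg unfolding self_adjoint_in_L2_def by blast
      then have "(\<integral>x. indicator (A \<times> B) x *\<^sub>R k1 (fst x) (snd x) \<partial>(\<mu> \<Otimes>\<^sub>M \<mu>)) =
        (\<integral>x. indicator (A \<times> B) x *\<^sub>R k2 (fst x) (snd x) \<partial>(\<mu> \<Otimes>\<^sub>M \<mu>))"
        unfolding L2_inner_def 1 2 by simp
      then show ?thesis using indk[OF that] by (simp add: scaleR_diff_right)
    qed
    have "AE x in \<mu> \<Otimes>\<^sub>M \<mu>. F x = 0"
    proof (rule AE_zero_if_integral_zero_generator)
      show "sigma_finite_measure (\<mu> \<Otimes>\<^sub>M \<mu>)" by unfold_locales
      show "integrable (\<mu> \<Otimes>\<^sub>M \<mu>) F"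
        using indk[OF A0 B0] unfolding F_def[abs_def] by (simp add: scaleR_diff_right)
      show "Int_stable {a \<times> b | a b. a \<in> sets \<mu> \<and> b \<in> sets \<mu>}"
        by (rule Int_stable_pair_measure_generator)
      show "{a \<times> b | a b. a \<in> sets \<mu> \<and> b \<in> sets \<mu>} \<subseteq> Pow (space (\<mu> \<Otimes>\<^sub>M \<mu>))"
        unfolding space_pair_measure by (rule pair_measure_closed)
      show "sets (\<mu> \<Otimes>\<^sub>M \<mu>) = sigma_sets (space (\<mu> \<Otimes>\<^sub>M \<mu>)) {a \<times> b | a b. a \<in> sets \<mu> \<and> b \<in> sets \<mu>}"
        by (simp only: sets_pair_measure space_pair_measure)
      show "integral\<^sup>L (\<mu> \<Otimes>\<^sub>M \<mu>) F = 0"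
        using rect[OF A0 B0] by (simp add: F_def[abs_def])
      fix E assume "E \<in> {a \<times> b | a b. a \<in> sets \<mu> \<and> b \<in> sets \<mu>}"
      then obtain A B where E: "E = A \<times> B" "A \<in> sets \<mu>" "B \<in> sets \<mu>" by blast
      have "(LINT x:E|\<mu> \<Otimes>\<^sub>M \<mu>. F x) = (\<integral>x. indicator ((A \<inter> A0) \<times> (B \<inter> B0)) x *\<^sub>R (k1 (fst x) (snd x) - k2 (fst x) (snd x)) \<partial>(\<mu> \<Otimes>\<^sub>M \<mu>))"
        unfolding set_lebesgue_integral_def F_def E(1)
        by (intro Bochner_Integration.integral_cong) (auto simp: indicator_def)
      also have "\<dots> = 0" by (rule rect) (use E A0 B0 in auto)
      finally show "(LINT x:E|\<mu> \<Otimes>\<^sub>M \<mu>. F x) = 0" .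
    qed
    moreover have "AE x in \<mu> \<Otimes>\<^sub>M \<mu>. fst x \<in> C \<and> snd x \<in> C"
      by (rule AE_I2) (auto simp: space_pair_measure)
    ultimately show ?thesis
      by eventually_elim (auto simp: F_def A0_def B0_def k1_def k2_def indicator_def)
  qed
  from AE_off_diagonal_if_AE_separated_balls[where u=w, OF this]
  have "AE x in \<mu> \<Otimes>\<^sub>M \<mu>. fst x \<noteq> snd x \<longrightarrow>
     w (snd x) * (\<tau> (fst x) / (fst x - snd x)) = w (fst x) * cnj (\<tau> (snd x) / (fst x - snd x))" .
  from AE_pair[OF this] show ?thesis by simp
qed

end

text \<open>The Hermitian identity is used at two base points, chosen generic so that it holds for
  almost every second point. Nontriviality of \<open>w\<close> makes its constant value nonzero, so
  that it can be cancelled.\<close>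

theorem self_adjoint_imp_circle:
  assumes G: "open G" "bounded G" "G \<noteq> {}" "frontier G = C"
    and w: "w \<in> borel_measurable \<mu>" "\<And>z. z \<in> C \<Longrightarrow> 0 \<le> w z" "\<not> (AE z in \<mu>. w z = 0)"
    and sa: "self_adjoint_in_L2 (weighted_measure \<Gamma> w) (cauchy_singular \<Gamma>)"
  shows "(\<exists>a r. 0 < r \<and> C = sphere a r) \<and> (\<exists>c. AE z in \<mu>. w z = c)"
proof -
  obtain \<tau> where \<tau>: "\<tau> \<in> borel_measurable borel" "\<And>z. cmod (\<tau> z) = 1"
    "\<And>f. integrable \<mu> f \<Longrightarrow> cycle_integral \<Gamma> f = (\<integral>z. f z * \<tau> z \<partial>\<mu>)"
    using unit_tangent_field by blast
  have \<tau>0: "\<tau> z \<noteq> 0" for z using \<tau>(2)[of z] by auto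
  let ?Q = "\<lambda>z. AE \<zeta> in \<mu>. z \<noteq> \<zeta> \<longrightarrow> w \<zeta> * (\<tau> z / (z - \<zeta>)) = w z * cnj (\<tau> \<zeta> / (z - \<zeta>))"
  have AEQ: "AE z in \<mu>. ?Q z" by (rule hermitian_kernel[OF \<tau> w(1,2) sa])
  \<comment> \<open>The denominators have equal modulus and \<tau> is unimodular, so absolute values
    leave only the weights.\<close>
  have w_eq: "AE \<zeta> in \<mu>. w \<zeta> = w z" if "z \<in> C" "?Q z" for z
    using that(2) AE_neq[of z] AE_space
  proof eventually_elim
    case (elim \<zeta>)
    then have "cmod (w \<zeta> * (\<tau> z / (z - \<zeta>))) = cmod (w z * cnj (\<tau> \<zeta> / (z - \<zeta>)))" by simp
    then have "\<bar>w \<zeta>\<bar> / cmod (z - \<zeta>) = \<bar>w z\<bar> / cmod (z - \<zeta>)"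
      unfolding norm_mult complex_mod_cnj norm_divide \<tau>(2) by simp
    moreover have "cmod (z - \<zeta>) \<noteq> 0" using elim(2) by simp
    ultimately show ?case using w(2)[OF that(1)] w(2)[of \<zeta>] elim(3) by simp
  qed
  have "frontier G \<noteq> {}" using G(1-3) frontier_eq_empty[of G] not_bounded_UNIV by auto
  then obtain p where p: "p \<in> C" using G(4) by blast
  obtain z1 where z1: "z1 \<in> C" "?Q z1" using AE_dense[OF AEQ p zero_less_one] by blast
  have "AE z in \<mu>. ?Q z \<and> z \<noteq> z1" using AEQ AE_neq[of z1] by (rule AE_conjI)
  then obtain z2 where z2: "z2 \<in> C" "?Q z2" "z2 \<noteq> z1" using AE_dense[OF _ p zero_less_one] by blast
  define c where "c = w z1"
  have wc: "AE z in \<mu>. w z = c" using w_eq[OF z1] by (simp add: c_def)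
  have c0: "c \<noteq> 0" using wc w(3) by auto
  \<comment> \<open>The identity at \<open>z2\<close> contains the pointwise value
    \<open>w z2\<close>. Two almost-everywhere constant values of \<open>w\<close> agree, so it
    equals \<open>c\<close> too.\<close>
  have "AE z in \<mu>. w z = c \<and> w z = w z2" using wc w_eq[OF z2(1,2)] by (rule AE_conjI)
  then obtain z where "w z = c \<and> w z = w z2" using AE_dense[OF _ p zero_less_one] by blast
  then have wz2: "w z2 = c" by simp
  have locus_AE: "AE z in \<mu>. cnj (\<tau> z1) * ((z - z1) * cnj (z - z2)) - cnj (\<tau> z2) * ((z - z2) * cnj (z - z1)) = 0"
    using z1(2) z2(2) wc AE_neq[of z1] AE_neq[of z2]
  proof eventually_elim
    case (elim z)
    have key: "cnj (\<tau> zi) * (zi - z) = \<tau> z * cnj (zi - z)"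
      if "zi \<noteq> z" "w z * (\<tau> zi / (zi - z)) = w zi * cnj (\<tau> z / (zi - z))" "w zi = c" for zi
    proof -
      have "of_real c * (\<tau> zi / (zi - z)) = of_real c * cnj (\<tau> z / (zi - z))"
        using that(2,3) elim(3) by simp
      then have "\<tau> zi / (zi - z) = cnj (\<tau> z) / cnj (zi - z)"
        using c0 by (simp only: mult_cancel_left complex_cnj_divide) simp
      moreover have "cnj (zi - z) \<noteq> 0" "zi - z \<noteq> 0" using that(1) by simp_all
      ultimately have "\<tau> zi * cnj (zi - z) = cnj (\<tau> z) * (zi - z)"
        by (simp add: frac_eq_eq del: complex_cnj_diff)
      from arg_cong[OF this, of cnj] show ?thesis by (simp only: complex_cnj_mult complex_cnj_cnj)
    qed
    have "cnj (\<tau> z1) * (z1 - z) = \<tau> z * cnj (z1 - z)" "cnj (\<tau> z2) * (z2 - z) = \<tau> z * cnj (z2 - z)"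
      by (rule key; use elim wz2 c_def in auto)+
    \<comment> \<open>Both relations are linear in \<open>\<tau> z\<close>, so cross-multiplication
      lets it cancel.\<close>
    then have "(cnj (\<tau> z1) * (z1 - z)) * (\<tau> z * cnj (z2 - z)) = (\<tau> z * cnj (z1 - z)) * (cnj (\<tau> z2) * (z2 - z))"
      by simp
    then have "\<tau> z * (cnj (\<tau> z1) * ((z1 - z) * cnj (z2 - z))) = \<tau> z * (cnj (\<tau> z2) * ((z2 - z) * cnj (z1 - z)))"
      by (simp only: ac_simps)
    then have "cnj (\<tau> z1) * ((z1 - z) * cnj (z2 - z)) = cnj (\<tau> z2) * ((z2 - z) * cnj (z1 - z))"
      using \<tau>0 by (simp only: mult_cancel_left) simp
    moreover have "(z1 - z) * cnj (z2 - z) = (z - z1) * cnj (z - z2)" "(z2 - z) * cnj (z1 - z) = (z - z2) * cnj (z - z1)"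
      by (simp_all add: algebra_simps)
    ultimately show ?case by simp
  qed
  let ?h = "\<lambda>z. cnj (\<tau> z1) * ((z - z1) * cnj (z - z2)) - cnj (\<tau> z2) * ((z - z2) * cnj (z - z1))"
  \<comment> \<open>\<open>?h\<close> is continuous and its zeros are dense in the cycle.\<close>
  have locus: "?h z = 0" if zC: "z \<in> C" for z
  proof (rule ccontr)
    assume ne: "?h z \<noteq> 0"
    have "continuous_on UNIV ?h" by (intro continuous_intros)
    then have "open {z. ?h z \<noteq> 0}" by (intro open_Collect_neq continuous_on_const)
    then obtain e where e: "e > 0" "ball z e \<subseteq> {z. ?h z \<noteq> 0}"
      using ne unfolding open_contains_ball by blast
    obtain z' where "z' \<in> C" "dist z' z < e" "?h z' = 0" using AE_dense[OF locus_AE zC e(1)] by blast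
    then have "z' \<in> ball z e" by (simp add: dist_commute)
    then show False using e(2) \<open>?h z' = 0\<close> by blast
  qed
  have "(\<exists>c R. \<forall>z\<in>C. (cmod (z - c))\<^sup>2 = R) \<or> (\<exists>d. d \<noteq> 0 \<and> (\<forall>z\<in>C. Im ((z - z1) * cnj d) = 0))"
    by (rule inscribed_angle_locus[of "cnj (\<tau> z1)" "cnj (\<tau> z2)" z1 z2]) (use \<tau>(2) z2(3) locus in auto)
  then have "\<exists>a R. \<forall>z\<in>C. (cmod (z - a))\<^sup>2 = R"
    using bounded_open_frontier_not_subset_line[OF G(1-3)] G(4) by blast
  then obtain a R where aR: "\<And>z. z \<in> C \<Longrightarrow> (cmod (z - a))\<^sup>2 = R" by blast
  define r where "r = cmod (z1 - a)"
  have sub: "C \<subseteq> sphere a r"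
  proof
    fix z assume "z \<in> C"
    then have "(cmod (z - a))\<^sup>2 = r\<^sup>2" using aR z1(1) by (simp add: r_def)
    then have "cmod (z - a) = r" by (rule power2_eq_imp_eq) (simp_all add: r_def)
    then show "z \<in> sphere a r" by (simp add: dist_norm norm_minus_commute)
  qed
  have "r > 0"
  proof (rule ccontr)
    assume "\<not> r > 0"
    then have "r = 0" by (simp add: r_def)
    then show False using sub z1(1) z2(1,3) by auto
  qed
  moreover have "C = sphere a r"
    using bounded_open_frontier_subset_sphere(2)[OF G(1-3) \<open>r > 0\<close>] sub G(4) by simp
  ultimately show ?thesis using wc by blast
qed

end

subsection \<open>Arc length on a circle\<close>

lemma cmod_cis_diff: "cmod (cis x - cis y) = 2 * \<bar>sin ((x - y) / 2)\<bar>"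
proof -
  have "cis x - cis y = cis y * (exp (\<i> * of_real (x - y)) - 1)"
    by (simp add: cis_conv_exp algebra_simps flip: exp_add)
  then show ?thesis by (simp only: norm_mult norm_cis mult_1 dist_exp_i_1)
qed

text \<open>A quadratic error suffices for the length of the circle: summed over \<open>n\<close>
  chords of angle \<open>2 * pi / n\<close> it is of order \<open>1 / n\<close>.\<close>

lemma sin_ge_minus_square: "x - x\<^sup>2 / 2 \<le> sin x" if "0 \<le> x" for x :: real
proof -
  have "\<bar>sin x - x\<bar> \<le> x\<^sup>2 / 2"
  proof -
    have "(\<Sum>m<2. sin_coeff m * x ^ m) = x" by (simp add: sin_coeff_def numeral_2_eq_2)
    moreover have "inverse (fact 2) * \<bar>x\<bar> ^ 2 = x\<^sup>2 / 2" by simp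
    ultimately show ?thesis using Maclaurin_sin_bound[of x 2] by simp
  qed
  then show ?thesis by linarith
qed

text \<open>The parametrization is an arbitrary simple loop onto the circle; its winding number
  about the centre encodes the counterclockwise orientation.\<close>

locale circle_cycle = rectifiable_cycle +
  fixes a :: complex and r :: real and \<gamma> :: "real \<Rightarrow> complex"
  assumes r: "r > 0" and \<Gamma>_eq: "\<Gamma> = {\<gamma>}" and C_eq: "C = sphere a r" and wind: "winding_number \<gamma> a = 1"
begin

section \<open>The angle along a parametrized circle, and its arc length\<close>

lemma \<gamma>_in: "\<gamma> \<in> \<Gamma>" by (simp add: \<Gamma>_eq)

lemma path_image_eq: "path_image \<gamma> = sphere a r"
  using C_eq by (simp add: cycle_image_def \<Gamma>_eq)

definition circ :: "real \<Rightarrow> complex" where "circ s = a + of_real r * cis s"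

text \<open>The angle is the imaginary part of a continuous logarithm of
  \<open>\<gamma> t - a\<close>; the exponential of the real part is the constant modulus
  \<open>r\<close>. Winding number 1 gives the increment \<open>2 * pi\<close>.\<close>

lemma angle_exists:
  "\<exists>\<theta>. continuous_on {0..1} \<theta> \<and> \<theta> 1 = \<theta> 0 + 2 * pi \<and> (\<forall>t\<in>{0..1}. \<gamma> t = circ (\<theta> t))"
proof -
  have "a \<notin> path_image \<gamma>" using path_image_eq r by auto
  then obtain q where q: "path q" "pathfinish q - pathstart q = 2 * of_real pi * \<i> * winding_number \<gamma> a"
    "\<And>t. t \<in> {0..1} \<Longrightarrow> \<gamma> t = a + exp (q t)"
    using winding_number_as_continuous_log[OF paths[OF \<gamma>_in]] by blast
  have "\<gamma> t = circ (Im (q t))" if t: "t \<in> {0..1}" for t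
  proof -
    have "\<gamma> t \<in> sphere a r" using t path_image_eq by (auto simp: path_image_def)
    then have "exp (Re (q t)) = r" using q(3)[OF t] by (simp add: dist_norm norm_minus_commute)
    then show ?thesis using q(3)[OF t] by (simp add: circ_def exp_eq_polar)
  qed
  moreover have "Im (q 1) = Im (q 0) + 2 * pi"
    using q(2) wind by (simp add: pathfinish_def pathstart_def complex_eq_iff)
  moreover have "continuous_on {0..1} (\<lambda>t. Im (q t))"
    using q(1) unfolding path_def by (intro continuous_intros)
  ultimately show ?thesis by (intro exI[of _ "\<lambda>t. Im (q t)"]) auto
qed

definition \<theta> :: "real \<Rightarrow> real" where
  "\<theta> = (SOME \<theta>. continuous_on {0..1} \<theta> \<and> \<theta> 1 = \<theta> 0 + 2 * pi \<and> (\<forall>t\<in>{0..1}. \<gamma> t = circ (\<theta> t)))"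

lemma \<theta>: "continuous_on {0..1} \<theta>" "\<theta> 1 = \<theta> 0 + 2 * pi" "t \<in> {0..1} \<Longrightarrow> \<gamma> t = circ (\<theta> t)"
  using someI_ex[OF angle_exists] unfolding \<theta>_def[symmetric] by auto

text \<open>Equal angles mean equal points, and the only coincidence of parameters, that of 0 and 1,
  is separated by \<open>2 * pi\<close>. So the continuous \<theta> is injective, hence monotone,
  and the increment fixes the direction.\<close>

lemma \<theta>_strict_mono: assumes "0 \<le> s" "s < t" "t \<le> 1" shows "\<theta> s < \<theta> t"
proof -
  have inj01: "inj_on \<gamma> {0..<1}" by (rule simple_loop_inj_on[OF simple[OF \<gamma>_in]])
  have inj: "inj_on \<theta> {0..1}"
  proof (rule linorder_inj_onI')
    fix x y :: real assume xy: "x \<in> {0..1}" "y \<in> {0..1}" "x < y"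
    show "\<theta> x \<noteq> \<theta> y"
    proof
      assume eq: "\<theta> x = \<theta> y"
      then have eq_\<gamma>: "\<gamma> x = \<gamma> y" using \<theta>(3) xy by simp
      have "y = 1" using inj_onD[OF inj01 eq_\<gamma>] xy by (cases "y < 1") auto
      moreover have "\<gamma> 1 = \<gamma> 0" using closed_loop[OF \<gamma>_in] by (simp add: pathfinish_def pathstart_def)
      ultimately have "x = 0" using inj_onD[OF inj01, of x 0] eq_\<gamma> xy by auto
      then show False using eq \<theta>(2) \<open>y = 1\<close> by simp
    qed
  qed
  have 0: "\<theta> 0 < \<theta> x" if "0 < x" "x \<le> 1" for x
  proof (cases "x = 1")
    case False
    then have "(\<theta> 0 < \<theta> x \<and> \<theta> x < \<theta> 1) \<or> (\<theta> 1 < \<theta> x \<and> \<theta> x < \<theta> 0)"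
      using continuous_inj_imp_mono[OF that(1) _ \<theta>(1) inj] that by simp
    then show ?thesis using \<theta>(2) pi_gt_zero by linarith
  qed (use \<theta>(2) pi_gt_zero in simp)
  show ?thesis
  proof (cases "s = 0")
    case False
    have "continuous_on {0..t} \<theta>" "inj_on \<theta> {0..t}"
      using assms by (auto intro: continuous_on_subset[OF \<theta>(1)] inj_on_subset[OF inj])
    from continuous_inj_imp_mono[OF _ assms(2) this] show ?thesis
      using 0[of t] False assms by auto
  qed (use 0[of t] assms in auto)
qed

lemma \<theta>_mono: "0 \<le> s \<Longrightarrow> s \<le> t \<Longrightarrow> t \<le> 1 \<Longrightarrow> \<theta> s \<le> \<theta> t"
  using \<theta>_strict_mono[of s t] by (cases "s = t") auto

lemma chord_length: "dist (circ x) (circ y) = 2 * r * \<bar>sin ((x - y) / 2)\<bar>"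
proof -
  have "circ x - circ y = of_real r * (cis x - cis y)" by (simp add: circ_def algebra_simps)
  then show ?thesis unfolding dist_norm using r by (simp add: norm_mult cmod_cis_diff)
qed

text \<open>A chord is no longer than its arc, by
  \<open>\<bar>sin x\<bar> \<le> \<bar>x\<bar>\<close>, and the angles telescope.\<close>

lemma arc_length_le_angle:
  assumes "0 \<le> s" "s \<le> t" "t \<le> 1" shows "arc_length \<gamma> s t \<le> r * (\<theta> t - \<theta> s)"
proof (rule arc_length_le[OF rect[OF \<gamma>_in] assms(2)])
  fix p :: "nat \<Rightarrow> real" and m assume p: "mono p" "range p \<subseteq> {s..t}"
  have pk: "s \<le> p k" "p k \<le> t" "p k \<le> p (Suc k)" for k
    using range_subsetD[OF p(2), of k] p(1) by (auto simp: mono_def)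
  have "dist (\<gamma> (p k)) (\<gamma> (p (Suc k))) \<le> r * (\<theta> (p (Suc k)) - \<theta> (p k))" for k
  proof -
    have "dist (\<gamma> (p k)) (\<gamma> (p (Suc k))) = 2 * r * \<bar>sin ((\<theta> (p (Suc k)) - \<theta> (p k)) / 2)\<bar>"
      using pk[of k] pk[of "Suc k"] assms chord_length[of "\<theta> (p (Suc k))" "\<theta> (p k)"]
      by (simp add: \<theta>(3) dist_commute)
    also have "\<dots> \<le> 2 * r * \<bar>(\<theta> (p (Suc k)) - \<theta> (p k)) / 2\<bar>"
      using r by (intro mult_left_mono abs_sin_x_le_abs_x) auto
    also have "\<dots> = r * (\<theta> (p (Suc k)) - \<theta> (p k))"
      using \<theta>_mono[of "p k" "p (Suc k)"] pk[of k] pk[of "Suc k"] assms by simp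
    finally show ?thesis .
  qed
  then have "(\<Sum>k<m. dist (\<gamma> (p k)) (\<gamma> (p (Suc k)))) \<le> (\<Sum>k<m. r * (\<theta> (p (Suc k)) - \<theta> (p k)))"
    by (intro sum_mono)
  also have "\<dots> = r * (\<theta> (p m) - \<theta> (p 0))"
    unfolding sum_distrib_left[symmetric] by (simp only: sum_lessThan_telescope[of "\<lambda>k. \<theta> (p k)"])
  also have "\<dots> \<le> r * (\<theta> t - \<theta> s)"
    using \<theta>_mono[of "p m" t] \<theta>_mono[of s "p 0"] pk[of m] pk[of 0] assms r
    by (intro mult_left_mono) auto
  finally show "(\<Sum>k<m. dist (\<gamma> (p k)) (\<gamma> (p (Suc k)))) \<le> r * (\<theta> t - \<theta> s)" .
qed

text \<open>The polygon with \<open>n\<close> equal angular steps falls short of the circumference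
  by at most \<open>r * pi\<^sup>2 / n\<close>. Its vertices come from the intermediate value
  theorem, since the speed of the parametrization is unknown.\<close>

lemma total_length: "arc_length \<gamma> 0 1 \<ge> r * (2 * pi)"
proof -
  \<comment> \<open>\<open>h\<close> is the excess of angular length over arc length; one angular
    step raises it by at most \<open>r * (pi / n)\<^sup>2\<close>.\<close>
  define h where "h t = r * \<theta> t - arc_length \<gamma> 0 t" for t
  have bound: "h 1 - h 0 \<le> r * pi\<^sup>2 / real n" if n: "n > 0" for n :: nat
  proof -
    have "\<exists>t\<in>{0..1}. \<theta> t = \<theta> 0 + 2 * pi * real k / real n" if "k \<le> n" for k
    proof -
      have "2 * pi * real k / real n \<le> 2 * pi" using that n by (simp add: field_simps)
      then have "\<exists>t. 0 \<le> t \<and> t \<le> 1 \<and> \<theta> t = \<theta> 0 + 2 * pi * real k / real n"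
        by (intro IVT') (use \<theta>(1,2) in auto)
      then show ?thesis by auto
    qed
    then obtain T where T: "\<And>k. k \<le> n \<Longrightarrow> T k \<in> {0..1} \<and> \<theta> (T k) = \<theta> 0 + 2 * pi * real k / real n"
      by metis
    have step: "\<theta> (T (Suc k)) - \<theta> (T k) = 2 * pi / real n" if "k < n" for k
      using T[of k] T[of "Suc k"] that n by (simp add: field_simps)
    have Tmono: "T k \<le> T (Suc k)" if k: "k < n" for k
    proof (rule ccontr)
      assume "\<not> T k \<le> T (Suc k)"
      then have "\<theta> (T (Suc k)) < \<theta> (T k)"
        using T[of k] T[of "Suc k"] k by (intro \<theta>_strict_mono) auto
      then show False using step[OF k] by (smt (verit) divide_pos_pos n of_nat_0_less_iff pi_gt_zero)
    qed
    have "h (T (Suc k)) - h (T k) \<le> r * (pi / real n)\<^sup>2" if k: "k < n" for k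
    proof -
      have Tk: "T k \<in> {0..1}" "T (Suc k) \<in> {0..1}" using T[of k] T[of "Suc k"] k by auto
      have "arc_length \<gamma> 0 (T (Suc k)) - arc_length \<gamma> 0 (T k) = arc_length \<gamma> (T k) (T (Suc k))"
        using arc_length_add[OF rect[OF \<gamma>_in], of 0 "T k" "T (Suc k)"] Tk Tmono[OF k] by auto
      also have "\<dots> \<ge> dist (\<gamma> (T k)) (\<gamma> (T (Suc k)))"
        using dist_le_arc_length[OF rect[OF \<gamma>_in]] Tk Tmono[OF k] by auto
      also have "dist (\<gamma> (T k)) (\<gamma> (T (Suc k))) = 2 * r * \<bar>sin ((\<theta> (T (Suc k)) - \<theta> (T k)) / 2)\<bar>"
        using Tk chord_length[of "\<theta> (T (Suc k))" "\<theta> (T k)"] by (simp add: \<theta>(3) dist_commute)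
      also have "\<dots> \<ge> 2 * r * (pi / real n - (pi / real n)\<^sup>2 / 2)"
        using sin_ge_minus_square[of "pi / real n"] r abs_ge_self[of "sin (pi / real n)"] unfolding step[OF k]
        by (intro mult_left_mono) auto
      finally have "2 * r * (pi / real n - (pi / real n)\<^sup>2 / 2) \<le> arc_length \<gamma> 0 (T (Suc k)) - arc_length \<gamma> 0 (T k)" .
      moreover have "r * \<theta> (T (Suc k)) - r * \<theta> (T k) = r * (2 * pi / real n)"
        unfolding step[OF k, symmetric] by (simp add: algebra_simps)
      ultimately show ?thesis unfolding h_def by (simp add: algebra_simps)
    qed
    then have "(\<Sum>k<n. h (T (Suc k)) - h (T k)) \<le> (\<Sum>k<n. r * (pi / real n)\<^sup>2)" by (intro sum_mono) auto
    also have "\<dots> = r * pi\<^sup>2 / real n" using n by (simp add: power2_eq_square field_simps)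
    also have "(\<Sum>k<n. h (T (Suc k)) - h (T k)) = h (T n) - h (T 0)" by (rule sum_lessThan_telescope)
    also have "T n = 1"
    proof (rule ccontr)
      assume "T n \<noteq> 1" then show False using \<theta>_strict_mono[of "T n" 1] T[of n] n \<theta>(2) by auto
    qed
    also have "T 0 = 0"
    proof (rule ccontr)
      assume "T 0 \<noteq> 0" then show False using \<theta>_strict_mono[of 0 "T 0"] T[of 0] n by auto
    qed
    finally show ?thesis .
  qed
  have "h 1 - h 0 \<le> 0"
  proof (rule LIMSEQ_le_const)
    show "(\<lambda>n. r * pi\<^sup>2 / real n) \<longlonglongrightarrow> 0" by (rule lim_const_over_n)
    show "\<exists>N. \<forall>n\<ge>N. h 1 - h 0 \<le> r * pi\<^sup>2 / real n" using bound by (intro exI[of _ 1]) auto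
  qed
  moreover have "arc_length \<gamma> 0 0 = 0"
    using arc_length_le_angle[of 0 0] arc_length_nonneg[OF rect[OF \<gamma>_in], of 0 0] by simp
  ultimately show ?thesis using \<theta>(2) by (simp add: h_def algebra_simps)
qed

text \<open>Angular length bounds arc length from above on \<open>{0..s}\<close> and on
  \<open>{s..1}\<close>, and the sum attains the total. Hence equality holds on each piece.\<close>

lemma length_fun_eq: "length_fun \<gamma> t = r * (\<theta> (clamp01 t) - \<theta> 0)"
proof -
  have "arc_length \<gamma> 0 s = r * (\<theta> s - \<theta> 0)" if "s \<in> {0..1}" for s
    using arc_length_add[OF rect[OF \<gamma>_in], of 0 s 1] arc_length_le_angle[of 0 s]
      arc_length_le_angle[of s 1] total_length \<theta>(2) that by (simp add: algebra_simps)
  then show ?thesis using clamp01_in by (simp add: length_fun_def)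
qed

section \<open>The push-forward of arc length to the angle\<close>

definition \<Theta> :: "real \<Rightarrow> real" where "\<Theta> t = \<theta> (clamp01 t)"

lemma continuous_\<Theta>: "continuous_on UNIV \<Theta>"
proof -
  have "continuous_on UNIV (\<theta> \<circ> clamp01)"
    by (rule continuous_on_compose[OF continuous_on_clamp01 continuous_on_subset[OF \<theta>(1)]])
       (use clamp01_in in blast)
  then show ?thesis by (simp add: \<Theta>_def[abs_def] comp_def)
qed

lemma \<Theta>_measurable [measurable]: "\<Theta> \<in> borel_measurable borel"
  by (rule borel_measurable_continuous_onI[OF continuous_\<Theta>])

lemma \<Theta>_range: "\<theta> 0 \<le> \<Theta> t" "\<Theta> t \<le> \<theta> 0 + 2 * pi"
  using \<theta>_mono[of 0 "clamp01 t"] \<theta>_mono[of "clamp01 t" 1] clamp01_in[of t] \<theta>(2) by (auto simp: \<Theta>_def)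

lemma emeasure_m_Ioc: "s \<le> t \<Longrightarrow> emeasure (m \<gamma>) {s<..t} = ennreal (r * (\<Theta> t - \<Theta> s))"
  using length_fun_props[OF paths rect, OF \<gamma>_in \<gamma>_in] continuous_at_right_UNIV
  by (subst emeasure_interval_measure_Ioc) (auto simp: mono_def length_fun_eq \<Theta>_def algebra_simps)

text \<open>The total mass is at most the total increment of the length function, and
  \<open>{0<..1}\<close> already carries that much.\<close>

lemma AE_m: "AE t in m \<gamma>. t \<in> {0<..1}"
proof -
  interpret M: finite_measure "m \<gamma>" by (rule finite_m[OF \<gamma>_in])
  have 1: "ennreal (r * (2 * pi)) = emeasure (m \<gamma>) {0<..1}"
    using emeasure_m_Ioc[of 0 1] \<theta>(2) by (simp add: \<Theta>_def clamp01_id)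
  have "emeasure (m \<gamma>) UNIV \<le> ennreal (r * (2 * pi) - 0)"
  proof (rule emeasure_interval_measure_UNIV_le)
    show "0 \<le> length_fun \<gamma> t \<and> length_fun \<gamma> t \<le> r * (2 * pi)" for t
      using \<Theta>_range[of t] r by (auto simp: length_fun_eq \<Theta>_def[symmetric])
  qed (use length_fun_props[OF paths rect, OF \<gamma>_in \<gamma>_in] in auto)
  then have "measure (m \<gamma>) UNIV \<le> measure (m \<gamma>) {0<..1}"
    using 1 r by (simp add: M.emeasure_eq_measure)
  then have "measure (m \<gamma>) (UNIV - {0<..1}) = 0"
    using M.finite_measure_compl[of "{0<..1}"] M.finite_measure_mono[of "{0<..1}" UNIV]
    by simp
  then have "UNIV - {0<..1} \<in> null_sets (m \<gamma>)"
    by (auto simp: null_sets_def M.emeasure_eq_measure)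
  from AE_not_in[OF this] show ?thesis by simp
qed

text \<open>The two measures are compared on rays \<open>{x<..}\<close>. For \<open>x\<close> in the
  range of the angle, strict monotonicity makes the preimage in \<open>{0<..1}\<close> an interval
  \<open>{s<..1}\<close>, whose mass is \<open>r\<close> times the remaining angle.\<close>

lemma distr_\<Theta>: "distr (m \<gamma>) borel \<Theta> = density lborel (\<lambda>s. ennreal (r * indicator {\<theta> 0..\<theta> 0 + 2 * pi} s))"
proof (rule measure_eqI_lessThan)
  interpret M: finite_measure "m \<gamma>" by (rule finite_m[OF \<gamma>_in])
  show "sets (distr (m \<gamma>) borel \<Theta>) = sets borel"
    "sets (density lborel (\<lambda>s. ennreal (r * indicator {\<theta> 0..\<theta> 0 + 2 * pi} s))) = sets borel" by simp_all
  fix x :: real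
  have dl: "emeasure (distr (m \<gamma>) borel \<Theta>) {x<..} = emeasure (m \<gamma>) {t. x < \<Theta> t}"
    by (subst emeasure_distr) (auto simp: vimage_def)
  show "emeasure (distr (m \<gamma>) borel \<Theta>) {x<..} < \<infinity>"
    unfolding dl using M.emeasure_finite by (simp add: M.emeasure_eq_measure)
  have inner: "emeasure (m \<gamma>) {t. x < \<Theta> t} = emeasure (m \<gamma>) {t \<in> {0<..1}. x < \<Theta> t}"
    by (rule emeasure_eq_AE) (use AE_m in auto)
  have "emeasure (density lborel (\<lambda>s. ennreal (r * indicator {\<theta> 0..\<theta> 0 + 2 * pi} s))) {x<..} =
     (\<integral>\<^sup>+s. ennreal r * indicator ({\<theta> 0..\<theta> 0 + 2 * pi} \<inter> {x<..}) s \<partial>lborel)"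
    by (subst emeasure_density) (auto intro!: nn_integral_cong simp: indicator_def)
  also have "\<dots> = ennreal r * emeasure lborel ({\<theta> 0..\<theta> 0 + 2 * pi} \<inter> {x<..})"
    by (rule nn_integral_cmult_indicator) simp
  finally have dr: "emeasure (density lborel (\<lambda>s. ennreal (r * indicator {\<theta> 0..\<theta> 0 + 2 * pi} s))) {x<..} =
    ennreal r * emeasure lborel ({\<theta> 0..\<theta> 0 + 2 * pi} \<inter> {x<..})" .
  consider "x < \<theta> 0" | "\<theta> 0 \<le> x" "x \<le> \<theta> 0 + 2 * pi" | "x > \<theta> 0 + 2 * pi" by linarith
  then show "emeasure (distr (m \<gamma>) borel \<Theta>) {x<..} =
     emeasure (density lborel (\<lambda>s. ennreal (r * indicator {\<theta> 0..\<theta> 0 + 2 * pi} s))) {x<..}"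
  proof cases
    case 1
    have "{t \<in> {0<..1}. x < \<Theta> t} = {0<..1}" using 1 \<Theta>_range(1) by (auto intro: less_le_trans)
    moreover have "{\<theta> 0..\<theta> 0 + 2 * pi} \<inter> {x<..} = {\<theta> 0..\<theta> 0 + 2 * pi}" using 1 by auto
    ultimately show ?thesis
      unfolding dl dr inner using emeasure_m_Ioc[of 0 1] \<theta>(2) r
      by (simp add: \<Theta>_def clamp01_id ennreal_mult)
  next
    case 2
    then obtain s where s: "0 \<le> s" "s \<le> 1" "\<theta> s = x"
      using IVT'[of \<theta> 0 x 1] \<theta>(1,2) by auto
    have "{t \<in> {0<..1}. x < \<Theta> t} = {s<..1}"
    proof safe
      fix t assume "t \<in> {0<..1}" "x < \<Theta> t"
      then show "t \<in> {s<..1}" using \<theta>_mono[of t s] s by (force simp: \<Theta>_def clamp01_id)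
    next
      fix t assume t: "t \<in> {s<..1}"
      then show "t \<in> {0<..1}" "x < \<Theta> t" using s \<theta>_strict_mono[of s t] by (auto simp: \<Theta>_def clamp01_id)
    qed
    moreover have "{\<theta> 0..\<theta> 0 + 2 * pi} \<inter> {x<..} = {x<..\<theta> 0 + 2 * pi}" using 2 by auto
    ultimately show ?thesis
      unfolding dl dr inner using emeasure_m_Ioc[of s 1] s \<theta>(2) 2 r
      by (simp add: \<Theta>_def clamp01_id ennreal_mult)
  next
    case 3
    have "\<not> x < \<Theta> t" for t using 3 \<Theta>_range(2)[of t] by linarith
    then have "{t \<in> {0<..1}. x < \<Theta> t} = {}" by blast
    moreover have "{\<theta> 0..\<theta> 0 + 2 * pi} \<inter> {x<..} = {}" using 3 by auto
    ultimately show ?thesis unfolding dl dr inner by (simp only: emeasure_empty mult_zero_right)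
  qed
qed

lemma circ_measurable [measurable]: "circ \<in> borel_measurable borel"
  unfolding circ_def[abs_def] by (intro borel_measurable_continuous_onI continuous_intros)

lemma circ_in: "circ s \<in> C"
  using r by (simp add: C_eq circ_def dist_norm norm_mult)

lemma \<mu>_circle:
  "\<mu> = distr (density lborel (\<lambda>s. ennreal (r * indicator {\<theta> 0..\<theta> 0 + 2 * pi} s))) (restrict_space borel C) circ"
proof (rule measure_eqI)
  have cm: "circ \<in> borel \<rightarrow>\<^sub>M restrict_space borel C"
    by (rule measurable_restrict_space2) (use circ_in in auto)
  fix A assume "A \<in> sets \<mu>"
  then have A: "A \<in> sets borel" "A \<subseteq> C" "A \<in> sets \<mu>" by auto
  have mA: "circ -` A \<in> sets borel" using measurable_sets[OF circ_measurable A(1)] by simp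
  then have mA': "\<Theta> -` (circ -` A) \<in> sets borel" using measurable_sets[OF \<Theta>_measurable] by auto
  have "{t \<in> {0..1}. \<gamma> t \<in> A} = {t \<in> {0..1}. circ (\<Theta> t) \<in> A}"
    using \<theta>(3) by (auto simp: \<Theta>_def clamp01_id)
  then have "emeasure \<mu> A = emeasure (m \<gamma>) {t \<in> {0..1}. circ (\<Theta> t) \<in> A}"
    using emeasure_\<mu>[OF _ A(3)] by (simp add: \<Gamma>_eq)
  also have "\<dots> = emeasure (m \<gamma>) (\<Theta> -` (circ -` A) \<inter> space (m \<gamma>))"
  proof (rule emeasure_eq_AE)
    have "{t \<in> {0..1}. circ (\<Theta> t) \<in> A} = {0..1} \<inter> \<Theta> -` (circ -` A)" by auto
    then show "{t \<in> {0..1}. circ (\<Theta> t) \<in> A} \<in> sets (m \<gamma>)" using mA' by simp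
  qed (use AE_m mA' in auto)
  also have "\<dots> = emeasure (distr (m \<gamma>) borel \<Theta>) (circ -` A)"
    by (rule emeasure_distr[symmetric]) (use mA in auto)
  also have "\<dots> = emeasure (distr (density lborel (\<lambda>s. ennreal (r * indicator {\<theta> 0..\<theta> 0 + 2 * pi} s))) (restrict_space borel C) circ) A"
    unfolding distr_\<Theta> using cm A by (subst emeasure_distr) (auto cong: measurable_cong_sets)
  finally show "emeasure \<mu> A = \<dots>" .
qed simp

lemma integral_circle:
  fixes h :: "complex \<Rightarrow> 'b::{banach,second_countable_topology}"
  assumes h: "h \<in> borel_measurable \<mu>"
  shows "(\<integral>z. h z \<partial>\<mu>) = (\<integral>s. (r * indicator {\<theta> 0..\<theta> 0 + 2 * pi} s) *\<^sub>R h (circ s) \<partial>lborel)"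
proof -
  let ?D = "density lborel (\<lambda>s. ennreal (r * indicator {\<theta> 0..\<theta> 0 + 2 * pi} s))"
  have cm: "circ \<in> borel \<rightarrow>\<^sub>M restrict_space borel C"
    by (rule measurable_restrict_space2) (use circ_in in auto)
  then have cm': "circ \<in> ?D \<rightarrow>\<^sub>M restrict_space borel C" by (simp cong: measurable_cong_sets)
  have h': "h \<in> borel_measurable (restrict_space borel C)" using h by (simp cong: measurable_cong_sets)
  have "(\<integral>z. h z \<partial>\<mu>) = (\<integral>s. h (circ s) \<partial>?D)"
    by (subst \<mu>_circle) (rule integral_distr[OF cm' h'])
  also have "\<dots> = (\<integral>s. (r * indicator {\<theta> 0..\<theta> 0 + 2 * pi} s) *\<^sub>R h (circ s) \<partial>lborel)"
    by (rule integral_density) (use r measurable_compose[OF cm h'] in auto)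
  finally show ?thesis .
qed

text \<open>The tangent is identified by its interval integrals. Those of
  \<open>\<i> * cis (\<Theta> u)\<close> are computed in the angle variable by the fundamental
  theorem of calculus and give the same increments of \<gamma>.\<close>

lemma cycle_integral_circle:
  assumes f: "integrable \<mu> f"
  shows "cycle_integral \<Gamma> f = (\<integral>z. f z * (\<i> * (z - a) / r) \<partial>\<mu>)"
proof -
  interpret M: finite_measure "m \<gamma>" by (rule finite_m[OF \<gamma>_in])
  obtain \<tau> where \<tau>: "\<tau> \<in> borel_measurable borel" "\<And>t. cmod (\<tau> t) = 1"
    "\<And>s t. s \<le> t \<Longrightarrow> (LINT u:{s<..t}|m \<gamma>. \<tau> u) = \<gamma> (clamp01 t) - \<gamma> (clamp01 s)"
    "\<And>f. set_integrable (m \<gamma>) {0..1} (\<lambda>t. f (\<gamma> t)) \<Longrightarrow>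
       curve_integral \<gamma> f = (LINT t:{0..1}|m \<gamma>. f (\<gamma> t) * \<tau> t)"
    using unit_tangent[OF paths[OF \<gamma>_in] rect[OF \<gamma>_in]] by metis
  note [measurable] = \<tau>(1)
  have cism[measurable]: "cis \<in> borel_measurable borel"
    by (intro borel_measurable_continuous_onI continuous_intros)
  have int: "integrable (m \<gamma>) \<tau>" "integrable (m \<gamma>) (\<lambda>u. \<i> * cis (\<Theta> u))"
    by (auto intro!: M.integrable_const_bound[where B=1] simp: \<tau>(2) norm_mult)
  have "AE u in m \<gamma>. \<tau> u - \<i> * cis (\<Theta> u) = 0"
  proof (rule real_AE_zero_if_interval_integrals_zero)
    show "sigma_finite_measure (m \<gamma>)" by unfold_locales
    show "integrable (m \<gamma>) (\<lambda>u. \<tau> u - \<i> * cis (\<Theta> u))" using int by simp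
    fix s t :: real assume st: "s \<le> t"
    \<comment> \<open>For \<open>u\<close> in \<open>{0<..1}\<close> strict monotonicity turns
      \<open>s < u\<close> and \<open>u \<le> t\<close> into the same inequalities between angles,
      also when \<open>s\<close> or \<open>t\<close> is clamped.\<close>
    have "(LINT u:{s<..t}|m \<gamma>. \<i> * cis (\<Theta> u)) = (\<integral>u. indicator {\<Theta> s<..\<Theta> t} (\<Theta> u) *\<^sub>R (\<i> * cis (\<Theta> u)) \<partial>m \<gamma>)"
      unfolding set_lebesgue_integral_def
    proof (rule integral_cong_AE)
      show "AE u in m \<gamma>. indicat_real {s<..t} u *\<^sub>R (\<i> * cis (\<Theta> u)) = indicat_real {\<Theta> s<..\<Theta> t} (\<Theta> u) *\<^sub>R (\<i> * cis (\<Theta> u))"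
        using AE_m
      proof eventually_elim
        case (elim u)
        have iff: "\<theta> x < \<theta> y \<longleftrightarrow> x < y" if "x \<in> {0..1}" "y \<in> {0..1}" for x y
          using \<theta>_strict_mono[of x y] \<theta>_mono[of y x] that by force
        have "\<Theta> s < \<Theta> u \<longleftrightarrow> clamp01 s < u"
          using iff[OF clamp01_in[of s], of u] elim by (simp add: \<Theta>_def clamp01_id)
        moreover have "\<Theta> t < \<Theta> u \<longleftrightarrow> clamp01 t < u"
          using iff[OF clamp01_in[of t], of u] elim by (simp add: \<Theta>_def clamp01_id)
        moreover have "clamp01 s < u \<longleftrightarrow> s < u" "clamp01 t < u \<longleftrightarrow> t < u" using elim by (auto simp: clamp01_def)
        ultimately show ?case by (auto simp: indicator_def not_less[symmetric])
      qed
    qed measurable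
    also have "\<dots> = (\<integral>x. indicator {\<Theta> s<..\<Theta> t} x *\<^sub>R (\<i> * cis x) \<partial>distr (m \<gamma>) borel \<Theta>)"
      by (rule integral_distr[symmetric]) measurable
    also have "\<dots> = (\<integral>x. (r * indicator {\<theta> 0..\<theta> 0 + 2 * pi} x) *\<^sub>R (indicator {\<Theta> s<..\<Theta> t} x *\<^sub>R (\<i> * cis x)) \<partial>lborel)"
      unfolding distr_\<Theta> by (rule integral_density) (use r in auto)
    also have "\<dots> = (\<integral>x. indicator {\<Theta> s..\<Theta> t} x *\<^sub>R (of_real r * \<i> * cis x) \<partial>lborel)"
    proof (rule integral_cong_AE)
      \<comment> \<open>The integral is moved to the closed interval, as the fundamental theorem
        requires; the added endpoint is null.\<close>
      have "AE x in lborel. x \<noteq> \<Theta> s" by (rule AE_lborel_singleton)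
      then show "AE x in lborel. (r * indicator {\<theta> 0..\<theta> 0 + 2 * pi} x) *\<^sub>R (indicator {\<Theta> s<..\<Theta> t} x *\<^sub>R (\<i> * cis x)) =
         indicator {\<Theta> s..\<Theta> t} x *\<^sub>R (of_real r * \<i> * cis x)"
      proof eventually_elim
        case (elim x)
        then show ?case using \<Theta>_range(1)[of s] \<Theta>_range(2)[of t]
          by (auto simp: indicator_def scaleR_conv_of_real)
      qed
    qed measurable
    also have "\<dots> = of_real r * cis (\<Theta> t) - of_real r * cis (\<Theta> s)"
    proof (rule integral_FTC_Icc)
      show "\<Theta> s \<le> \<Theta> t" using clamp01_mono[OF st] clamp01_in[of s] clamp01_in[of t] by (auto simp: \<Theta>_def intro!: \<theta>_mono)
      show "((\<lambda>x. of_real r * cis x) has_vector_derivative of_real r * \<i> * cis x) (at x within {\<Theta> s..\<Theta> t})" for x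
        unfolding cis_conv_exp
        by (rule has_vector_derivative_real_field) (auto intro!: derivative_eq_intros)
      show "continuous_on {\<Theta> s..\<Theta> t} (\<lambda>x. of_real r * \<i> * cis x)" by (intro continuous_intros)
    qed
    also have "\<dots> = \<gamma> (clamp01 t) - \<gamma> (clamp01 s)"
      using \<theta>(3) clamp01_in by (simp add: circ_def \<Theta>_def)
    finally have "(LINT u:{s<..t}|m \<gamma>. \<i> * cis (\<Theta> u)) = \<gamma> (clamp01 t) - \<gamma> (clamp01 s)" .
    then show "(LINT u:{s<..t}|m \<gamma>. \<tau> u - \<i> * cis (\<Theta> u)) = 0"
      using \<tau>(3)[OF st] set_integral_diff(2)[OF set_integrable_if_integrable[OF int(1)] set_integrable_if_integrable[OF int(2)], of "{s<..t}"]
      by simp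
  qed simp
  then have AE\<tau>: "AE u in m \<gamma>. \<tau> u = \<i> * cis (\<Theta> u)" by simp
  have si: "set_integrable (m \<gamma>) {0..1} (\<lambda>t. f (\<gamma> t))" by (rule integral_path_image(1)[OF \<gamma>_in f])
  have "cycle_integral \<Gamma> f = (LINT t:{0..1}|m \<gamma>. f (\<gamma> t) * \<tau> t)"
    using \<tau>(4)[OF si] by (simp add: cycle_integral_def \<Gamma>_eq)
  also have "\<dots> = (\<integral>t. (indicat_real {0..1} t *\<^sub>R f (\<gamma> t)) * \<tau> t \<partial>m \<gamma>)"
    by (simp add: set_lebesgue_integral_def)
  also have "\<dots> = (\<integral>t. (indicat_real {0..1} t *\<^sub>R f (\<gamma> t)) * (\<i> * cis (\<Theta> t)) \<partial>m \<gamma>)"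
  proof (rule integral_cong_AE)
    have [measurable]: "(\<lambda>t. indicat_real {0..1} t *\<^sub>R f (\<gamma> t)) \<in> borel_measurable (m \<gamma>)"
      using si unfolding set_integrable_def by auto
    show "(\<lambda>t. (indicat_real {0..1} t *\<^sub>R f (\<gamma> t)) * \<tau> t) \<in> borel_measurable (m \<gamma>)"
      "(\<lambda>t. (indicat_real {0..1} t *\<^sub>R f (\<gamma> t)) * (\<i> * cis (\<Theta> t))) \<in> borel_measurable (m \<gamma>)"
      by measurable
    show "AE t in m \<gamma>. (indicat_real {0..1} t *\<^sub>R f (\<gamma> t)) * \<tau> t = (indicat_real {0..1} t *\<^sub>R f (\<gamma> t)) * (\<i> * cis (\<Theta> t))"
      using AE\<tau> by eventually_elim simp
  qed
  also have "\<dots> = (LINT t:{0..1}|m \<gamma>. f (\<gamma> t) * (\<i> * (\<gamma> t - a) / r))"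
    unfolding set_lebesgue_integral_def
    by (rule Bochner_Integration.integral_cong)
       (use r in \<open>auto simp: indicator_def \<theta>(3) \<Theta>_def clamp01_id circ_def\<close>)
  also have "\<dots> = (\<integral>z. f z * (\<i> * (z - a) / r) \<partial>\<mu>)"
  proof -
    have hm: "(\<lambda>z. \<i> * (z - a) / r) \<in> borel_measurable \<mu>"
      by (intro borel_measurable_\<mu> borel_measurable_continuous_onI continuous_intros) (use r in auto)
    have "integrable \<mu> (\<lambda>z. f z * (\<i> * (z - a) / r))"
    proof (rule Bochner_Integration.integrable_bound[OF f])
      show "(\<lambda>z. f z * (\<i> * (z - a) / r)) \<in> borel_measurable \<mu>"
        by (rule borel_measurable_times[OF _ hm]) (use f in auto)
      show "AE z in \<mu>. cmod (f z * (\<i> * (z - a) / r)) \<le> cmod (f z)"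
        using r by (intro AE_I2) (simp add: norm_mult norm_divide C_eq dist_norm norm_minus_commute)
    qed
    from integral_\<mu>[OF this] show ?thesis by (simp only: \<Gamma>_eq) simp
  qed
  finally show ?thesis .
qed

end

subsection \<open>Symmetric bounded operators and dense subspaces\<close>

text \<open>The squared norm without the factor \<open>1 / (2 * pi)\<close>, which cancels in the
  symmetry and density arguments.\<close>

definition L2_sq :: "complex measure \<Rightarrow> (complex \<Rightarrow> complex) \<Rightarrow> real" where
  "L2_sq M f = (\<integral>z. (cmod (f z))\<^sup>2 \<partial>M)"

lemma L2_sq_nonneg: "0 \<le> L2_sq M f"
  by (simp add: L2_sq_def)

lemma cmod_add_sq_le: "(cmod (x + y))\<^sup>2 \<le> 2 * (cmod x)\<^sup>2 + 2 * (cmod y)\<^sup>2"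
proof -
  have "(cmod (x + y))\<^sup>2 \<le> (cmod x + cmod y)\<^sup>2" by (intro power_mono norm_triangle_ineq) auto
  also have "\<dots> \<le> 2 * (cmod x)\<^sup>2 + 2 * (cmod y)\<^sup>2"
    using sum_squares_bound[of "cmod x" "cmod y"] by (simp add: power2_sum)
  finally show ?thesis .
qed

lemma L2_add:
  assumes f: "f \<in> L2 M" and g: "g \<in> L2 M"
  shows "(\<lambda>z. f z + g z) \<in> L2 M" "L2_sq M (\<lambda>z. f z + g z) \<le> 2 * L2_sq M f + 2 * L2_sq M g"
proof -
  have m: "f \<in> borel_measurable M" "g \<in> borel_measurable M"
    and i: "integrable M (\<lambda>z. (cmod (f z))\<^sup>2)" "integrable M (\<lambda>z. (cmod (g z))\<^sup>2)"
    using f g by (auto simp: L2_def)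
  note [measurable] = m
  have i2: "integrable M (\<lambda>z. 2 * (cmod (f z))\<^sup>2 + 2 * (cmod (g z))\<^sup>2)" using i by simp
  have i3: "integrable M (\<lambda>z. (cmod (f z + g z))\<^sup>2)"
    by (rule Bochner_Integration.integrable_bound[OF i2]) (measurable, auto intro!: AE_I2 cmod_add_sq_le)
  then show "(\<lambda>z. f z + g z) \<in> L2 M" by (auto simp: L2_def)
  have "L2_sq M (\<lambda>z. f z + g z) \<le> (\<integral>z. 2 * (cmod (f z))\<^sup>2 + 2 * (cmod (g z))\<^sup>2 \<partial>M)"
    unfolding L2_sq_def by (rule integral_mono[OF i3 i2 cmod_add_sq_le])
  also have "\<dots> = 2 * L2_sq M f + 2 * L2_sq M g"
    using i by (simp add: L2_sq_def)
  finally show "L2_sq M (\<lambda>z. f z + g z) \<le> 2 * L2_sq M f + 2 * L2_sq M g" .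
qed

lemma L2_cmult:
  assumes f: "f \<in> L2 M"
  shows "(\<lambda>z. c * f z) \<in> L2 M" "L2_sq M (\<lambda>z. c * f z) = (cmod c)\<^sup>2 * L2_sq M f"
  using f by (auto simp: L2_def L2_sq_def norm_mult power_mult_distrib)

lemma L2_diff:
  assumes f: "f \<in> L2 M" and g: "g \<in> L2 M"
  shows "(\<lambda>z. f z - g z) \<in> L2 M"
  using L2_add(1)[OF f L2_cmult(1)[OF g, of "-1"]] by simp

lemma L2_bounded:
  assumes "finite_measure M" "f \<in> borel_measurable M" "\<And>z. z \<in> space M \<Longrightarrow> cmod (f z) \<le> B"
  shows "f \<in> L2 M"
proof -
  note [measurable] = assms(2)
  have "integrable M (\<lambda>z. (cmod (f z))\<^sup>2)"
    by (rule finite_measure.integrable_const_bound[OF assms(1), where B="B\<^sup>2"])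
       (auto intro!: AE_I2 power_mono assms(3))
  then show ?thesis using assms(2) by (simp add: L2_def)
qed

lemma L2_Cauchy_Schwarz:
  assumes f: "f \<in> L2 M" and g: "g \<in> L2 M"
  shows "integrable M (\<lambda>z. f z * cnj (g z))"
    "cmod (\<integral>z. f z * cnj (g z) \<partial>M) \<le> sqrt (L2_sq M f) * sqrt (L2_sq M g)"
proof -
  have m: "f \<in> borel_measurable M" "g \<in> borel_measurable M"
    and i: "integrable M (\<lambda>z. (cmod (f z))\<^sup>2)" "integrable M (\<lambda>z. (cmod (g z))\<^sup>2)"
    using f g by (auto simp: L2_def)
  note [measurable] = m measurable_compose[OF m(2) borel_measurable_cnj]
  have i2: "integrable M (\<lambda>z. (cmod (f z))\<^sup>2 + (cmod (g z))\<^sup>2)" using i by simp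
  have le: "cmod (f z) * cmod (g z) \<le> (cmod (f z))\<^sup>2 + (cmod (g z))\<^sup>2" for z
    using sum_squares_bound[of "cmod (f z)" "cmod (g z)"] mult_nonneg_nonneg[OF norm_ge_zero[of "f z"] norm_ge_zero[of "g z"]]
    by linarith
  have i3: "integrable M (\<lambda>z. cmod (f z) * cmod (g z))"
    by (rule Bochner_Integration.integrable_bound[OF i2]) (measurable, auto intro!: AE_I2 le)
  show i4: "integrable M (\<lambda>z. f z * cnj (g z))"
    by (rule Bochner_Integration.integrable_bound[OF i3]) (measurable, auto intro!: AE_I2 simp: norm_mult)
  let ?P = "\<integral>z. cmod (f z) * cmod (g z) \<partial>M"
  have "(\<integral>\<^sup>+z. ennreal (cmod (f z)) * ennreal (cmod (g z)) \<partial>M)\<^sup>2 \<le>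
     (\<integral>\<^sup>+z. (ennreal (cmod (f z)))\<^sup>2 \<partial>M) * (\<integral>\<^sup>+z. (ennreal (cmod (g z)))\<^sup>2 \<partial>M)"
    by (rule Cauchy_Schwarz_nn_integral) measurable
  moreover have "(\<integral>\<^sup>+z. ennreal (cmod (f z)) * ennreal (cmod (g z)) \<partial>M) = ennreal ?P"
    using nn_integral_eq_integral[OF i3] by (simp add: ennreal_mult)
  moreover have "(\<integral>\<^sup>+z. (ennreal (cmod (f z)))\<^sup>2 \<partial>M) = ennreal (L2_sq M f)"
    using nn_integral_eq_integral[OF i(1)] by (simp add: L2_sq_def ennreal_power)
  moreover have "(\<integral>\<^sup>+z. (ennreal (cmod (g z)))\<^sup>2 \<partial>M) = ennreal (L2_sq M g)"
    using nn_integral_eq_integral[OF i(2)] by (simp add: L2_sq_def ennreal_power)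
  ultimately have "ennreal (?P\<^sup>2) \<le> ennreal (L2_sq M f * L2_sq M g)"
    by (simp add: ennreal_power ennreal_mult L2_sq_nonneg)
  then have "?P\<^sup>2 \<le> L2_sq M f * L2_sq M g"
    by (subst (asm) ennreal_le_iff) (auto intro!: mult_nonneg_nonneg L2_sq_nonneg)
  then have "?P \<le> sqrt (L2_sq M f * L2_sq M g)" by (rule real_le_rsqrt)
  moreover have "cmod (\<integral>z. f z * cnj (g z) \<partial>M) \<le> ?P"
    using integral_norm_bound[of M "\<lambda>z. f z * cnj (g z)"] by (simp add: norm_mult)
  ultimately show "cmod (\<integral>z. f z * cnj (g z) \<partial>M) \<le> sqrt (L2_sq M f) * sqrt (L2_sq M g)"
    by (simp add: real_sqrt_mult)
qed

text \<open>The defect of symmetry is continuous in each argument because \<open>T\<close> is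
  bounded. It is shown to vanish for \<open>g\<close> in \<open>D\<close> and arbitrary
  \<open>f\<close>, and from this for arbitrary \<open>g\<close>. Linearity is an almost-everywhere
  statement because \<open>T\<close> acts on representatives.\<close>

lemma symmetric_on_dense_imp_symmetric:
  assumes T: "\<And>f. f \<in> L2 M \<Longrightarrow> T f \<in> L2 M"
    and bd: "\<And>f. f \<in> L2 M \<Longrightarrow> sqrt (L2_sq M (T f)) \<le> K * sqrt (L2_sq M f)"
    and lin: "\<And>f g. f \<in> L2 M \<Longrightarrow> g \<in> L2 M \<Longrightarrow> AE z in M. T (\<lambda>z. f z - g z) z = T f z - T g z"
    and D: "\<And>f. f \<in> D \<Longrightarrow> f \<in> L2 M"
    and dense: "\<And>f e. f \<in> L2 M \<Longrightarrow> e > 0 \<Longrightarrow> \<exists>g\<in>D. L2_sq M (\<lambda>z. f z - g z) < e"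
    and sym: "\<And>f g. f \<in> D \<Longrightarrow> g \<in> D \<Longrightarrow> (\<integral>z. T f z * cnj (g z) \<partial>M) = (\<integral>z. f z * cnj (T g z) \<partial>M)"
    and f: "f \<in> L2 M" and g: "g \<in> L2 M"
  shows "(\<integral>z. T f z * cnj (g z) \<partial>M) = (\<integral>z. f z * cnj (T g z) \<partial>M)"
proof -
  let ?I = "\<lambda>f g. \<integral>z. f z * cnj (g z) \<partial>M" and ?N = "\<lambda>f. sqrt (L2_sq M f)"
  have dense': "\<exists>g\<in>D. ?N (\<lambda>z. f z - g z) < e" if "f \<in> L2 M" "e > 0" for f e
    using dense[OF that(1), of "e\<^sup>2"] that(2) by (auto intro!: real_less_lsqrt simp: L2_sq_nonneg)
  have cs: "cmod (?I f g) \<le> ?N f * ?N g" if "f \<in> L2 M" "g \<in> L2 M" for f g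
    by (rule L2_Cauchy_Schwarz(2)[OF that])
  have I_diff1: "?I (\<lambda>z. f z - f' z) g = ?I f g - ?I f' g" if "f \<in> L2 M" "f' \<in> L2 M" "g \<in> L2 M" for f f' g
    using L2_Cauchy_Schwarz(1)[OF that(1,3)] L2_Cauchy_Schwarz(1)[OF that(2,3)] by (simp add: left_diff_distrib)
  have I_diff2: "?I f (\<lambda>z. g z - g' z) = ?I f g - ?I f g'" if "f \<in> L2 M" "g \<in> L2 M" "g' \<in> L2 M" for f g g'
    using L2_Cauchy_Schwarz(1)[OF that(1,2)] L2_Cauchy_Schwarz(1)[OF that(1,3)] by (simp add: right_diff_distrib)
  have T_diff1: "?I (T (\<lambda>z. f z - f' z)) g = ?I (T f) g - ?I (T f') g" if L: "f \<in> L2 M" "f' \<in> L2 M" "g \<in> L2 M" for f f' g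
  proof -
    have m: "T (\<lambda>z. f z - f' z) \<in> borel_measurable M" "T f \<in> borel_measurable M" "T f' \<in> borel_measurable M" "g \<in> borel_measurable M"
      using T[OF L2_diff[OF L(1,2)]] T[OF L(1)] T[OF L(2)] L(3) by (auto simp: L2_def)
    note [measurable] = m measurable_compose[OF m(4) borel_measurable_cnj]
    have "?I (T (\<lambda>z. f z - f' z)) g = ?I (\<lambda>z. T f z - T f' z) g"
    proof (rule integral_cong_AE)
      show "AE z in M. T (\<lambda>z. f z - f' z) z * cnj (g z) = (T f z - T f' z) * cnj (g z)"
        using lin[OF L(1,2)] by eventually_elim simp
    qed measurable
    then show ?thesis using I_diff1 T L by simp
  qed
  have T_diff2: "?I g (T (\<lambda>z. f z - f' z)) = ?I g (T f) - ?I g (T f')" if L: "f \<in> L2 M" "f' \<in> L2 M" "g \<in> L2 M" for f f' g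
  proof -
    have m: "T (\<lambda>z. f z - f' z) \<in> borel_measurable M" "T f \<in> borel_measurable M" "T f' \<in> borel_measurable M" "g \<in> borel_measurable M"
      using T[OF L2_diff[OF L(1,2)]] T[OF L(1)] T[OF L(2)] L(3) by (auto simp: L2_def)
    note [measurable] = m(4) measurable_compose[OF m(1) borel_measurable_cnj]
      measurable_compose[OF borel_measurable_diff[OF m(2,3)] borel_measurable_cnj]
    have "?I g (T (\<lambda>z. f z - f' z)) = ?I g (\<lambda>z. T f z - T f' z)"
    proof (rule integral_cong_AE)
      show "AE z in M. g z * cnj (T (\<lambda>z. f z - f' z) z) = g z * cnj (T f z - T f' z)"
        using lin[OF L(1,2)] by eventually_elim simp
    qed measurable
    then show ?thesis using I_diff2 T L by simp
  qed
  \<comment> \<open>The sign of \<open>B\<close> is unknown; scaling \<open>e\<close> with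
    \<open>\<bar>B\<bar> + 1\<close> covers every case and avoids division by zero.\<close>
  have small: "x = 0" if "\<And>e. e > 0 \<Longrightarrow> cmod x \<le> B * e" for x :: complex and B
  proof (rule ccontr)
    assume x: "x \<noteq> 0"
    define e where "e = cmod x / (2 * (\<bar>B\<bar> + 1))"
    have e: "e > 0" using x by (auto simp: e_def intro!: divide_pos_pos)
    have "cmod x \<le> B * e" by (rule that[OF e])
    also have "\<dots> \<le> (\<bar>B\<bar> + 1) * e" using e by (intro mult_right_mono) auto
    also have "\<dots> = cmod x / 2" by (simp add: e_def field_simps)
    finally show False using x by simp
  qed
  have half: "?I (T f) g - ?I f (T g) = 0" if f: "f \<in> L2 M" and g: "g \<in> D" for f g
  proof (rule small[where B="K * ?N g + ?N (T g)"])
    fix e :: real assume "e > 0"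
    then obtain h where h: "h \<in> D" "?N (\<lambda>z. f z - h z) < e" using dense'[OF f] by blast
    let ?d = "\<lambda>z. f z - h z"
    have L: "h \<in> L2 M" "g \<in> L2 M" "?d \<in> L2 M" "T g \<in> L2 M" "T ?d \<in> L2 M"
      using D h(1) g T L2_diff[OF f D[OF h(1)]] by auto
    \<comment> \<open>\<open>sym\<close> removes the contribution of \<open>h\<close>, so only the
      small difference \<open>?d\<close> remains.\<close>
    have "cmod (?I (T f) g - ?I f (T g)) = cmod (?I (T ?d) g - ?I ?d (T g))"
      using sym[OF h(1) g] T_diff1[OF f L(1,2)] I_diff1[OF f L(1,4)] by simp
    also have "\<dots> \<le> ?N (T ?d) * ?N g + ?N ?d * ?N (T g)"
      by (rule order_trans[OF norm_triangle_ineq4 add_mono[OF cs[OF L(5,2)] cs[OF L(3,4)]]])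
    also have "\<dots> \<le> (K * ?N ?d) * ?N g + ?N ?d * ?N (T g)"
      using bd[OF L(3)] by (intro add_mono mult_right_mono) (auto simp: L2_sq_nonneg)
    also have "\<dots> = (K * ?N g + ?N (T g)) * ?N ?d" by (simp add: algebra_simps)
    finally have le: "cmod (?I (T f) g - ?I f (T g)) \<le> (K * ?N g + ?N (T g)) * ?N ?d" .
    have "0 \<le> ?N (T g)" by (simp add: L2_sq_nonneg)
    \<comment> \<open>No sign of \<open>K\<close> is assumed; the operator bound itself shows that
      this product is nonnegative.\<close>
    then have "0 \<le> K * ?N g" using bd[OF L(2)] by linarith
    then have "0 \<le> K * ?N g + ?N (T g)" by (simp add: L2_sq_nonneg)
    then show "cmod (?I (T f) g - ?I f (T g)) \<le> (K * ?N g + ?N (T g)) * e"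
      using le h(2) by (meson less_imp_le mult_left_mono order_trans)
  qed
  have "?I (T f) g - ?I f (T g) = 0"
  proof (rule small[where B="?N (T f) + K * ?N f"])
    fix e :: real assume "e > 0"
    then obtain h where h: "h \<in> D" "?N (\<lambda>z. g z - h z) < e" using dense'[OF g] by blast
    let ?d = "\<lambda>z. g z - h z"
    have L: "h \<in> L2 M" "T f \<in> L2 M" "?d \<in> L2 M" "T h \<in> L2 M" "T ?d \<in> L2 M"
      using D h(1) f T L2_diff[OF g D[OF h(1)]] by auto
    have "cmod (?I (T f) g - ?I f (T g)) = cmod (?I (T f) ?d - ?I f (T ?d))"
      using half[OF f h(1)] T_diff2[OF g L(1) f] I_diff2[OF L(2) g L(1)] by simp
    also have "\<dots> \<le> ?N (T f) * ?N ?d + ?N f * ?N (T ?d)"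
      by (rule order_trans[OF norm_triangle_ineq4 add_mono[OF cs[OF L(2,3)] cs[OF f L(5)]]])
    also have "\<dots> \<le> ?N (T f) * ?N ?d + ?N f * (K * ?N ?d)"
      using bd[OF L(3)] by (intro add_mono mult_left_mono) (auto simp: L2_sq_nonneg)
    also have "\<dots> = (?N (T f) + K * ?N f) * ?N ?d" by (simp add: algebra_simps)
    finally have le: "cmod (?I (T f) g - ?I f (T g)) \<le> (?N (T f) + K * ?N f) * ?N ?d" .
    have "0 \<le> ?N (T f)" by (simp add: L2_sq_nonneg)
    then have "0 \<le> K * ?N f" using bd[OF f] by linarith
    then have "0 \<le> ?N (T f) + K * ?N f" by (simp add: L2_sq_nonneg)
    then show "cmod (?I (T f) g - ?I f (T g)) \<le> (?N (T f) + K * ?N f) * e"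
      using le h(2) by (meson less_imp_le mult_left_mono order_trans)
  qed
  then show ?thesis by simp
qed

subsection \<open>Density of bounded Lipschitz functions\<close>

text \<open>The Lipschitz condition cancels the singularity of the kernel. Boundedness is a separate
  condition because the functions live on the whole plane; it puts them into \<open>L2 \<mu>\<close>
  for the finite measure \<mu>.\<close>

definition bounded_lipschitz :: "(complex \<Rightarrow> complex) set" where
  "bounded_lipschitz = {f. (\<exists>L. L-lipschitz_on UNIV f) \<and> bounded (range f)}"

lemma bounded_lipschitz_add: "f \<in> bounded_lipschitz \<Longrightarrow> g \<in> bounded_lipschitz \<Longrightarrow> (\<lambda>z. f z + g z) \<in> bounded_lipschitz"
  unfolding bounded_lipschitz_def by (auto intro: lipschitz_on_add bounded_plus_comp)

lemma bounded_lipschitz_cmult: assumes "f \<in> bounded_lipschitz" shows "(\<lambda>z. c * f z) \<in> bounded_lipschitz"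
proof -
  obtain L B where L: "L-lipschitz_on UNIV f" and B: "\<And>z. cmod (f z) \<le> B"
    using assms by (auto simp: bounded_lipschitz_def bounded_iff)
  have "(cmod c * L)-lipschitz_on UNIV (\<lambda>z. c * f z)"
  proof (rule lipschitz_onI)
    fix x y
    have "dist (c * f x) (c * f y) = cmod c * dist (f x) (f y)"
      by (simp add: dist_norm norm_mult flip: right_diff_distrib)
    also have "\<dots> \<le> cmod c * (L * dist x y)" using lipschitz_onD[OF L] by (intro mult_left_mono) auto
    finally show "dist (c * f x) (c * f y) \<le> cmod c * L * dist x y" by (simp add: mult.assoc)
  qed (use lipschitz_on_nonneg[OF L] in auto)
  moreover have "cmod (c * f z) \<le> cmod c * B" for z using B[of z] by (simp add: norm_mult mult_left_mono)
  ultimately show ?thesis by (auto simp: bounded_lipschitz_def bounded_iff)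
qed

lemma bounded_lipschitz_measurable: "f \<in> bounded_lipschitz \<Longrightarrow> f \<in> borel_measurable borel"
  by (auto simp: bounded_lipschitz_def intro!: borel_measurable_continuous_onI dest: lipschitz_on_continuous_on)

lemma bounded_lipschitz_zero: "(\<lambda>z. 0) \<in> bounded_lipschitz"
  by (auto simp: bounded_lipschitz_def intro!: exI[of _ 0] lipschitz_on_constant)

context rectifiable_cycle
begin

lemma bounded_lipschitz_L2: assumes "f \<in> bounded_lipschitz" shows "f \<in> L2 \<mu>"
proof -
  obtain B where B: "\<And>z. cmod (f z) \<le> B"
    using assms by (auto simp: bounded_lipschitz_def bounded_iff)
  show ?thesis
    by (rule L2_bounded[where B=B]) (use B borel_measurable_\<mu>[OF bounded_lipschitz_measurable[OF assms]] in \<open>auto intro: finite_measure_axioms\<close>)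
qed

text \<open>Membership in the closure of the bounded Lipschitz functions, the property that the
  standard induction over indicators and simple functions carries to all of
  \<open>L2 \<mu>\<close>.\<close>

definition approximable :: "(complex \<Rightarrow> complex) \<Rightarrow> bool" where
  "approximable f \<longleftrightarrow> f \<in> L2 \<mu> \<and> (\<forall>e>0. \<exists>g\<in>bounded_lipschitz. L2_sq \<mu> (\<lambda>z. f z - g z) < e)"

text \<open>The closure is closed. The tolerance \<open>e / 4\<close> compensates the factor 2 in
  \<open>cmod_add_sq_le\<close>.\<close>

lemma approximable_limit:
  assumes f: "f \<in> L2 \<mu>" and ap: "\<And>e. e > 0 \<Longrightarrow> \<exists>g. approximable g \<and> L2_sq \<mu> (\<lambda>z. f z - g z) < e"
  shows "approximable f"
  unfolding approximable_def
proof (intro conjI allI impI f)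
  fix e :: real assume e: "e > 0"
  obtain g where g: "approximable g" "L2_sq \<mu> (\<lambda>z. f z - g z) < e / 4" using ap[of "e/4"] e by auto
  obtain h where h: "h \<in> bounded_lipschitz" "L2_sq \<mu> (\<lambda>z. g z - h z) < e / 4"
    using g(1) e unfolding approximable_def by (meson divide_pos_pos zero_less_numeral)
  have L: "g \<in> L2 \<mu>" "h \<in> L2 \<mu>" using g h bounded_lipschitz_L2 by (auto simp: approximable_def)
  have "L2_sq \<mu> (\<lambda>z. f z - h z) = L2_sq \<mu> (\<lambda>z. (f z - g z) + (g z - h z))" by simp
  also have "\<dots> \<le> 2 * L2_sq \<mu> (\<lambda>z. f z - g z) + 2 * L2_sq \<mu> (\<lambda>z. g z - h z)"
    by (rule L2_add(2)[OF L2_diff[OF f L(1)] L2_diff[OF L]])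
  also have "\<dots> < e" using g h by simp
  finally show "\<exists>g\<in>bounded_lipschitz. L2_sq \<mu> (\<lambda>z. f z - g z) < e" using h(1) by blast
qed

lemma approximable_add: assumes "approximable f" "approximable g" shows "approximable (\<lambda>z. f z + g z)"
  unfolding approximable_def
proof (intro conjI allI impI)
  have L: "f \<in> L2 \<mu>" "g \<in> L2 \<mu>" using assms by (auto simp: approximable_def)
  show "(\<lambda>z. f z + g z) \<in> L2 \<mu>" by (rule L2_add(1)[OF L])
  fix e :: real assume e: "e > 0"
  then have e4: "e / 4 > 0" by simp
  obtain f' where f': "f' \<in> bounded_lipschitz" "L2_sq \<mu> (\<lambda>z. f z - f' z) < e / 4"
    using assms(1) e4 unfolding approximable_def by blast
  obtain g' where g': "g' \<in> bounded_lipschitz" "L2_sq \<mu> (\<lambda>z. g z - g' z) < e / 4"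
    using assms(2) e4 unfolding approximable_def by blast
  have "L2_sq \<mu> (\<lambda>z. f z + g z - (f' z + g' z)) = L2_sq \<mu> (\<lambda>z. (f z - f' z) + (g z - g' z))"
    by (simp add: algebra_simps)
  also have "\<dots> \<le> 2 * L2_sq \<mu> (\<lambda>z. f z - f' z) + 2 * L2_sq \<mu> (\<lambda>z. g z - g' z)"
    by (rule L2_add(2)) (intro L2_diff L bounded_lipschitz_L2 f'(1) g'(1))+
  also have "\<dots> < e" using f' g' by simp
  finally show "\<exists>h\<in>bounded_lipschitz. L2_sq \<mu> (\<lambda>z. f z + g z - h z) < e"
    by (intro bexI[OF _ bounded_lipschitz_add[OF f'(1) g'(1)]])
qed

lemma approximable_cmult: assumes "approximable f" shows "approximable (\<lambda>z. c * f z)"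
  unfolding approximable_def
proof (intro conjI allI impI)
  have L: "f \<in> L2 \<mu>" using assms by (auto simp: approximable_def)
  show "(\<lambda>z. c * f z) \<in> L2 \<mu>" by (rule L2_cmult(1)[OF L])
  fix e :: real assume e: "e > 0"
  define K where "K = (cmod c)\<^sup>2 + 1"
  have K: "K > 0" by (simp add: K_def add_nonneg_pos)
  then have "e / K > 0" using e by simp
  then obtain f' where f': "f' \<in> bounded_lipschitz" "L2_sq \<mu> (\<lambda>z. f z - f' z) < e / K"
    using assms unfolding approximable_def by blast
  have "L2_sq \<mu> (\<lambda>z. c * f z - c * f' z) = (cmod c)\<^sup>2 * L2_sq \<mu> (\<lambda>z. f z - f' z)"
    using L2_cmult(2)[OF L2_diff[OF L bounded_lipschitz_L2[OF f'(1)]], of c] by (simp add: right_diff_distrib)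
  also have "\<dots> \<le> K * L2_sq \<mu> (\<lambda>z. f z - f' z)"
    by (intro mult_right_mono) (auto simp: K_def L2_sq_nonneg)
  also have "\<dots> < e" using f'(2) K by (simp add: field_simps)
  finally show "\<exists>h\<in>bounded_lipschitz. L2_sq \<mu> (\<lambda>z. c * f z - h z) < e"
    by (intro bexI[OF _ bounded_lipschitz_cmult[OF f'(1), of c]])
qed

lemma indicator_L2: "A \<in> sets \<mu> \<Longrightarrow> indicator A \<in> L2 \<mu>"
  by (rule L2_bounded[where B=1, OF finite_measure_axioms borel_measurable_indicator]) (auto simp: indicator_def)

text \<open>The cut-offs \<open>max 0 (1 - real n * infdist z K)\<close> are Lipschitz with constant
  \<open>n\<close> and decrease to the indicator of \<open>K\<close>, because \<open>infdist\<close>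
  vanishes only on the closed set.\<close>

lemma approximable_indicator_closed:
  assumes K: "closed K" "K \<subseteq> C" shows "approximable (indicator K)"
proof (cases "K = {}")
  \<comment> \<open>\<open>infdist\<close> to the empty set is 0 by convention, so the cut-offs
    would be constantly 1 in this case.\<close>
  case True
  have "approximable (\<lambda>_. 0)"
    unfolding approximable_def using bounded_lipschitz_zero bounded_lipschitz_L2[OF bounded_lipschitz_zero]
    by (auto simp: L2_sq_def intro!: bexI[OF _ bounded_lipschitz_zero])
  then show ?thesis using True by (simp add: indicator_def[abs_def])
next
  case False
  have Ks: "K \<in> sets \<mu>" using K by simp
  define g where "g n z = complex_of_real (max 0 (1 - real n * infdist z K))" for n :: nat and z
  have g01: "0 \<le> max 0 (1 - real n * infdist z K)" "max 0 (1 - real n * infdist z K) \<le> 1" for n z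
    by (auto simp: infdist_nonneg)
  have gB: "cmod (g n z) \<le> 1" for n z using g01[of n z] by (simp add: g_def)
  have gl: "g n \<in> bounded_lipschitz" for n
  proof -
    have "(real n)-lipschitz_on UNIV (g n)"
    proof (rule lipschitz_onI)
      fix x y
      have "\<bar>infdist x K - infdist y K\<bar> \<le> dist x y" by (rule infdist_triangle_abs)
      then have "real n * \<bar>infdist x K - infdist y K\<bar> \<le> real n * dist x y" by (intro mult_left_mono) auto
      moreover have "dist (g n x) (g n y) \<le> \<bar>real n * infdist x K - real n * infdist y K\<bar>"
        unfolding g_def dist_norm by (simp flip: of_real_diff)
      moreover have "\<bar>real n * infdist x K - real n * infdist y K\<bar> = real n * \<bar>infdist x K - infdist y K\<bar>"
        by (simp add: abs_mult flip: right_diff_distrib)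
      ultimately show "dist (g n x) (g n y) \<le> real n * dist x y" by linarith
    qed simp
    then show ?thesis using gB by (auto simp: bounded_lipschitz_def bounded_iff)
  qed
  have lim: "(\<lambda>n. L2_sq \<mu> (\<lambda>z. indicator K z - g n z)) \<longlonglongrightarrow> (\<integral>z. 0 \<partial>\<mu>)"
    unfolding L2_sq_def
  proof (rule integral_dominated_convergence[where w="\<lambda>_. 4"])
    show "AE z in \<mu>. (\<lambda>n. (cmod (indicator K z - g n z))\<^sup>2) \<longlonglongrightarrow> 0"
    proof (rule AE_I2, rule tendsto_eventually)
      fix z
      show "\<forall>\<^sub>F n in sequentially. (cmod (indicator K z - g n z))\<^sup>2 = 0"
      proof (cases "z \<in> K")
        case True then show ?thesis by (simp add: g_def)
      next
        case zK: False
        then have "infdist z K > 0"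
          using in_closed_iff_infdist_zero[OF K(1) False] infdist_nonneg[of z K] by force
        then obtain N :: nat where N: "1 < real N * infdist z K" using ex_less_of_nat_mult by blast
        show ?thesis
          using eventually_ge_at_top[of N]
        proof eventually_elim
          case (elim n)
          then have "real N * infdist z K \<le> real n * infdist z K" by (intro mult_right_mono) (auto simp: infdist_nonneg)
          then show ?case using N zK by (simp add: g_def)
        qed
      qed
    qed
    show "AE z in \<mu>. norm ((cmod (indicator K z - g n z))\<^sup>2) \<le> 4" for n
    proof (rule AE_I2)
      fix z
      have "cmod (indicator K z - g n z) \<le> cmod (indicator K z) + cmod (g n z)" by (rule norm_triangle_ineq4)
      also have "\<dots> \<le> 2" using gB[of n z] by (simp add: indicator_def)
      finally have "(cmod (indicator K z - g n z))\<^sup>2 \<le> 2\<^sup>2" by (intro power_mono) auto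
      then show "norm ((cmod (indicator K z - g n z))\<^sup>2) \<le> 4" by simp
    qed
    show "(\<lambda>z. (cmod (indicator K z - g n z))\<^sup>2) \<in> borel_measurable \<mu>" for n
      using L2_diff[OF indicator_L2[OF Ks] bounded_lipschitz_L2[OF gl[of n]]] by (auto simp: L2_def)
  qed auto
  show ?thesis
    unfolding approximable_def
  proof (intro conjI allI impI indicator_L2 Ks)
    fix e :: real assume "e > 0"
    then have "\<forall>\<^sub>F n in sequentially. L2_sq \<mu> (\<lambda>z. indicator K z - g n z) < e"
      using lim by (intro order_tendstoD(2)) auto
    then obtain n where "L2_sq \<mu> (\<lambda>z. indicator K z - g n z) < e"
      by (auto simp: eventually_sequentially)
    then show "\<exists>h\<in>bounded_lipschitz. L2_sq \<mu> (\<lambda>z. indicator K z - h z) < e" using gl by blast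
  qed
qed

text \<open>Inner regularity gives a compact \<open>K\<close> inside \<open>A\<close> with
  \<open>A - K\<close> of small measure, and this measure is the squared distance of the two
  indicators.\<close>

lemma approximable_indicator:
  assumes A: "A \<in> sets \<mu>" shows "approximable (indicator A)"
proof (rule approximable_limit[OF indicator_L2[OF A]])
  fix e :: real assume e: "e > 0"
  \<comment> \<open>\<open>?D\<close> is \<mu> extended by zero to the Borel sets of the plane, the
    setting of \<open>inner_regular\<close>.\<close>
  let ?D = "distr \<mu> borel (\<lambda>z. z)"
  have idm: "(\<lambda>z. z) \<in> borel_measurable \<mu>" by (rule borel_measurable_\<mu>) simp
  interpret D: finite_measure ?D by (rule finite_measure_distr[OF idm])
  have Ab: "A \<in> sets borel" "A \<subseteq> C" using A by auto
  have em: "emeasure ?D B = emeasure \<mu> B" if "B \<in> sets borel" "B \<subseteq> C" for B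
    using that by (subst emeasure_distr[OF idm]) (auto simp: Int_absorb2)
  have "emeasure ?D A = (SUP K\<in>{K. K \<subseteq> A \<and> compact K}. emeasure ?D K)"
    by (rule inner_regular) (use D.emeasure_finite Ab in auto)
  then have "\<exists>K\<in>{K. K \<subseteq> A \<and> compact K}. emeasure ?D A < emeasure ?D K + ennreal e"
  proof (rule SUP_approx_ennreal[OF e, rotated])
    show "{K. K \<subseteq> A \<and> compact K} \<noteq> {}" using compact_empty by blast
    show "emeasure ?D A \<noteq> \<infinity>" using D.emeasure_finite[of A] by simp
  qed
  then obtain K where K: "K \<subseteq> A" "compact K" and less: "emeasure ?D A < emeasure ?D K + ennreal e"
    by blast
  have Kb: "K \<in> sets borel" "K \<subseteq> C" "K \<in> sets \<mu>" using K Ab by (auto simp: compact_imp_closed)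
  have "ennreal (measure \<mu> A) < ennreal (measure \<mu> K + e)"
    using less e em Ab Kb by (simp add: emeasure_eq_measure)
  then have "measure \<mu> A < measure \<mu> K + e" by (simp add: ennreal_less_iff)
  then have "measure \<mu> (A - K) < e" using finite_measure_Diff[OF A Kb(3) K(1)] by simp
  moreover have "L2_sq \<mu> (\<lambda>z. indicator A z - indicator K z) = measure \<mu> (A - K)"
  proof -
    have "L2_sq \<mu> (\<lambda>z. indicator A z - indicator K z) = (\<integral>z. indicator (A - K) z \<partial>\<mu>)"
      unfolding L2_sq_def using K(1) by (intro Bochner_Integration.integral_cong) (auto simp: indicator_def)
    also have "\<dots> = measure \<mu> ((A - K) \<inter> space \<mu>)" by simp
    finally show ?thesis using Ab by (simp add: Int_absorb2 subset_iff)
  qed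
  ultimately show "\<exists>g. approximable g \<and> L2_sq \<mu> (\<lambda>z. indicator A z - g z) < e"
    using approximable_indicator_closed[OF compact_imp_closed[OF K(2)] Kb(2)] by (intro exI[of _ "indicator K"]) auto
qed

lemma approximable_cong:
  assumes "approximable f" "\<And>z. z \<in> C \<Longrightarrow> f z = g z" shows "approximable g"
proof -
  have L: "L2_sq \<mu> (\<lambda>z. f z - h z) = L2_sq \<mu> (\<lambda>z. g z - h z)" for h
    unfolding L2_sq_def using assms(2) by (intro Bochner_Integration.integral_cong) auto
  have "g \<in> L2 \<mu>"
    using assms unfolding approximable_def L2_def
    by (auto simp: cong: measurable_cong[of \<mu> f g] Bochner_Integration.integrable_cong[OF refl])
       (metis (no_types, lifting) Bochner_Integration.integrable_cong measurable_cong space_arclength_measure)+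
  then show ?thesis using assms(1) unfolding approximable_def L by blast
qed

lemma approximable_simple:
  assumes s: "simple_function \<mu> s" shows "approximable s"
proof -
  let ?Y = "s ` space \<mu>"
  have fin: "finite ?Y" using s by (simp add: simple_function_def)
  have sets: "s -` {y} \<inter> space \<mu> \<in> sets \<mu>" for y
  proof (cases "y \<in> ?Y")
    case False
    then have "s -` {y} \<inter> space \<mu> = {}" by auto
    then show ?thesis by (simp only: sets.empty_sets)
  qed (use s in \<open>auto simp: simple_function_def\<close>)
  have "approximable (\<lambda>z. \<Sum>y\<in>Y. y * indicator (s -` {y} \<inter> space \<mu>) z)" if "finite Y" for Y
    using that
  proof induction
    case empty
    show ?case using approximable_indicator[of "{}"] by (simp add: indicator_def[abs_def])
  next
    case (insert y Y)
    show ?case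
      using approximable_add[OF approximable_cmult[OF approximable_indicator[OF sets[of y]], of y] insert.IH]
      by (simp only: sum.insert[OF insert.hyps])
  qed
  from this[OF fin] show ?thesis
  proof (rule approximable_cong)
    fix z assume z: "z \<in> C"
    have "(\<Sum>y\<in>?Y. y * indicator (s -` {y} \<inter> space \<mu>) z) = (\<Sum>y\<in>?Y. if s z = y then y else 0)"
      using z by (intro sum.cong) (auto simp: indicator_def)
    also have "\<dots> = s z" using fin z by (simp add: sum.delta)
    finally show "(\<Sum>y\<in>?Y. y * indicator (s -` {y} \<inter> space \<mu>) z) = s z" .
  qed
qed

text \<open>Simple functions converge to \<open>f\<close> pointwise with moduli at most
  \<open>2 * cmod (f z)\<close>, so the squared differences are dominated by
  \<open>9 * (cmod (f z))\<^sup>2\<close>.\<close>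

lemma bounded_lipschitz_dense:
  assumes f: "f \<in> L2 \<mu>" and e: "e > 0"
  shows "\<exists>g\<in>bounded_lipschitz. L2_sq \<mu> (\<lambda>z. f z - g z) < e"
proof -
  have fm: "f \<in> borel_measurable \<mu>" and fi: "integrable \<mu> (\<lambda>z. (cmod (f z))\<^sup>2)" using f by (auto simp: L2_def)
  obtain F where F: "\<And>i. simple_function \<mu> (F i)" "\<And>z. z \<in> space \<mu> \<Longrightarrow> (\<lambda>i. F i z) \<longlonglongrightarrow> f z"
    "\<And>i z. z \<in> space \<mu> \<Longrightarrow> dist (F i z) 0 \<le> 2 * dist (f z) 0"
    using borel_measurable_implies_sequence_metric[OF fm, of 0] by blast
  have "approximable f"
  proof (rule approximable_limit[OF f])
    fix e :: real assume e: "e > 0"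
    have "(\<lambda>n. L2_sq \<mu> (\<lambda>z. f z - F n z)) \<longlonglongrightarrow> (\<integral>z. 0 \<partial>\<mu>)"
      unfolding L2_sq_def
    proof (rule integral_dominated_convergence[where w="\<lambda>z. 9 * (cmod (f z))\<^sup>2"])
      show "AE z in \<mu>. (\<lambda>n. (cmod (f z - F n z))\<^sup>2) \<longlonglongrightarrow> 0"
      proof (rule AE_I2)
        fix z assume "z \<in> space \<mu>"
        then have "(\<lambda>n. (cmod (f z - F n z))\<^sup>2) \<longlonglongrightarrow> (cmod (f z - f z))\<^sup>2"
          using F(2) by (intro tendsto_intros)
        then show "(\<lambda>n. (cmod (f z - F n z))\<^sup>2) \<longlonglongrightarrow> 0" by simp
      qed
      show "AE z in \<mu>. norm ((cmod (f z - F n z))\<^sup>2) \<le> 9 * (cmod (f z))\<^sup>2" for n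
      proof (rule AE_I2)
        fix z assume z: "z \<in> space \<mu>"
        have "cmod (f z - F n z) \<le> cmod (f z) + cmod (F n z)" by (rule norm_triangle_ineq4)
        also have "\<dots> \<le> 3 * cmod (f z)" using F(3)[OF z, of n] by simp
        finally have "(cmod (f z - F n z))\<^sup>2 \<le> (3 * cmod (f z))\<^sup>2" by (intro power_mono) auto
        then show "norm ((cmod (f z - F n z))\<^sup>2) \<le> 9 * (cmod (f z))\<^sup>2" by (simp add: power_mult_distrib)
      qed
      show "(\<lambda>z. (cmod (f z - F n z))\<^sup>2) \<in> borel_measurable \<mu>" for n
        using L2_diff[OF f] approximable_simple[OF F(1)[of n]] by (auto simp: L2_def approximable_def)
    qed (use fi in auto)
    then have "\<forall>\<^sub>F n in sequentially. L2_sq \<mu> (\<lambda>z. f z - F n z) < e"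
      using e by (intro order_tendstoD(2)) auto
    then obtain n where "L2_sq \<mu> (\<lambda>z. f z - F n z) < e"
      by (auto simp: eventually_sequentially)
    then show "\<exists>g. approximable g \<and> L2_sq \<mu> (\<lambda>z. f z - g z) < e" using approximable_simple[OF F(1)] by blast
  qed
  then show ?thesis using e by (simp add: approximable_def)
qed

end

subsection \<open>The Cauchy singular integral on a circle\<close>

text \<open>Reflecting the variable in \<open>p\<close> preserves the interval and changes the sign
  of the integral.\<close>

lemma integral_odd_symmetric_interval:
  fixes H :: "real \<Rightarrow> complex"
  assumes odd: "\<And>x. H (p + x) = - H (p - x)"
  shows "(\<integral>x. indicator {p - d..p + d} x *\<^sub>R H x \<partial>lborel) = 0"
proof -
  let ?I = "\<integral>x. indicator {p - d..p + d} x *\<^sub>R H x \<partial>lborel"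
  have "?I = (\<integral>x. indicator {p - d..p + d} (2 * p + (-1) * x) *\<^sub>R H (2 * p + (-1) * x) \<partial>lborel)"
    using lborel_integral_real_affine[of "-1" "\<lambda>x. indicator {p - d..p + d} x *\<^sub>R H x" "2 * p"] by simp
  also have "\<dots> = (\<integral>x. - (indicator {p - d..p + d} x *\<^sub>R H x) \<partial>lborel)"
  proof (rule Bochner_Integration.integral_cong[OF refl])
    fix x
    have "H (2 * p + (-1) * x) = - H x" using odd[of "p - x"] by simp
    then show "indicator {p - d..p + d} (2 * p + (-1) * x) *\<^sub>R H (2 * p + (-1) * x) = - (indicator {p - d..p + d} x *\<^sub>R H x)"
      by (auto simp: indicator_def)
  qed
  also have "\<dots> = - ?I" by (rule integral_minus)
  finally show ?thesis by simp
qed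

text \<open>\<open>p\<close> need not be the midpoint of the period interval. Oddness about
  \<open>p\<close> and the period give oddness about \<open>p + pi\<close> and
  \<open>p - pi\<close>, and the interval splits into two pieces centred at points of this
  kind.\<close>

lemma integral_odd_periodic:
  fixes H :: "real \<Rightarrow> complex"
  assumes m[measurable]: "H \<in> borel_measurable borel" and bd: "\<And>x. cmod (H x) \<le> B"
    and per: "\<And>x. H (x + 2 * pi) = H x" and odd: "\<And>x. H (p + x) = - H (p - x)"
    and p: "c \<le> p" "p \<le> c + 2 * pi"
  shows "(\<integral>x. indicator {c..c + 2 * pi} x *\<^sub>R H x \<partial>lborel) = 0"
proof -
  \<comment> \<open>\<open>q\<close> is a centre of oddness in \<open>{c..c + pi}\<close>. The
    pieces are \<open>{c..2 * q - c}\<close> about \<open>q\<close> and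
    \<open>{2 * q - c..c + 2 * pi}\<close> about \<open>q + pi\<close>; they share one
    point.\<close>
  define q where "q = (if p \<le> c + pi then p else p - pi)"
  have shift: "H (t - pi + x) = - H (t - pi - x)" "H (t + pi + x) = - H (t + pi - x)"
    if "\<And>x. H (t + x) = - H (t - x)" for t x
    using that[of "x - pi"] that[of "x + pi"] per[of "t - x - pi"] per[of "t - pi - x"] per[of "t + pi - x"]
    by (simp_all add: algebra_simps)
  have q: "c \<le> q" "q \<le> c + pi" using p pi_gt_zero by (auto simp: q_def)
  have oddq: "H (q + x) = - H (q - x)" for x
    using shift(1)[OF odd] odd by (simp add: q_def)
  define d where "d = q - c"
  have int: "integrable lborel (\<lambda>x. indicator {s..t} x *\<^sub>R H x)" for s t
  proof (rule Bochner_Integration.integrable_bound)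
    show "integrable lborel (\<lambda>x. indicator {s..t} x *\<^sub>R B)"
      by (intro integrable_scaleR_left) (cases "s \<le> t"; simp)
    show "AE x in lborel. norm (indicator {s..t} x *\<^sub>R H x) \<le> norm (indicator {s..t} x *\<^sub>R B)"
      by (intro AE_I2) (auto simp: indicator_def intro: order_trans[OF bd abs_ge_self])
  qed measurable
  have "(\<integral>x. indicator {c..c + 2 * pi} x *\<^sub>R H x \<partial>lborel) =
    (\<integral>x. indicator {q - d..q + d} x *\<^sub>R H x + indicator {(q + pi) - (pi - d)..(q + pi) + (pi - d)} x *\<^sub>R H x \<partial>lborel)"
  proof (rule integral_cong_AE)
    have "AE x in lborel. x \<noteq> q + d" by (rule AE_lborel_singleton)
    then show "AE x in lborel. indicator {c..c + 2 * pi} x *\<^sub>R H x =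
      indicator {q - d..q + d} x *\<^sub>R H x + indicator {(q + pi) - (pi - d)..(q + pi) + (pi - d)} x *\<^sub>R H x"
    proof eventually_elim
      case (elim x)
      then show ?case using q by (auto simp: indicator_def d_def)
    qed
  qed measurable
  also have "\<dots> = (\<integral>x. indicator {q - d..q + d} x *\<^sub>R H x \<partial>lborel) +
    (\<integral>x. indicator {(q + pi) - (pi - d)..(q + pi) + (pi - d)} x *\<^sub>R H x \<partial>lborel)"
    by (rule Bochner_Integration.integral_add[OF int int])
  also have "\<dots> = 0"
    by (simp only: integral_odd_symmetric_interval[OF oddq] integral_odd_symmetric_interval[OF shift(2)[OF oddq]] add_0_right)
  finally show ?thesis .
qed

context rectifiable_cycle
begin

text \<open>\<open>cycle_integral\<close> is defined through Stieltjes integrals; its linearity on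
  integrable functions is read off from the representation with the density \<tau>.\<close>

lemma has_cauchy_pv_diff:
  assumes "has_cauchy_pv \<Gamma> f \<zeta> l" "has_cauchy_pv \<Gamma> g \<zeta> l'"
  shows "has_cauchy_pv \<Gamma> (\<lambda>z. f z - g z) \<zeta> (l - l')"
proof -
  have eq: "truncated_kernel (\<lambda>z. f z - g z) \<zeta> \<epsilon> = (\<lambda>z. truncated_kernel f \<zeta> \<epsilon> z - truncated_kernel g \<zeta> \<epsilon> z)" for \<epsilon>
    by (auto simp: truncated_kernel_def diff_divide_distrib)
  have int: "integrable \<mu> (truncated_kernel f \<zeta> \<epsilon>)" "integrable \<mu> (truncated_kernel g \<zeta> \<epsilon>)" if "\<epsilon> > 0" for \<epsilon>
    using assms that by (auto simp: has_cauchy_pv_def)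
  have lim: "((\<lambda>\<epsilon>. 1 / (2 * pi * \<i>) * cycle_integral \<Gamma> (truncated_kernel f \<zeta> \<epsilon>) - 1 / (2 * pi * \<i>) * cycle_integral \<Gamma> (truncated_kernel g \<zeta> \<epsilon>)) \<longlongrightarrow> l - l') (at_right 0)"
    using assms unfolding has_cauchy_pv_def by (intro tendsto_diff) auto
  obtain \<tau> where \<tau>: "\<tau> \<in> borel_measurable borel" "\<And>z. cmod (\<tau> z) = 1"
    "\<And>f. integrable \<mu> f \<Longrightarrow> cycle_integral \<Gamma> f = (\<integral>z. f z * \<tau> z \<partial>\<mu>)"
    using unit_tangent_field by blast
  have \<tau>i: "integrable \<mu> (\<lambda>z. f z * \<tau> z)" if f: "integrable \<mu> f" for f
  proof (rule Bochner_Integration.integrable_bound[OF f])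
    note [measurable] = borel_measurable_\<mu>[OF \<tau>(1)] borel_measurable_integrable[OF f]
    show "(\<lambda>z. f z * \<tau> z) \<in> borel_measurable \<mu>" by measurable
  qed (simp add: norm_mult \<tau>(2))
  have "\<forall>\<^sub>F \<epsilon> in at_right 0. 1 / (2 * pi * \<i>) * cycle_integral \<Gamma> (truncated_kernel f \<zeta> \<epsilon>) - 1 / (2 * pi * \<i>) * cycle_integral \<Gamma> (truncated_kernel g \<zeta> \<epsilon>)
     = 1 / (2 * pi * \<i>) * cycle_integral \<Gamma> (truncated_kernel (\<lambda>z. f z - g z) \<zeta> \<epsilon>)"
    using eventually_at_right_less[of "0::real"]
  proof eventually_elim
    case (elim \<epsilon>)
    note i = int[OF elim]
    have "cycle_integral \<Gamma> (truncated_kernel (\<lambda>z. f z - g z) \<zeta> \<epsilon>) = (\<integral>z. truncated_kernel f \<zeta> \<epsilon> z * \<tau> z - truncated_kernel g \<zeta> \<epsilon> z * \<tau> z \<partial>\<mu>)"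
      unfolding eq using i by (subst \<tau>(3)) (auto simp: left_diff_distrib)
    also have "\<dots> = cycle_integral \<Gamma> (truncated_kernel f \<zeta> \<epsilon>) - cycle_integral \<Gamma> (truncated_kernel g \<zeta> \<epsilon>)"
      using \<tau>i[OF i(1)] \<tau>i[OF i(2)] i by (simp add: \<tau>(3))
    finally show ?case by (simp add: right_diff_distrib)
  qed
  from Lim_transform_eventually[OF lim this] show ?thesis
    unfolding has_cauchy_pv_def eq using int by auto
qed

end

context circle_cycle
begin

text \<open>Up to the factor \<open>\<i> / r\<close> this is the truncated Cauchy kernel times the
  tangent \<open>\<i> * (z - a) / r\<close> of the circle. The truncation is symmetric in
  \<open>z\<close> and \<zeta>, so it respects Hermitian symmetry.\<close>

definition kern :: "real \<Rightarrow> complex \<Rightarrow> complex \<Rightarrow> complex" where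
  "kern \<epsilon> z \<zeta> = (if \<epsilon> \<le> cmod (z - \<zeta>) then (z - a) / (z - \<zeta>) else 0)"

section \<open>Symmetry and uniform bounds for the truncated kernel\<close>

lemma on_circle: "z \<in> C \<longleftrightarrow> cmod (z - a) = r"
  by (simp add: C_eq dist_norm norm_minus_commute)

lemma circle_mult_cnj: "z \<in> C \<Longrightarrow> (z - a) * cnj (z - a) = of_real (r\<^sup>2)"
  using complex_norm_square[of "z - a"] by (simp add: on_circle)

text \<open>For \<open>u = z - a\<close> and \<open>v = \<zeta> - a\<close> of equal modulus
  \<open>r\<close>, both \<open>cnj v * (u - v)\<close> and \<open>u * (cnj v - cnj u)\<close> equal
  \<open>u * cnj v - r\<^sup>2\<close>.\<close>

lemma kern_hermitian:
  assumes "z \<in> C" "\<zeta> \<in> C" "\<epsilon> > 0" shows "cnj (kern \<epsilon> \<zeta> z) = kern \<epsilon> z \<zeta>"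
proof (cases "\<epsilon> \<le> cmod (z - \<zeta>)")
  case True
  define u v where "u = z - a" and "v = \<zeta> - a"
  have uv: "u * cnj u = v * cnj v" using circle_mult_cnj assms by (simp only: u_def v_def)
  have ne: "u \<noteq> v" using True assms(3) by (auto simp: u_def v_def)
  then have ne': "cnj v - cnj u \<noteq> 0" "u - v \<noteq> 0" by auto
  have "cnj v * (u - v) = u * (cnj v - cnj u)" using uv by (simp add: algebra_simps)
  then have "cnj v / (cnj v - cnj u) = u / (u - v)" using ne' by (simp add: frac_eq_eq)
  moreover have "\<zeta> - z = v - u" "z - \<zeta> = u - v" by (simp_all add: u_def v_def)
  moreover have "\<epsilon> \<le> cmod (u - v)" "\<epsilon> \<le> cmod (v - u)"
    using True by (simp_all add: u_def v_def norm_minus_commute)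
  ultimately show ?thesis by (simp add: kern_def u_def[symmetric] v_def[symmetric])
next
  case False
  then show ?thesis by (simp add: kern_def norm_minus_commute)
qed

lemma kern_bound: assumes "z \<in> C" "\<epsilon> > 0" shows "cmod (kern \<epsilon> z \<zeta>) \<le> r / \<epsilon>"
  using assms r by (auto simp: kern_def norm_divide on_circle intro!: frac_le)

lemma kern_measurable [measurable]: "(\<lambda>x. kern \<epsilon> (fst x) (snd x)) \<in> borel_measurable (\<mu> \<Otimes>\<^sub>M \<mu>)"
proof -
  have idm: "(\<lambda>z. z) \<in> borel_measurable \<mu>" by (rule borel_measurable_\<mu>) simp
  have [measurable]: "fst \<in> borel_measurable (\<mu> \<Otimes>\<^sub>M \<mu>)" by (rule measurable_compose[OF measurable_fst idm])
  have [measurable]: "snd \<in> borel_measurable (\<mu> \<Otimes>\<^sub>M \<mu>)" by (rule measurable_compose[OF measurable_snd idm])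
  show ?thesis unfolding kern_def by measurable
qed

lemma kern_measurable1 [measurable]: "(\<lambda>z. kern \<epsilon> z \<zeta>) \<in> borel_measurable \<mu>"
proof -
  have [measurable]: "(\<lambda>z. z) \<in> borel_measurable \<mu>" by (rule borel_measurable_\<mu>) simp
  show ?thesis unfolding kern_def by measurable
qed

lemma kern_integrable:
  assumes f: "f \<in> borel_measurable \<mu>" "\<And>z. z \<in> C \<Longrightarrow> cmod (f z) \<le> B" and \<epsilon>: "\<epsilon> > 0"
  shows "integrable \<mu> (\<lambda>z. f z * kern \<epsilon> z \<zeta>)"
proof (rule integrable_const_bound[where B="B * (r / \<epsilon>)"])
  note [measurable] = f(1)
  show "(\<lambda>z. f z * kern \<epsilon> z \<zeta>) \<in> borel_measurable \<mu>" by measurable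
  show "AE z in \<mu>. cmod (f z * kern \<epsilon> z \<zeta>) \<le> B * (r / \<epsilon>)"
  proof (rule AE_I2)
    fix z assume "z \<in> space \<mu>"
    then have z: "z \<in> C" by simp
    have "0 \<le> B" using f(2)[OF z] norm_ge_zero order_trans by blast
    then show "cmod (f z * kern \<epsilon> z \<zeta>) \<le> B * (r / \<epsilon>)"
      unfolding norm_mult using f(2)[OF z] kern_bound[OF z \<epsilon>] by (intro mult_mono) auto
  qed
qed

text \<open>Up to the additive constant \<open>1/2\<close> the kernel is odd under reflection in the line through \<open>a\<close> and \<open>\<zeta>\<close>.\<close>

lemma kern_integral_bound:
  assumes \<zeta>: "\<zeta> \<in> C" and \<epsilon>: "\<epsilon> > 0"
  shows "cmod (\<integral>z. kern \<epsilon> z \<zeta> \<partial>\<mu>) \<le> measure \<mu> C"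
proof -
  \<comment> \<open>\<open>z - a\<close> is the mean of \<open>z - \<zeta>\<close> and
    \<open>(z - a) + (\<zeta> - a)\<close>. The first contributes the constant 1/2, the second a
    quotient of sum and difference, which is odd in the relative angle.\<close>
  define h1 h2 where "h1 z = (if \<epsilon> \<le> cmod (z - \<zeta>) then 1 / 2 else 0 :: complex)"
    and "h2 z = (if \<epsilon> \<le> cmod (z - \<zeta>) then (z - a + (\<zeta> - a)) / (2 * (z - \<zeta>)) else 0)" for z
  have k_split: "kern \<epsilon> z \<zeta> = h1 z + h2 z" for z
  proof (cases "\<epsilon> \<le> cmod (z - \<zeta>)")
    case True
    then have "z - \<zeta> \<noteq> 0" using \<epsilon> by auto
    then show ?thesis using True by (simp add: kern_def h1_def h2_def field_simps)
  qed (simp add: kern_def h1_def h2_def)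
  have [measurable]: "h1 \<in> borel_measurable borel" "h2 \<in> borel_measurable borel"
    unfolding h1_def h2_def by measurable
  have h2_bound: "cmod (h2 z) \<le> r / \<epsilon>" if "z \<in> C" for z
  proof -
    have "cmod (z - a + (\<zeta> - a)) \<le> 2 * r"
      using norm_triangle_ineq[of "z - a" "\<zeta> - a"] that \<zeta> by (simp add: on_circle)
    then have "cmod (z - a + (\<zeta> - a)) / (2 * cmod (z - \<zeta>)) \<le> (2 * r) / (2 * \<epsilon>)"
      if "\<epsilon> \<le> cmod (z - \<zeta>)"
      using that \<epsilon> r by (intro frac_le) auto
    moreover have "cmod (h2 z) = cmod (z - a + (\<zeta> - a)) / (2 * cmod (z - \<zeta>))" if "\<epsilon> \<le> cmod (z - \<zeta>)"
      using that by (simp only: h2_def if_True norm_divide norm_mult norm_numeral)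
    ultimately show ?thesis using \<epsilon> r by (cases "\<epsilon> \<le> cmod (z - \<zeta>)") (simp_all add: h2_def)
  qed
  have i1: "integrable \<mu> h1"
    by (rule integrable_const_bound[where B=1]) (auto simp: h1_def intro!: borel_measurable_\<mu>)
  have i2: "integrable \<mu> h2"
    by (rule integrable_const_bound[where B="r / \<epsilon>"]) (auto intro!: borel_measurable_\<mu> AE_I2 h2_bound)
  obtain p where p: "\<theta> 0 \<le> p" "p \<le> \<theta> 0 + 2 * pi" "\<zeta> = circ p"
  proof -
    have "\<zeta> \<in> path_image \<gamma>" using \<zeta> path_image_eq C_eq by simp
    then obtain t where "t \<in> {0..1}" "\<zeta> = \<gamma> t" by (auto simp: path_image_def)
    then show ?thesis using that[of "\<theta> t"] \<theta>(2,3) \<theta>_mono[of 0 t] \<theta>_mono[of t 1] by auto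
  qed
  define H where "H s = h2 (circ s)" for s
  have Hm: "H \<in> borel_measurable borel" unfolding H_def by measurable
  \<comment> \<open>The factor \<open>r * cis p\<close> cancels, so only the angle \<open>x\<close>
    relative to \<zeta> remains; the truncation condition is even in \<open>x\<close>.\<close>
  have H_eq: "H (p + x) = (if \<epsilon> \<le> 2 * r * \<bar>sin (x / 2)\<bar> then (cis x + 1) / (2 * (cis x - 1)) else 0)" for x
  proof -
    have "cmod (circ (p + x) - \<zeta>) = 2 * r * \<bar>sin (x / 2)\<bar>"
      using chord_length[of "p + x" p] by (simp add: p(3) dist_norm)
    moreover have "circ (p + x) - \<zeta> = (of_real r * cis p) * (cis x - 1)"
      "circ (p + x) - a + (\<zeta> - a) = (of_real r * cis p) * (cis x + 1)"
      by (simp_all add: p(3) circ_def cis_mult[symmetric] algebra_simps)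
    moreover have "of_real r * cis p \<noteq> 0" using r by simp
    ultimately show ?thesis
      unfolding H_def h2_def by (simp add: mult.left_commute[of 2])
  qed
  have odd: "H (p + x) = - H (p - x)" for x
  proof -
    \<comment> \<open>Multiplying numerator and denominator by \<open>cis x\<close> exchanges
      \<open>cis (- x)\<close> with 1 up to the factor. Where the denominators vanish, both
      quotients are 0 by convention.\<close>
    have *: "(cis x + 1) / (2 * (cis x - 1)) = - ((cis (- x) + 1) / (2 * (cis (- x) - 1)))"
    proof -
      have "(cis (- x) + 1) / (2 * (cis (- x) - 1)) = (cis x * (cis (- x) + 1)) / (cis x * (2 * (cis (- x) - 1)))"
        by simp
      also have "cis x * (cis (- x) + 1) = cis x + 1"
        by (simp add: distrib_left cis_mult)
      also have "cis x * (2 * (cis (- x) - 1)) = - (2 * (cis x - 1))"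
        by (simp add: right_diff_distrib cis_mult mult.left_commute[of "cis x"])
      finally show ?thesis by (simp only: divide_minus_right minus_minus)
    qed
    have eq2: "H (p - x) = (if \<epsilon> \<le> 2 * r * \<bar>sin (x / 2)\<bar> then (cis (- x) + 1) / (2 * (cis (- x) - 1)) else 0)"
      using H_eq[of "- x"] by simp
    show ?thesis unfolding H_eq eq2 using * by simp
  qed
  have "(\<integral>s. indicator {\<theta> 0..\<theta> 0 + 2 * pi} s *\<^sub>R H s \<partial>lborel) = 0"
  proof (rule integral_odd_periodic[OF Hm _ _ odd p(1,2)])
    show "cmod (H x) \<le> r / \<epsilon>" for x unfolding H_def by (rule h2_bound[OF circ_in])
    show "H (x + 2 * pi) = H x" for x by (simp add: H_def circ_def cis_mult[symmetric])
  qed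
  then have "(\<integral>z. h2 z \<partial>\<mu>) = 0"
    using integral_circle[OF borel_measurable_integrable[OF i2]]
    by (simp add: H_def[symmetric] flip: scaleR_scaleR)
  then have "(\<integral>z. kern \<epsilon> z \<zeta> \<partial>\<mu>) = (\<integral>z. h1 z \<partial>\<mu>)"
    using i1 i2 by (simp add: k_split)
  also have "cmod \<dots> \<le> (\<integral>z. 1 \<partial>\<mu>)"
    by (intro Bochner_Integration.integral_norm_bound_integral i1) (simp_all add: h1_def)
  also have "\<dots> = measure \<mu> C" by simp
  finally show ?thesis .
qed

text \<open>After subtracting \<open>f \<zeta>\<close> the Lipschitz condition absorbs the
  singularity and leaves at most \<open>L * r\<close>; the constant \<open>f \<zeta>\<close> meets
  only the integral of the kernel. The bound is independent of \<epsilon>.\<close>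

lemma kern_integral_lipschitz_bound:
  assumes f: "L-lipschitz_on UNIV f" "\<And>z. cmod (f z) \<le> B" and \<zeta>: "\<zeta> \<in> C" and \<epsilon>: "\<epsilon> > 0"
  shows "cmod (\<integral>z. f z * kern \<epsilon> z \<zeta> \<partial>\<mu>) \<le> (L * r + B) * measure \<mu> C"
proof -
  have [measurable]: "f \<in> borel_measurable \<mu>"
    by (intro borel_measurable_\<mu> borel_measurable_continuous_onI lipschitz_on_continuous_on[OF f(1)])
  have i1: "integrable \<mu> (\<lambda>z. f z * kern \<epsilon> z \<zeta>)"
    by (rule kern_integrable[where B=B]) (use f \<epsilon> in auto)
  have i2: "integrable \<mu> (\<lambda>z. f \<zeta> * kern \<epsilon> z \<zeta>)"
    by (rule kern_integrable[where B="cmod (f \<zeta>)"]) (use \<epsilon> in auto)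
  have i3: "integrable \<mu> (\<lambda>z. (f z - f \<zeta>) * kern \<epsilon> z \<zeta>)"
    using i1 i2 by (simp add: left_diff_distrib)
  have pt: "cmod ((f z - f \<zeta>) * kern \<epsilon> z \<zeta>) \<le> L * r" if "z \<in> C" for z
  proof (cases "\<epsilon> \<le> cmod (z - \<zeta>)")
    case True
    then have pos: "cmod (z - \<zeta>) > 0" using \<epsilon> by linarith
    have "cmod (f z - f \<zeta>) \<le> L * cmod (z - \<zeta>)"
      using lipschitz_onD[OF f(1), of z \<zeta>] by (simp add: dist_norm)
    then have "cmod (f z - f \<zeta>) * r \<le> L * cmod (z - \<zeta>) * r" using r by (intro mult_right_mono) auto
    moreover have "cmod ((f z - f \<zeta>) * kern \<epsilon> z \<zeta>) = cmod (f z - f \<zeta>) * r / cmod (z - \<zeta>)"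
      using True that by (simp add: kern_def norm_mult norm_divide on_circle)
    ultimately show ?thesis using pos by (simp only: pos_divide_le_eq ac_simps)
  next
    case False
    then show ?thesis using lipschitz_on_nonneg[OF f(1)] r by (simp add: kern_def)
  qed
  have "(\<integral>z. f z * kern \<epsilon> z \<zeta> \<partial>\<mu>) = (\<integral>z. (f z - f \<zeta>) * kern \<epsilon> z \<zeta> + f \<zeta> * kern \<epsilon> z \<zeta> \<partial>\<mu>)"
    by (intro Bochner_Integration.integral_cong refl) (simp add: left_diff_distrib)
  also have "\<dots> = (\<integral>z. (f z - f \<zeta>) * kern \<epsilon> z \<zeta> \<partial>\<mu>) + (\<integral>z. f \<zeta> * kern \<epsilon> z \<zeta> \<partial>\<mu>)"
    by (rule Bochner_Integration.integral_add[OF i3 i2])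
  finally have "cmod (\<integral>z. f z * kern \<epsilon> z \<zeta> \<partial>\<mu>) \<le> cmod (\<integral>z. (f z - f \<zeta>) * kern \<epsilon> z \<zeta> \<partial>\<mu>) + cmod (\<integral>z. f \<zeta> * kern \<epsilon> z \<zeta> \<partial>\<mu>)"
    by (simp only: norm_triangle_ineq)
  also have "\<dots> \<le> L * r * measure \<mu> C + B * measure \<mu> C"
  proof (rule add_mono)
    have "cmod (\<integral>z. (f z - f \<zeta>) * kern \<epsilon> z \<zeta> \<partial>\<mu>) \<le> (\<integral>z. L * r \<partial>\<mu>)"
      using pt by (intro Bochner_Integration.integral_norm_bound_integral i3) auto
    then show "cmod (\<integral>z. (f z - f \<zeta>) * kern \<epsilon> z \<zeta> \<partial>\<mu>) \<le> L * r * measure \<mu> C" by (simp add: ac_simps)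
    have "cmod (\<integral>z. f \<zeta> * kern \<epsilon> z \<zeta> \<partial>\<mu>) = cmod (f \<zeta>) * cmod (\<integral>z. kern \<epsilon> z \<zeta> \<partial>\<mu>)"
      by (simp add: norm_mult)
    also have "\<dots> \<le> B * measure \<mu> C"
      by (intro mult_mono f(2) kern_integral_bound[OF \<zeta> \<epsilon>] norm_ge_zero order_trans[OF norm_ge_zero f(2)])
    finally show "cmod (\<integral>z. f \<zeta> * kern \<epsilon> z \<zeta> \<partial>\<mu>) \<le> B * measure \<mu> C" .
  qed
  finally show ?thesis by (simp add: algebra_simps)
qed

lemma truncated_symmetric:
  assumes f: "f \<in> borel_measurable \<mu>" "\<And>z. z \<in> C \<Longrightarrow> cmod (f z) \<le> B"
    and g: "g \<in> borel_measurable \<mu>" "\<And>z. z \<in> C \<Longrightarrow> cmod (g z) \<le> B'" and \<epsilon>: "\<epsilon> > 0"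
  shows "(\<integral>\<zeta>. (\<integral>z. f z * kern \<epsilon> z \<zeta> \<partial>\<mu>) * cnj (g \<zeta>) \<partial>\<mu>) = (\<integral>z. f z * cnj (\<integral>\<zeta>. g \<zeta> * kern \<epsilon> \<zeta> z \<partial>\<mu>) \<partial>\<mu>)"
proof -
  interpret pair_sigma_finite \<mu> \<mu> by unfold_locales
  interpret PP: finite_measure "\<mu> \<Otimes>\<^sub>M \<mu>"
    by (rule finite_measure_pair_measure) (rule finite_measure_axioms)+
  note [measurable] = f(1) g(1) measurable_compose[OF g(1) borel_measurable_cnj]
  have "integrable (\<mu> \<Otimes>\<^sub>M \<mu>) (\<lambda>x. f (fst x) * kern \<epsilon> (fst x) (snd x) * cnj (g (snd x)))"
  proof (rule PP.integrable_const_bound[where B="B * (r / \<epsilon>) * B'"])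
    show "AE x in \<mu> \<Otimes>\<^sub>M \<mu>. cmod (f (fst x) * kern \<epsilon> (fst x) (snd x) * cnj (g (snd x))) \<le> B * (r / \<epsilon>) * B'"
    proof (rule AE_I2)
      fix x assume "x \<in> space (\<mu> \<Otimes>\<^sub>M \<mu>)"
      then have x: "fst x \<in> C" "snd x \<in> C" by (auto simp: space_pair_measure)
      have "0 \<le> B" using f(2)[OF x(1)] norm_ge_zero order_trans by blast
      then show "cmod (f (fst x) * kern \<epsilon> (fst x) (snd x) * cnj (g (snd x))) \<le> B * (r / \<epsilon>) * B'"
        unfolding norm_mult complex_mod_cnj
        using f(2)[OF x(1)] g(2)[OF x(2)] kern_bound[OF x(1) \<epsilon>] r \<epsilon> by (intro mult_mono) auto
    qed
  qed measurable
  then have "(\<integral>\<zeta>. (\<integral>z. f z * kern \<epsilon> z \<zeta> * cnj (g \<zeta>) \<partial>\<mu>) \<partial>\<mu>) = (\<integral>z. (\<integral>\<zeta>. f z * kern \<epsilon> z \<zeta> * cnj (g \<zeta>) \<partial>\<mu>) \<partial>\<mu>)"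
    using Fubini_integral[of "\<lambda>z \<zeta>. f z * kern \<epsilon> z \<zeta> * cnj (g \<zeta>)"] by (simp add: case_prod_beta')
  moreover have "(\<integral>z. f z * kern \<epsilon> z \<zeta> * cnj (g \<zeta>) \<partial>\<mu>) = (\<integral>z. f z * kern \<epsilon> z \<zeta> \<partial>\<mu>) * cnj (g \<zeta>)" for \<zeta>
    by (rule integral_mult_left_zero)
  moreover have "(\<integral>\<zeta>. f z * kern \<epsilon> z \<zeta> * cnj (g \<zeta>) \<partial>\<mu>) = f z * cnj (\<integral>\<zeta>. g \<zeta> * kern \<epsilon> \<zeta> z \<partial>\<mu>)" if z: "z \<in> C" for z
  proof -
    have "(\<integral>\<zeta>. f z * kern \<epsilon> z \<zeta> * cnj (g \<zeta>) \<partial>\<mu>) = (\<integral>\<zeta>. f z * cnj (g \<zeta> * kern \<epsilon> \<zeta> z) \<partial>\<mu>)"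
      using kern_hermitian[OF z _ \<epsilon>] by (intro Bochner_Integration.integral_cong) auto
    also have "\<dots> = f z * (\<integral>\<zeta>. cnj (g \<zeta> * kern \<epsilon> \<zeta> z) \<partial>\<mu>)" by (rule integral_mult_right_zero)
    also have "(\<integral>\<zeta>. cnj (g \<zeta> * kern \<epsilon> \<zeta> z) \<partial>\<mu>) = cnj (\<integral>\<zeta>. g \<zeta> * kern \<epsilon> \<zeta> z \<partial>\<mu>)"
      by (rule integral_bounded_linear'[OF bounded_linear_cnj bounded_linear_cnj]) simp
    finally show ?thesis .
  qed
  then have "(\<integral>z. (\<integral>\<zeta>. f z * kern \<epsilon> z \<zeta> * cnj (g \<zeta>) \<partial>\<mu>) \<partial>\<mu>) = (\<integral>z. f z * cnj (\<integral>\<zeta>. g \<zeta> * kern \<epsilon> \<zeta> z \<partial>\<mu>) \<partial>\<mu>)"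
    by (intro Bochner_Integration.integral_cong refl) simp
  ultimately show ?thesis by (simp only:)
qed

text \<open>The factor \<i> of the tangent cancels the one in \<open>2 * pi * \<i>\<close>. The
  remaining constant is real, which is what preserves the Hermitian symmetry.\<close>

lemma truncated_integral_circle:
  assumes "integrable \<mu> (truncated_kernel f \<zeta> \<epsilon>)"
  shows "1 / (2 * pi * \<i>) * cycle_integral \<Gamma> (truncated_kernel f \<zeta> \<epsilon>) = 1 / (2 * pi * r) * (\<integral>z. f z * kern \<epsilon> z \<zeta> \<partial>\<mu>)"
proof -
  have "cycle_integral \<Gamma> (truncated_kernel f \<zeta> \<epsilon>) = (\<integral>z. truncated_kernel f \<zeta> \<epsilon> z * (\<i> * (z - a) / r) \<partial>\<mu>)"
    by (rule cycle_integral_circle[OF assms])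
  also have "\<dots> = (\<integral>z. (\<i> / r) * (f z * kern \<epsilon> z \<zeta>) \<partial>\<mu>)"
    by (rule Bochner_Integration.integral_cong) (auto simp: truncated_kernel_def kern_def)
  also have "\<dots> = (\<i> / r) * (\<integral>z. f z * kern \<epsilon> z \<zeta> \<partial>\<mu>)" by (rule integral_mult_right_zero)
  finally show ?thesis using r by simp
qed

text \<open>A sequence of truncations is singled out because dominated convergence will be applied
  to it.\<close>

lemma cauchy_singular_limit:
  assumes "\<exists>l. has_cauchy_pv \<Gamma> f \<zeta> l"
  shows "(\<lambda>n. 1 / (2 * pi * r) * (\<integral>z. f z * kern (1 / real (Suc n)) z \<zeta> \<partial>\<mu>)) \<longlonglongrightarrow> cauchy_singular \<Gamma> f \<zeta>"
proof -
  obtain l where l: "has_cauchy_pv \<Gamma> f \<zeta> l" using assms by blast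
  have lim: "((\<lambda>\<epsilon>. 1 / (2 * pi * \<i>) * cycle_integral \<Gamma> (truncated_kernel f \<zeta> \<epsilon>)) \<longlongrightarrow> l) (at_right 0)"
    and int: "\<And>\<epsilon>. \<epsilon> > 0 \<Longrightarrow> integrable \<mu> (truncated_kernel f \<zeta> \<epsilon>)"
    using l by (auto simp: has_cauchy_pv_def)
  have "filterlim (\<lambda>n. 1 / real (Suc n)) (at_right 0) sequentially"
    unfolding filterlim_at using LIMSEQ_inverse_real_of_nat by (auto simp: inverse_eq_divide)
  from filterlim_compose[OF lim this]
  have "(\<lambda>n. 1 / (2 * pi * \<i>) * cycle_integral \<Gamma> (truncated_kernel f \<zeta> (1 / real (Suc n)))) \<longlonglongrightarrow> l" .
  then show ?thesis unfolding cauchy_singular_eq[OF l] by (subst (asm) truncated_integral_circle) (auto intro: int)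
qed

text \<open>For a fixed truncation the forms of \<open>f\<close> and \<open>g\<close> are conjugate
  to each other by \<open>truncated_symmetric\<close>. The bound that is uniform in \<epsilon> lets
  both pass to the limit.\<close>

lemma cauchy_singular_symmetric_lipschitz:
  assumes f: "f \<in> bounded_lipschitz" and g: "g \<in> bounded_lipschitz"
    and pv: "AE \<zeta> in \<mu>. \<exists>l. has_cauchy_pv \<Gamma> f \<zeta> l" "AE \<zeta> in \<mu>. \<exists>l. has_cauchy_pv \<Gamma> g \<zeta> l"
    and Tm: "cauchy_singular \<Gamma> f \<in> borel_measurable \<mu>" "cauchy_singular \<Gamma> g \<in> borel_measurable \<mu>"
  shows "(\<integral>z. cauchy_singular \<Gamma> f z * cnj (g z) \<partial>\<mu>) = (\<integral>z. f z * cnj (cauchy_singular \<Gamma> g z) \<partial>\<mu>)"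
proof -
  have key: "(\<lambda>n. \<integral>\<zeta>. (1 / (2 * pi * r) * (\<integral>z. f z * kern (1 / real (Suc n)) z \<zeta> \<partial>\<mu>)) * cnj (g \<zeta>) \<partial>\<mu>)
    \<longlonglongrightarrow> (\<integral>z. cauchy_singular \<Gamma> f z * cnj (g z) \<partial>\<mu>)"
    if f: "f \<in> bounded_lipschitz" and g: "g \<in> bounded_lipschitz" and pv: "AE \<zeta> in \<mu>. \<exists>l. has_cauchy_pv \<Gamma> f \<zeta> l"
      and Tm: "cauchy_singular \<Gamma> f \<in> borel_measurable \<mu>" for f g
  proof -
    obtain L B where L: "L-lipschitz_on UNIV f" and B: "\<And>z. cmod (f z) \<le> B"
      using f by (auto simp: bounded_lipschitz_def bounded_iff)
    obtain B' where B': "\<And>z. cmod (g z) \<le> B'"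
      using g by (auto simp: bounded_lipschitz_def bounded_iff)
    have B'0: "0 \<le> B'" using B'[of 0] norm_ge_zero order_trans by blast
    have fm[measurable]: "f \<in> borel_measurable \<mu>" and gm: "g \<in> borel_measurable \<mu>"
      using f g by (auto intro!: borel_measurable_\<mu> bounded_lipschitz_measurable)
    note [measurable] = measurable_compose[OF gm borel_measurable_cnj] Tm
    have Km[measurable]: "(\<lambda>\<zeta>. \<integral>z. f z * kern \<epsilon> z \<zeta> \<partial>\<mu>) \<in> borel_measurable \<mu>" for \<epsilon>
    proof (rule borel_measurable_lebesgue_integral)
      have "(\<lambda>x. f (snd x) * kern \<epsilon> (snd x) (fst x)) \<in> borel_measurable (\<mu> \<Otimes>\<^sub>M \<mu>)"
      proof (intro borel_measurable_times)
        show "(\<lambda>x. kern \<epsilon> (snd x) (fst x)) \<in> borel_measurable (\<mu> \<Otimes>\<^sub>M \<mu>)"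
          using measurable_compose[OF measurable_Pair[OF measurable_snd measurable_fst] kern_measurable] by simp
      qed measurable
      then show "(\<lambda>(\<zeta>, z). f z * kern \<epsilon> z \<zeta>) \<in> borel_measurable (\<mu> \<Otimes>\<^sub>M \<mu>)" by (simp add: case_prod_beta')
    qed
    \<comment> \<open>The majorant depends neither on \<open>n\<close> nor on \<zeta>, and constants
      are integrable because \<mu> is finite.\<close>
    let ?W = "1 / (2 * pi * r) * ((L * r + B) * measure \<mu> C) * B'"
    show ?thesis
    proof (rule integral_dominated_convergence[where w="\<lambda>_. ?W"])
      show "AE \<zeta> in \<mu>. (\<lambda>n. (1 / (2 * pi * r) * (\<integral>z. f z * kern (1 / real (Suc n)) z \<zeta> \<partial>\<mu>)) * cnj (g \<zeta>))
        \<longlonglongrightarrow> cauchy_singular \<Gamma> f \<zeta> * cnj (g \<zeta>)"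
        using pv
      proof eventually_elim
        case (elim \<zeta>)
        show ?case by (intro tendsto_mult tendsto_const cauchy_singular_limit elim)
      qed
      show "AE \<zeta> in \<mu>. norm ((1 / (2 * pi * r) * (\<integral>z. f z * kern (1 / real (Suc n)) z \<zeta> \<partial>\<mu>)) * cnj (g \<zeta>)) \<le> ?W" for n
      proof (rule AE_I2)
        fix \<zeta> assume "\<zeta> \<in> space \<mu>"
        then have \<zeta>: "\<zeta> \<in> C" by simp
        have "cmod (1 / (2 * pi * r) * (\<integral>z. f z * kern (1 / real (Suc n)) z \<zeta> \<partial>\<mu>)) =
          1 / (2 * pi * r) * cmod (\<integral>z. f z * kern (1 / real (Suc n)) z \<zeta> \<partial>\<mu>)"
          using r by (simp add: norm_mult norm_divide)
        also have "\<dots> \<le> 1 / (2 * pi * r) * ((L * r + B) * measure \<mu> C)"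
          using r by (intro mult_left_mono kern_integral_lipschitz_bound[OF L B \<zeta>]) auto
        finally have 1: "cmod (1 / (2 * pi * r) * (\<integral>z. f z * kern (1 / real (Suc n)) z \<zeta> \<partial>\<mu>)) \<le> 1 / (2 * pi * r) * ((L * r + B) * measure \<mu> C)" .
        then show "norm ((1 / (2 * pi * r) * (\<integral>z. f z * kern (1 / real (Suc n)) z \<zeta> \<partial>\<mu>)) * cnj (g \<zeta>)) \<le> ?W"
          unfolding norm_mult[of _ "cnj (g \<zeta>)"] complex_mod_cnj
          by (intro mult_mono 1 B' norm_ge_zero order_trans[OF norm_ge_zero 1])
      qed
      show "(\<lambda>\<zeta>. (1 / (2 * pi * r) * (\<integral>z. f z * kern (1 / real (Suc n)) z \<zeta> \<partial>\<mu>)) * cnj (g \<zeta>)) \<in> borel_measurable \<mu>" for n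
        by (intro borel_measurable_times borel_measurable_const Km measurable_compose[OF gm borel_measurable_cnj])
      show "(\<lambda>\<zeta>. cauchy_singular \<Gamma> f \<zeta> * cnj (g \<zeta>)) \<in> borel_measurable \<mu>"
        by (intro borel_measurable_times Tm measurable_compose[OF gm borel_measurable_cnj])
    qed simp
  qed
  have fb: "f \<in> borel_measurable \<mu>" "g \<in> borel_measurable \<mu>"
    using f g by (auto intro!: borel_measurable_\<mu> bounded_lipschitz_measurable)
  obtain B B' where B: "\<And>z. cmod (f z) \<le> B" "\<And>z. cmod (g z) \<le> B'"
    using f g by (auto simp: bounded_lipschitz_def bounded_iff)
  define c where "c = 1 / (2 * pi * r)"
  have eq: "(\<integral>\<zeta>. (c * (\<integral>z. f z * kern (1 / real (Suc n)) z \<zeta> \<partial>\<mu>)) * cnj (g \<zeta>) \<partial>\<mu>) =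
     cnj (\<integral>\<zeta>. (c * (\<integral>z. g z * kern (1 / real (Suc n)) z \<zeta> \<partial>\<mu>)) * cnj (f \<zeta>) \<partial>\<mu>)" for n
  proof -
    let ?\<epsilon> = "1 / real (Suc n)"
    have "(\<integral>\<zeta>. (c * (\<integral>z. f z * kern ?\<epsilon> z \<zeta> \<partial>\<mu>)) * cnj (g \<zeta>) \<partial>\<mu>) = c * (\<integral>\<zeta>. (\<integral>z. f z * kern ?\<epsilon> z \<zeta> \<partial>\<mu>) * cnj (g \<zeta>) \<partial>\<mu>)"
      by (simp only: mult.assoc integral_mult_right_zero)
    also have "(\<integral>\<zeta>. (\<integral>z. f z * kern ?\<epsilon> z \<zeta> \<partial>\<mu>) * cnj (g \<zeta>) \<partial>\<mu>) = (\<integral>z. f z * cnj (\<integral>\<zeta>. g \<zeta> * kern ?\<epsilon> \<zeta> z \<partial>\<mu>) \<partial>\<mu>)"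
      by (rule truncated_symmetric[where B=B and B'=B']) (use fb B in auto)
    also have "\<dots> = (\<integral>\<zeta>. cnj ((\<integral>z. g z * kern ?\<epsilon> z \<zeta> \<partial>\<mu>) * cnj (f \<zeta>)) \<partial>\<mu>)"
      by (intro Bochner_Integration.integral_cong refl) (simp only: complex_cnj_mult complex_cnj_cnj mult.commute)
    also have "\<dots> = cnj (\<integral>\<zeta>. (\<integral>z. g z * kern ?\<epsilon> z \<zeta> \<partial>\<mu>) * cnj (f \<zeta>) \<partial>\<mu>)"
      by (rule integral_bounded_linear'[OF bounded_linear_cnj bounded_linear_cnj]) simp
    also have "c * \<dots> = cnj (c * (\<integral>\<zeta>. (\<integral>z. g z * kern ?\<epsilon> z \<zeta> \<partial>\<mu>) * cnj (f \<zeta>) \<partial>\<mu>))" by simp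
    also have "c * (\<integral>\<zeta>. (\<integral>z. g z * kern ?\<epsilon> z \<zeta> \<partial>\<mu>) * cnj (f \<zeta>) \<partial>\<mu>) = (\<integral>\<zeta>. (c * (\<integral>z. g z * kern ?\<epsilon> z \<zeta> \<partial>\<mu>)) * cnj (f \<zeta>) \<partial>\<mu>)"
      by (simp only: mult.assoc integral_mult_right_zero)
    finally show ?thesis .
  qed
  \<comment> \<open>By \<open>eq\<close> the same sequence has two limits, one from
    \<open>key\<close> for each order of \<open>f\<close> and \<open>g\<close>.\<close>
  have "(\<lambda>n. cnj (\<integral>\<zeta>. (c * (\<integral>z. g z * kern (1 / real (Suc n)) z \<zeta> \<partial>\<mu>)) * cnj (f \<zeta>) \<partial>\<mu>))
     \<longlonglongrightarrow> cnj (\<integral>z. cauchy_singular \<Gamma> g z * cnj (f z) \<partial>\<mu>)"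
    using key[OF g f pv(2) Tm(2)] unfolding c_def by (intro tendsto_cnj) simp
  moreover have "(\<lambda>n. cnj (\<integral>\<zeta>. (c * (\<integral>z. g z * kern (1 / real (Suc n)) z \<zeta> \<partial>\<mu>)) * cnj (f \<zeta>) \<partial>\<mu>))
     \<longlonglongrightarrow> (\<integral>z. cauchy_singular \<Gamma> f z * cnj (g z) \<partial>\<mu>)"
    using key[OF f g pv(1) Tm(1)] unfolding eq[symmetric] unfolding c_def by simp
  ultimately have "(\<integral>z. cauchy_singular \<Gamma> f z * cnj (g z) \<partial>\<mu>) = cnj (\<integral>z. cauchy_singular \<Gamma> g z * cnj (f z) \<partial>\<mu>)"
    using LIMSEQ_unique by blast
  also have "\<dots> = (\<integral>z. cnj (cauchy_singular \<Gamma> g z * cnj (f z)) \<partial>\<mu>)"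
    by (rule integral_bounded_linear'[OF bounded_linear_cnj bounded_linear_cnj, symmetric]) simp
  also have "\<dots> = (\<integral>z. f z * cnj (cauchy_singular \<Gamma> g z) \<partial>\<mu>)"
    by (intro Bochner_Integration.integral_cong refl) (simp only: complex_cnj_mult complex_cnj_cnj mult.commute)
  finally show ?thesis .
qed

text \<open>A positive constant weight only rescales the measure: null sets, the space and the
  operator bound are those of \<mu>, and inner products change by the factor \<open>c\<close>.
  Existence of the principal values almost everywhere makes the operator linear almost
  everywhere.\<close>

theorem circle_imp_self_adjoint:
  assumes w: "w \<in> borel_measurable \<mu>" "AE z in \<mu>. w z = c" "c > 0"
    and bd: "cauchy_singular_bounded \<Gamma> w"
  shows "self_adjoint_in_L2 (weighted_measure \<Gamma> w) (cauchy_singular \<Gamma>)"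
proof -
  let ?\<nu> = "weighted_measure \<Gamma> w" and ?T = "cauchy_singular \<Gamma>"
  have \<nu>: "?\<nu> = density \<mu> (\<lambda>_. ennreal c)"
    unfolding weighted_measure_def using w(1,2) by (intro density_cong) auto
  have int_iff: "integrable ?\<nu> f \<longleftrightarrow> integrable \<mu> f" if "f \<in> borel_measurable \<mu>" for f :: "complex \<Rightarrow> real"
    unfolding \<nu> using w(3) that by (subst integrable_density) auto
  have L2_eq: "L2 ?\<nu> = L2 \<mu>"
    unfolding L2_def using int_iff by (auto simp: \<nu>)
  have AE_iff: "(AE z in ?\<nu>. P z) \<longleftrightarrow> (AE z in \<mu>. P z)" for P
    unfolding \<nu> using w(3) by (subst AE_density) auto
  have norm_eq: "L2_norm ?\<nu> f = sqrt (c / (2 * pi)) * sqrt (L2_sq \<mu> f)" if f: "f \<in> L2 \<mu>" for f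
  proof -
    have "(\<integral>z. (cmod (f z))\<^sup>2 \<partial>?\<nu>) = c * L2_sq \<mu> f"
      unfolding \<nu> L2_sq_def using f w(3) by (subst integral_density) (auto simp: L2_def)
    then show ?thesis by (simp add: L2_norm_def real_sqrt_mult real_sqrt_divide)
  qed
  obtain M where M: "\<And>f. f \<in> L2 \<mu> \<Longrightarrow> AE \<zeta> in \<mu>. \<exists>l. has_cauchy_pv \<Gamma> f \<zeta> l"
    "\<And>f. f \<in> L2 \<mu> \<Longrightarrow> ?T f \<in> L2 \<mu>" "\<And>f. f \<in> L2 \<mu> \<Longrightarrow> L2_norm ?\<nu> (?T f) \<le> M * L2_norm ?\<nu> f"
    using bd unfolding cauchy_singular_bounded_def L2_eq AE_iff by blast
  have sym: "(\<integral>z. ?T f z * cnj (g z) \<partial>\<mu>) = (\<integral>z. f z * cnj (?T g z) \<partial>\<mu>)" if fg: "f \<in> L2 \<mu>" "g \<in> L2 \<mu>" for f g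
  proof (rule symmetric_on_dense_imp_symmetric[where K=M and D=bounded_lipschitz, OF M(2) _ _ _ _ _ fg])
    fix f assume f: "f \<in> L2 \<mu>"
    show "sqrt (L2_sq \<mu> (?T f)) \<le> M * sqrt (L2_sq \<mu> f)"
    proof -
      have "sqrt (c / (2 * pi)) * sqrt (L2_sq \<mu> (?T f)) \<le> sqrt (c / (2 * pi)) * (M * sqrt (L2_sq \<mu> f))"
        using M(3)[OF f] norm_eq[OF f] norm_eq[OF M(2)[OF f]] by (simp add: mult.left_commute)
      moreover have "sqrt (c / (2 * pi)) > 0" using w(3) by simp
      ultimately show ?thesis by (simp only: mult_le_cancel_left_pos)
    qed
    fix g assume g: "g \<in> L2 \<mu>"
    show "AE z in \<mu>. ?T (\<lambda>z. f z - g z) z = ?T f z - ?T g z"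
      using M(1)[OF f] M(1)[OF g]
    proof eventually_elim
      case (elim z)
      then obtain l l' where "has_cauchy_pv \<Gamma> f z l" "has_cauchy_pv \<Gamma> g z l'" by blast
      then show ?case using has_cauchy_pv_diff cauchy_singular_eq by metis
    qed
  next
    fix f g assume fg: "f \<in> bounded_lipschitz" "g \<in> bounded_lipschitz"
    then have L: "f \<in> L2 \<mu>" "g \<in> L2 \<mu>" by (auto intro: bounded_lipschitz_L2)
    show "(\<integral>z. ?T f z * cnj (g z) \<partial>\<mu>) = (\<integral>z. f z * cnj (?T g z) \<partial>\<mu>)"
      using M(2)[OF L(1)] M(2)[OF L(2)]
      by (intro cauchy_singular_symmetric_lipschitz fg M(1) L) (auto simp: L2_def)
  qed (auto intro: bounded_lipschitz_L2 bounded_lipschitz_dense)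
  have inner_eq: "L2_inner ?\<nu> f g = of_real c / (2 * pi) * (\<integral>z. f z * cnj (g z) \<partial>\<mu>)" if "f \<in> L2 \<mu>" "g \<in> L2 \<mu>" for f g
  proof -
    have "(\<lambda>z. f z * cnj (g z)) \<in> borel_measurable \<mu>"
      using L2_Cauchy_Schwarz(1)[OF that] by (rule borel_measurable_integrable)
    then have "(\<integral>z. f z * cnj (g z) \<partial>?\<nu>) = of_real c * (\<integral>z. f z * cnj (g z) \<partial>\<mu>)"
      unfolding \<nu> using w(3) by (subst integral_density) (auto simp: scaleR_conv_of_real)
    then show ?thesis by (simp add: L2_inner_def)
  qed
  show ?thesis
    unfolding self_adjoint_in_L2_def L2_eq
    using M(2) sym by (auto simp: inner_eq)
qed

end

section \<open>The equivalence for the boundary of a bounded domain\<close>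

theorem corollary2:
  fixes G :: "complex set"
    and \<Gamma> :: "(real \<Rightarrow> complex) set"
    and C :: "complex set"
    and w :: "complex \<Rightarrow> real"
  assumes "finitely_connected_domain G" and "bounded G"
    and "C = frontier G"
    and "boundary_cycle \<Gamma> G"
    and "\<forall>\<gamma>\<in>\<Gamma>. rectifiable \<gamma>"
    and "carleson \<Gamma>"
    and "w \<in> borel_measurable (arclength_measure \<Gamma>)"
    and "\<forall>z\<in>C. 0 \<le> w z"
    and "\<forall>K\<in>components C. \<not> (AE z in arclength_measure \<Gamma>. z \<in> K \<longrightarrow> w z = 0)"
    and "cauchy_singular_bounded \<Gamma> w"
  shows "self_adjoint_in_L2 (weighted_measure \<Gamma> w) (cauchy_singular \<Gamma>) \<longleftrightarrow>
    (\<exists>a r. 0 < r \<and> C = sphere a r) \<and> (\<exists>c. AE z in arclength_measure \<Gamma>. w z = c)"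
proof -
  have G: "open G" "bounded G" "G \<noteq> {}" using assms(1,2) by (auto simp: finitely_connected_domain_def)
  have bc: "finite \<Gamma>" "\<And>\<gamma>. \<gamma> \<in> \<Gamma> \<Longrightarrow> simple_path \<gamma>" "\<And>\<gamma>. \<gamma> \<in> \<Gamma> \<Longrightarrow> pathfinish \<gamma> = pathstart \<gamma>"
    "disjoint_family_on path_image \<Gamma>" "frontier G = cycle_image \<Gamma>" "positively_oriented \<Gamma> G"
    using assms(4) by (auto simp: boundary_cycle_def)
  interpret R: rectifiable_cycle \<Gamma>
    by unfold_locales (use bc assms(5) in auto)
  have C: "C = cycle_image \<Gamma>" using assms(3) bc(5) by simp
  have ne: "C \<noteq> {}" using G assms(3) frontier_eq_empty[of G] not_bounded_UNIV by auto
  \<comment> \<open>A bounded nonempty open set has nonempty frontier, so \<open>C\<close> has a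
    component, and \<open>w\<close> does not vanish almost everywhere on it.\<close>
  have w0: "\<not> (AE z in arclength_measure \<Gamma>. w z = 0)"
  proof
    assume "AE z in arclength_measure \<Gamma>. w z = 0"
    then have "AE z in arclength_measure \<Gamma>. z \<in> K \<longrightarrow> w z = 0" for K
      by eventually_elim simp
    moreover obtain K where "K \<in> components C" using ne components_eq_empty by blast
    ultimately show False using assms(9) by blast
  qed
  have wC: "\<And>z. z \<in> cycle_image \<Gamma> \<Longrightarrow> 0 \<le> w z" using assms(8) C by simp
  show ?thesis
  proof
    assume "self_adjoint_in_L2 (weighted_measure \<Gamma> w) (cauchy_singular \<Gamma>)"
    then show "(\<exists>a r. 0 < r \<and> C = sphere a r) \<and> (\<exists>c. AE z in arclength_measure \<Gamma>. w z = c)"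
      using R.self_adjoint_imp_circle[OF G bc(5) assms(7) wC w0] C by simp
  next
    assume "(\<exists>a r. 0 < r \<and> C = sphere a r) \<and> (\<exists>c. AE z in arclength_measure \<Gamma>. w z = c)"
    then obtain a r c where ar: "0 < r" "C = sphere a r" and c: "AE z in arclength_measure \<Gamma>. w z = c" by blast
    have Gball: "G = ball a r"
      by (rule bounded_open_frontier_subset_sphere(1)[OF G ar(1)]) (use assms(3) ar(2) in simp)
    obtain \<gamma> where \<gamma>: "\<gamma> \<in> \<Gamma>" using ne C by (auto simp: cycle_image_def)
    \<comment> \<open>Several curves would split the connected circle into two disjoint nonempty
      closed sets.\<close>
    have "\<Gamma> = {\<gamma>}"
    proof (rule ccontr)
      assume "\<Gamma> \<noteq> {\<gamma>}"
      then obtain \<delta> where \<delta>: "\<delta> \<in> \<Gamma>" "\<delta> \<noteq> \<gamma>" using \<gamma> by blast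
      let ?Q = "\<Union>\<delta>\<in>\<Gamma> - {\<gamma>}. path_image \<delta>"
      have cl: "closed (path_image \<gamma>)" "closed ?Q"
        using bc(1) R.paths \<gamma> by (auto intro!: closed_UN closed_path_image)
      have "path_image \<gamma> \<inter> ?Q \<inter> sphere a r = {}"
        using bc(4) \<gamma> by (auto simp: disjoint_family_on_def)
      moreover have "sphere a r \<subseteq> path_image \<gamma> \<union> ?Q"
        unfolding ar(2)[symmetric] C cycle_image_def by auto
      moreover have "connected (sphere a r)" by (rule connected_sphere) simp
      ultimately have "path_image \<gamma> \<inter> sphere a r = {} \<or> ?Q \<inter> sphere a r = {}"
        using connected_closedD[OF _ _ _ cl] by blast
      moreover have "path_image \<gamma> \<subseteq> sphere a r" "path_image \<delta> \<subseteq> sphere a r" "path_image \<delta> \<subseteq> ?Q"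
        using R.path_image_subset \<gamma> \<delta> unfolding ar(2)[symmetric] C by auto
      moreover have "path_image \<gamma> \<noteq> {}" "path_image \<delta> \<noteq> {}" by auto
      ultimately show False by blast
    qed
    \<comment> \<open>The centre lies in \<open>G\<close>, so positive orientation gives the sum of
      winding numbers there, which has a single term.\<close>
    moreover have "winding_number \<gamma> a = 1"
    proof -
      have "a \<notin> cycle_image \<Gamma>" "a \<in> G" using ar C Gball by auto
      then have "(\<Sum>\<gamma>\<in>\<Gamma>. winding_number \<gamma> a) = 1" using bc(6) by (simp add: positively_oriented_def)
      then show ?thesis using \<open>\<Gamma> = {\<gamma>}\<close> by simp
    qed
    ultimately interpret K: circle_cycle \<Gamma> a r \<gamma>
      by unfold_locales (use ar C in auto)
    \<comment> \<open>A negative value is excluded at a single point of \<open>C\<close> where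
      \<open>w z = c\<close>, the value 0 by \<open>w0\<close>.\<close>
    have "c > 0"
    proof (rule ccontr)
      assume "\<not> c > 0"
      moreover obtain p where "p \<in> cycle_image \<Gamma>" using ne C by blast
      ultimately have "c = 0" using R.AE_dense[OF c _ zero_less_one] wC by (metis less_eq_real_def)
      then show False using w0 c by simp
    qed
    then show "self_adjoint_in_L2 (weighted_measure \<Gamma> w) (cauchy_singular \<Gamma>)"
      by (rule K.circle_imp_self_adjoint[OF assms(7) c _ assms(10)])
  qed
qed

end
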